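(* There is a universal constant $c>0$ such that the following holds. Consider the class $\mathcal{P}_{OSS}^{Gauss}$ of data-generating mechanisms described in the context, with parameters satisfying $C_X\ge\sqrt{8\lambda_+/3}$, $\kappa_\epsilon\ge 105^{1/4}$ and $\lambda_-<\lambda_+$. For $z\in\mathbb{R}^p$ and $j\in[K]$ define $D_j(z)=\frac{R^2}{R^2+\|z_{M_j}\|_2^2}$, and for $i\in[p]$ define $\alpha_i(z)=\sum_{j=1}^K n_jD_j(z)\mathbb{1}_{\{i\in O_j\}}$. Assume that for all $i\in[p]$ $$\inf_{z\in\mathbb{R}^p:\|z\|_2\le B}\{\alpha_i(z)\}\ge\frac12\max\left\{\frac{1}{\lambda_-},\lambda_-\right\}\max\left\{\frac{R^2}{B^2},\frac{B^2}{R^2}\right\}p,$$ and that for all $i\in[p]$ $$\min\{1,\lambda_+^2\}\sum_{j\in[p]\setminus\{i\}}\min\left\{\frac{B^2}{N+n_{\xi(j),\xi(i)}},\frac{R^2}{n_{\xi(j),\xi(i)}}\right\}\le 2B^2(\lambda_+-\lambda_-)^2.$$ Then, provided $|L_i|\ge 2$ for all $i\in[L]$, $$\inf_{\hat\beta\in\hat\Theta_{OSS}}\sup_{P\in\mathcal{P}_{OSS}^{Gauss}}\mathbb{E}\left[\|\hat\beta-\beta^*(P)\|_2^2\right]\ge c\left(\sup_{z\in\mathbb{R}^p:\|z\|_2\le B}\left\{\frac{R^2}{\max\{1,\lambda_-\}}\sum_{i=1}^p\frac{1}{\alpha_i(z)}\right\}+\min\{\lambda_+^{-2},1\}\max_{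i\in[p]}\sum_{j\in[p]\setminus\{i\}}\min\left\{\frac{B^2}{N+n_{\xi(j),\xi(i)}},\frac{R^2}{n_{\xi(j),\xi(i)}}\right\}\right).$$
   Context: Data model: $(X,Y)\in\mathbb{R}^p\times\mathbb{R}$ with $X\sim P_X$, $\Sigma=\mathbb{E}[XX^T]$, and $Y=X^T\beta^*+\epsilon$ with $\beta^*\in\mathbb{R}^p$, $\mathbb{E}[\epsilon|X]=0$, $\mathrm{Var}[\epsilon|X]=\sigma^2$. There are $K$ fixed missingness patterns with observed sets $O_k\subseteq[p]$, $M_k=[p]\setminus O_k$, $\cup_kO_k=[p]$. The labelled data consist, independently over $k\in[K]$, of $n_k$ i.i.d. copies of $(X_{O_k},Y)$; in addition there are $N\ge 0$ unlabelled i.i.d. copies of $X$, independent of the labelled data. The modalities $L_1,\dots,L_L$ form the partition of $[p]$ with the smallest number $L$ of parts such that each $O_k$ is a union of parts; $\xi:[p]\to[L]$ is defined by $\xi(j)=i$ for $j\in L_i$. For $g,h\in[L]$, $n_{g,h}=\sum_{k=1}^K n_k\mathbb{1}_{\{L_g\cup L_h\subseteq O_k\}}$. Fractions with zero denominator and positive numerator are $+\infty$. Class: fix $R,B>0$, $0<\lambda_-\le\lambda_+$, $\chi\in(0,1]$, $C\ge1$, $\kappa_\epsilon\ge1$, $C_X>0$. $\mathcal{P}_{OSS}$ is the set of distributions of the full data on $\mathcal X=\prod_{k=1}^K(\mathbb{R}^{|O_k|+1})^{n_k}\times(\mathbb{R}^p)^N$ that arise when $Y=X^T\beta^*+\epsilon$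 with $\mathbb{E}[\epsilon|X]=0$ and $\mathrm{Var}[\epsilon|X]=\sigma^2$, and the data consist, independently over $k\in[K]$, of $n_k$ i.i.d. copies of $(X_{O_k},Y)$ together with $N$ independent unlabelled i.i.d. copies of $X$, such that: $\mathbb{P}(|X^T\theta|\le t\sqrt{\theta^T\Sigma\theta})\le(Ct)^\chi$ for all $\theta\ne0$, $t>0$; $\|X\|_{\psi_2}\le C_X$; $\lambda_-\le\lambda_{\min}(\Sigma)\le\lambda_{\max}(\Sigma)\le\lambda_+$; $\|\beta^*\|_2\le B$; $\sigma\le R$; $\mathbb{E}[\epsilon^8]^{1/4}\le\kappa_\epsilon\sigma^2$. $\mathcal{P}_{OSS}^{Gauss}$ is the subset with $X\sim N(0,\Sigma)$, $\epsilon\sim N(0,\sigma^2)$ and $\epsilon$ independent of $X$. $\beta^*(P)$ denotes the regression parameter of the mechanism $P$. $\hat\Theta_{OSS}$ is the set of functions $\hat\beta:\mathcal X\to\mathbb{R}^p$ such that $x\mapsto\|\hat\beta(x)-\beta^*(P)\|_2$ is (Borel) measurable for every $P\in\mathcal{P}_{OSS}$; the expectation is over data drawn from $P$. Here $\|Z\|_{\psi_2}=\inf\{c>0:\mathbb{E}e^{Z^2/c^2}\le2\}$ for scalar $Z$ and $\|X\|_{\psi_2}=\sup_{\|u\|_2=1}\|u^TX\|_{\psi_2}$ for vectors. *)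

theory Defs
  imports "HOL-Probability.Probability" "Jordan_Normal_Form.Spectral_Radius"
begin

text \<open>
  The dimension \<open>p\<close> has to be quantified after the universal constant, so it cannot be a type:
  \<open>\<real>^p\<close> is the product space of extensional functions on \<open>{..<p}\<close>, and \<open>[p]\<close>, \<open>[K]\<close>, \<open>[L]\<close> are
  \<open>{..<p}\<close>, \<open>{..<K}\<close>, \<open>{..<L}\<close>.
\<close>

abbreviation rvec :: "nat set \<Rightarrow> (nat \<Rightarrow> real) measure" where
  "rvec I \<equiv> PiM I (\<lambda>_. borel)"

definition dotp :: "nat \<Rightarrow> (nat \<Rightarrow> real) \<Rightarrow> (nat \<Rightarrow> real) \<Rightarrow> real" where
  "dotp p u v = (\<Sum>i<p. u i * v i)"

definition rcball :: "nat \<Rightarrow> real \<Rightarrow> (nat \<Rightarrow> real) set" where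
  "rcball p B = {z \<in> space (rvec {..<p}). L2_set z {..<p} \<le> B}"

definition refines_patterns ::
  "nat \<Rightarrow> nat \<Rightarrow> (nat \<Rightarrow> nat set) \<Rightarrow> nat set set \<Rightarrow> bool" where
  "refines_patterns p K Obs Q \<longleftrightarrow>
     partition_on {..<p} Q \<and> (\<forall>k<K. \<exists>S\<subseteq>Q. Obs k = \<Union>S)"

definition modalities ::
  "nat \<Rightarrow> nat \<Rightarrow> (nat \<Rightarrow> nat set) \<Rightarrow> nat \<Rightarrow> (nat \<Rightarrow> nat set) \<Rightarrow> bool" where
  "modalities p K Obs L Lm \<longleftrightarrow>
     inj_on Lm {..<L} \<and> refines_patterns p K Obs (Lm ` {..<L}) \<and>
     (\<forall>Q. refines_patterns p K Obs Q \<longrightarrow> L \<le> card Q)"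

definition xi :: "nat \<Rightarrow> (nat \<Rightarrow> nat set) \<Rightarrow> nat \<Rightarrow> nat" where
  "xi L Lm j = (THE i. i < L \<and> j \<in> Lm i)"

definition n_joint ::
  "nat \<Rightarrow> (nat \<Rightarrow> nat set) \<Rightarrow> (nat \<Rightarrow> nat) \<Rightarrow> (nat \<Rightarrow> nat set) \<Rightarrow> nat \<Rightarrow> nat \<Rightarrow> nat" where
  "n_joint K Obs n Lm g h = (\<Sum>k<K. if Lm g \<union> Lm h \<subseteq> Obs k then n k else 0)"

text \<open>
  A mechanism consists of the joint law of \<open>(X, \<epsilon>)\<close>, the regression parameter and the noise
  standard deviation. It is kept apart from the law of the full data because the latter need not
  determine the regression parameter.
\<close>

record mechanism =
  law :: "((nat \<Rightarrow> real) \<times> real) measure"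
  coef :: "nat \<Rightarrow> real"
  noise_sd :: real

definition second_moment :: "nat \<Rightarrow> mechanism \<Rightarrow> nat \<Rightarrow> nat \<Rightarrow> real" where
  "second_moment p P i j = (\<integral>\<omega>. fst \<omega> i * fst \<omega> j \<partial>law P)"

definition quad_form :: "nat \<Rightarrow> (nat \<Rightarrow> nat \<Rightarrow> real) \<Rightarrow> (nat \<Rightarrow> real) \<Rightarrow> real" where
  "quad_form p S t = (\<Sum>i<p. \<Sum>j<p. t i * S i j * t j)"

definition lambda_min :: "nat \<Rightarrow> (nat \<Rightarrow> nat \<Rightarrow> real) \<Rightarrow> real" where
  "lambda_min p S = Min (spectrum (mat p p (\<lambda>(i, j). S i j)))"

definition lambda_max :: "nat \<Rightarrow> (nat \<Rightarrow> nat \<Rightarrow> real) \<Rightarrow> real" where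
  "lambda_max p S = Max (spectrum (mat p p (\<lambda>(i, j). S i j)))"

text \<open>The value is \<open>\<infinity>\<close> if no admissible \<open>c\<close> exists.\<close>

definition psi2_norm :: "'a measure \<Rightarrow> ('a \<Rightarrow> real) \<Rightarrow> ennreal" where
  "psi2_norm M Z =
     Inf (ennreal ` {c. 0 < c \<and> (\<integral>\<^sup>+\<omega>. ennreal (exp ((Z \<omega>)\<^sup>2 / c\<^sup>2)) \<partial>M) \<le> 2})"

definition psi2_norm_vec :: "nat \<Rightarrow> 'a measure \<Rightarrow> ('a \<Rightarrow> nat \<Rightarrow> real) \<Rightarrow> ennreal" where
  "psi2_norm_vec p M X =
     (SUP u\<in>{u \<in> space (rvec {..<p}). L2_set u {..<p} = 1}. psi2_norm M (\<lambda>\<omega>. dotp p u (X \<omega>)))"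

definition sigma_X :: "nat \<Rightarrow> mechanism \<Rightarrow> ((nat \<Rightarrow> real) \<times> real) measure" where
  "sigma_X p P = vimage_algebra (space (law P)) fst (rvec {..<p})"

definition cond_var :: "'a measure \<Rightarrow> 'a measure \<Rightarrow> ('a \<Rightarrow> real) \<Rightarrow> 'a \<Rightarrow> real" where
  "cond_var M F f = real_cond_exp M F (\<lambda>x. (f x - real_cond_exp M F f x)\<^sup>2)"

definition linear_model :: "nat \<Rightarrow> mechanism \<Rightarrow> bool" where
  "linear_model p P \<longleftrightarrow>
     prob_space (law P) \<and> sets (law P) = sets (rvec {..<p} \<Otimes>\<^sub>M borel) \<and>
     coef P \<in> space (rvec {..<p}) \<and> 0 \<le> noise_sd P \<and>
     integrable (law P) snd \<and> integrable (law P) (\<lambda>\<omega>. (snd \<omega>)\<^sup>2) \<and>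
     (AE \<omega> in law P. real_cond_exp (law P) (sigma_X p P) snd \<omega> = 0) \<and>
     (AE \<omega> in law P. cond_var (law P) (sigma_X p P) snd \<omega> = (noise_sd P)\<^sup>2)"

definition P_OSS ::
  "nat \<Rightarrow> real \<Rightarrow> real \<Rightarrow> real \<Rightarrow> real \<Rightarrow> real \<Rightarrow> real \<Rightarrow> real \<Rightarrow> real \<Rightarrow> mechanism set" where
  "P_OSS p R B lm lp chi C \<kappa> CX =
     {P. linear_model p P \<and>
         (\<forall>\<theta> t. (\<exists>i<p. \<theta> i \<noteq> 0) \<and> 0 < t \<longrightarrow>
            measure (law P) {\<omega> \<in> space (law P).
               \<bar>dotp p (fst \<omega>) \<theta>\<bar> \<le> t * sqrt (quad_form p (second_moment p P) \<theta>)}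
              \<le> (C * t) powr chi) \<and>
         psi2_norm_vec p (law P) fst \<le> ennreal CX \<and>
         lm \<le> lambda_min p (second_moment p P) \<and>
         lambda_max p (second_moment p P) \<le> lp \<and>
         L2_set (coef P) {..<p} \<le> B \<and>
         noise_sd P \<le> R \<and>
         integrable (law P) (\<lambda>\<omega>. (snd \<omega>) ^ 8) \<and>
         (\<integral>\<omega>. (snd \<omega>) ^ 8 \<partial>law P) powr (1 / 4) \<le> \<kappa> * (noise_sd P)\<^sup>2}"

text \<open>The normal law with standard deviation \<open>s\<close>; the point mass at \<open>m\<close> if \<open>s = 0\<close>.\<close>

definition normal_law :: "real \<Rightarrow> real \<Rightarrow> real measure" where
  "normal_law m s =
     (if s = 0 then return borel m else density lborel (\<lambda>x. ennreal (normal_density m s x)))"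

text \<open>Multivariate normality: every linear combination of the coordinates is normal.\<close>

definition centred_gaussian ::
  "nat \<Rightarrow> 'a measure \<Rightarrow> ('a \<Rightarrow> nat \<Rightarrow> real) \<Rightarrow> (nat \<Rightarrow> nat \<Rightarrow> real) \<Rightarrow> bool" where
  "centred_gaussian p M X S \<longleftrightarrow>
     (\<forall>\<theta>. distr M borel (\<lambda>\<omega>. dotp p \<theta> (X \<omega>)) = normal_law 0 (sqrt (quad_form p S \<theta>)))"

text \<open>
  \<open>prob_space.indep_var\<close> requires both variables to have the same type, so independence of \<open>X\<close>
  and \<open>\<epsilon>\<close> is stated for the generated \<open>\<sigma>\<close>-algebras.
\<close>

definition P_OSS_Gauss ::
  "nat \<Rightarrow> real \<Rightarrow> real \<Rightarrow> real \<Rightarrow> real \<Rightarrow> real \<Rightarrow> real \<Rightarrow> real \<Rightarrow> real \<Rightarrow> mechanism set" where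
  "P_OSS_Gauss p R B lm lp chi C \<kappa> CX =
     {P \<in> P_OSS p R B lm lp chi C \<kappa> CX.
         centred_gaussian p (law P) fst (second_moment p P) \<and>
         distr (law P) borel snd = normal_law 0 (noise_sd P) \<and>
         prob_space.indep_set (law P) (sets (sigma_X p P))
           (sets (vimage_algebra (space (law P)) snd borel))}"

type_synonym full_data = "(nat \<Rightarrow> nat \<Rightarrow> (nat \<Rightarrow> real) \<times> real) \<times> (nat \<Rightarrow> nat \<Rightarrow> real)"

definition data_space ::
  "nat \<Rightarrow> nat \<Rightarrow> (nat \<Rightarrow> nat set) \<Rightarrow> (nat \<Rightarrow> nat) \<Rightarrow> nat \<Rightarrow> full_data measure" where
  "data_space p K Obs n N =
     PiM {..<K} (\<lambda>k. PiM {..<n k} (\<lambda>_. rvec (Obs k) \<Otimes>\<^sub>M borel)) \<Otimes>\<^sub>M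
     PiM {..<N} (\<lambda>_. rvec {..<p})"

definition labelled_law :: "nat \<Rightarrow> nat set \<Rightarrow> mechanism \<Rightarrow> ((nat \<Rightarrow> real) \<times> real) measure" where
  "labelled_law p Ok P =
     distr (law P) (rvec Ok \<Otimes>\<^sub>M borel)
       (\<lambda>\<omega>. (restrict (fst \<omega>) Ok, dotp p (fst \<omega>) (coef P) + snd \<omega>))"

definition data_law ::
  "nat \<Rightarrow> nat \<Rightarrow> (nat \<Rightarrow> nat set) \<Rightarrow> (nat \<Rightarrow> nat) \<Rightarrow> nat \<Rightarrow> mechanism \<Rightarrow> full_data measure" where
  "data_law p K Obs n N P =
     PiM {..<K} (\<lambda>k. PiM {..<n k} (\<lambda>_. labelled_law p (Obs k) P)) \<Otimes>\<^sub>M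
     PiM {..<N} (\<lambda>_. distr (law P) (rvec {..<p}) fst)"

definition est_error :: "nat \<Rightarrow> (full_data \<Rightarrow> nat \<Rightarrow> real) \<Rightarrow> mechanism \<Rightarrow> full_data \<Rightarrow> real" where
  "est_error p bhat P x = L2_set (\<lambda>i. bhat x i - coef P i) {..<p}"

definition estimators ::
  "nat \<Rightarrow> nat \<Rightarrow> (nat \<Rightarrow> nat set) \<Rightarrow> (nat \<Rightarrow> nat) \<Rightarrow> nat \<Rightarrow> mechanism set
     \<Rightarrow> (full_data \<Rightarrow> nat \<Rightarrow> real) set" where
  "estimators p K Obs n N \<P> =
     {bhat \<in> space (data_space p K Obs n N) \<rightarrow> space (rvec {..<p}).
        \<forall>P\<in>\<P>. est_error p bhat P \<in> borel_measurable (data_space p K Obs n N)}"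

definition risk ::
  "nat \<Rightarrow> nat \<Rightarrow> (nat \<Rightarrow> nat set) \<Rightarrow> (nat \<Rightarrow> nat) \<Rightarrow> nat \<Rightarrow> (full_data \<Rightarrow> nat \<Rightarrow> real) \<Rightarrow> mechanism
     \<Rightarrow> ennreal" where
  "risk p K Obs n N bhat P =
     (\<integral>\<^sup>+x. ennreal ((est_error p bhat P x)\<^sup>2) \<partial>data_law p K Obs n N P)"

definition D_fac :: "nat \<Rightarrow> (nat \<Rightarrow> nat set) \<Rightarrow> real \<Rightarrow> nat \<Rightarrow> (nat \<Rightarrow> real) \<Rightarrow> real" where
  "D_fac p Obs R j z = R\<^sup>2 / (R\<^sup>2 + (L2_set z ({..<p} - Obs j))\<^sup>2)"

definition alpha ::
  "nat \<Rightarrow> nat \<Rightarrow> (nat \<Rightarrow> nat set) \<Rightarrow> (nat \<Rightarrow> nat) \<Rightarrow> real \<Rightarrow> nat \<Rightarrow> (nat \<Rightarrow> real) \<Rightarrow> real" where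
  "alpha p K Obs n R i z =
     (\<Sum>j<K. real (n j) * D_fac p Obs R j z * (if i \<in> Obs j then 1 else 0))"

text \<open>
  Division in \<^typ>\<open>ennreal\<close> gives \<open>\<infinity>\<close> for a positive numerator and zero denominator.
\<close>

definition cross_sum ::
  "nat \<Rightarrow> nat \<Rightarrow> (nat \<Rightarrow> nat set) \<Rightarrow> (nat \<Rightarrow> nat) \<Rightarrow> nat \<Rightarrow> nat \<Rightarrow> (nat \<Rightarrow> nat set) \<Rightarrow> real \<Rightarrow> real
     \<Rightarrow> nat \<Rightarrow> ennreal" where
  "cross_sum p K Obs n N L Lm R B i =
     (\<Sum>j\<in>{..<p} - {i}.
        let m = n_joint K Obs n Lm (xi L Lm j) (xi L Lm i)
        in min (ennreal (B\<^sup>2) / of_nat (N + m)) (ennreal (R\<^sup>2) / of_nat m))"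

end

theory Submission
  imports Defs
begin

text \<open>
The right-hand side is a sum, and up to a factor two a minimax risk dominates a sum as soon as it
dominates each summand. Both summands come from Assouad's argument: a hypercube of Gaussian
mechanisms, indexed by sign vectors, in which flipping the sign of coordinate \<open>j\<close> moves only
\<open>\<beta>\<^sub>j\<close>, from \<open>-a\<^sub>j\<close> to \<open>a\<^sub>j\<close>, while the law of the data moves by a bounded amount. Then every
estimator has worst-case risk at least a constant times \<open>\<Sum> a\<^sub>j\<^sup>2\<close> (lemma \<open>minimax_risk_ge\<close>).

Distances are measured by the Hellinger affinity, because bounds on one minus the affinity
add up over independent samples and survive measurable maps. All data are functions of standard
Gaussian vectors, and for one sample there are two cases. If the sample is uninformative about the
sign, then the two laws are equal: either the observation map does not depend on the sign, or the
coordinate \<open>j\<close> is missing and flipping the sign of the \<open>j\<close>-th Gaussian coordinate turns one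
observation map into the other (lemma \<open>distr_gauss_flip_eq\<close>). Otherwise both observations are the
same function of \<open>z - z\<^sub>j w\<close> and of \<open>z + z\<^sub>j w\<close> for a vector \<open>w\<close> with \<open>w\<^sub>j = 0\<close>;
for such a pair of shears one minus the affinity is at most \<open>\<parallel>w\<parallel>\<^sup>2 / 2\<close> (lemma \<open>hellinger_close_gauss_shear\<close>). The choice of \<open>w\<close> is free as long as it produces the right
observation, and the cheapest one gives the rates.

The first summand (lemma \<open>labelled_lower_bound\<close>). Take \<open>\<Sigma> = \<lambda>\<^sub>- I\<close>. The weights \<open>\<alpha>\<^sub>i(z)\<close> depend
on \<open>z\<close> only through the norms of its restrictions to modalities. Every modality has at least two
coordinates, so one representative can carry \<open>1/\<surd>3\<close> times the norm of \<open>z\<close> on that modality, and the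
other coordinates are free to take values \<open>\<plusminus>\<delta>\<^sub>j\<close>. Signs do not change the norm of the missing part of
\<open>\<beta>\<close>, so a sample from a pattern missing \<open>j\<close> says nothing about the sign of \<open>\<beta>\<^sub>j\<close>; for a pattern
that observes \<open>j\<close> and misses the set \<open>M\<close>, the missing covariates act as additional noise and
\<open>\<parallel>w\<parallel>\<^sup>2 = \<lambda>\<^sub>- \<delta>\<^sub>j\<^sup>2 / (R\<^sup>2 + \<lambda>\<^sub>- \<parallel>\<beta>\<^sub>M\<parallel>\<^sup>2)\<close>. Summed over the samples this is bounded when
\<open>\<delta>\<^sub>j\<^sup>2\<close> is of order \<open>R\<^sup>2 / ((max 1 \<lambda>\<^sub>-) \<alpha>\<^sub>j(z))\<close>. The lower bound on \<open>\<alpha>\<close> keeps \<open>\<parallel>\<beta>\<parallel> \<le> B\<close>. Since \<open>\<alpha>\<close> is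
constant on a modality, leaving out the representatives costs at most a factor two.

The second summand (lemma \<open>cross_lower_bound\<close>). Fix \<open>i\<close> and let the signs sit in the covariance:
\<open>X\<^sub>i\<close> has covariance \<open>\<mp>d\<^sub>j\<close> with \<open>X\<^sub>j\<close>, all variances are \<open>\<lambda> = (\<lambda>\<^sub>- + \<lambda>\<^sub>+)/2\<close>, and \<open>\<beta>\<close> is chosen such that
\<open>Y\<close> is independent of all \<open>X\<^sub>j\<close> with \<open>j \<noteq> i\<close>. This forces \<open>\<beta>\<^sub>j = \<plusminus>d\<^sub>j \<beta>\<^sub>i / \<lambda>\<close>, with \<open>\<beta>\<^sub>i\<close> of order \<open>B\<close>,
and only samples that contain both \<open>X\<^sub>i\<close> and \<open>X\<^sub>j\<close> carry information on the sign. A labelled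
sample costs \<open>d\<^sub>j\<^sup>2 (1/\<lambda>\<^sup>2 + B\<^sup>2 / (\<lambda> R\<^sup>2))\<close> up to constants, an unlabelled one only the first term, and this
allows \<open>d\<^sub>j\<^sup>2\<close> of order \<open>min 1 \<lambda>\<^sub>+\<^sup>2\<close> times \<open>min (1 / (N + n\<^sub>i\<^sub>j)) (R\<^sup>2 / (B\<^sup>2 n\<^sub>i\<^sub>j))\<close>. The hypothesis on the
cross sums keeps the spectrum of the covariance inside \<open>[\<lambda>\<^sub>-, \<lambda>\<^sub>+]\<close>.
\<close>

section \<open>Hellinger affinity without densities\<close>

text \<open>
The Cauchy--Schwarz inequality in the form in which it iterates over product spaces: the integrals of
\<open>f\<close>, \<open>g\<close> and \<open>h\<close> over one coordinate satisfy the same pointwise hypothesis again.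
\<close>

lemma nn_integral_Cauchy_Schwarz_le:
  fixes f g h :: "'a \<Rightarrow> ennreal"
  assumes [measurable]: "f \<in> borel_measurable M" "g \<in> borel_measurable M" "h \<in> borel_measurable M"
    and le: "\<And>x. x \<in> space M \<Longrightarrow> (h x)\<^sup>2 \<le> f x * g x"
  shows "(\<integral>\<^sup>+x. h x \<partial>M)\<^sup>2 \<le> (\<integral>\<^sup>+x. f x \<partial>M) * (\<integral>\<^sup>+x. g x \<partial>M)"
proof -
  let ?F = "\<integral>\<^sup>+x. f x \<partial>M" and ?G = "\<integral>\<^sup>+x. g x \<partial>M"
  show ?thesis
  proof (cases "?F = 0 \<or> ?G = 0")
    case True
    then have "AE x in M. h x = 0"
    proof
      assume "?F = 0"
      then have "AE x in M. f x = 0" by (simp add: nn_integral_0_iff_AE)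
      with AE_space show ?thesis
        by eventually_elim (use le in fastforce)
    next
      assume "?G = 0"
      then have "AE x in M. g x = 0" by (simp add: nn_integral_0_iff_AE)
      with AE_space show ?thesis
        by eventually_elim (use le in fastforce)
    qed
    then have "(\<integral>\<^sup>+x. h x \<partial>M) = 0" by (simp add: nn_integral_0_iff_AE)
    then show ?thesis by simp
  next
    case False
    show ?thesis
    proof (cases "?F = \<infinity> \<or> ?G = \<infinity>")
      case True
      then show ?thesis using False by (auto simp: ennreal_mult_top ennreal_top_mult)
    next
      case fin: False
      have ff: "AE x in M. f x \<noteq> \<infinity>" and gf: "AE x in M. g x \<noteq> \<infinity>"
        using fin nn_integral_PInf_AE[of f M] nn_integral_PInf_AE[of g M] by auto
      let ?u = "\<lambda>x. ennreal (sqrt (enn2real (f x)))" and ?v = "\<lambda>x. ennreal (sqrt (enn2real (g x)))"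
      have "AE x in M. h x \<le> ?u x * ?v x"
        using ff gf AE_space
      proof eventually_elim
        case (elim x)
        obtain a b where ab: "f x = ennreal a" "a \<ge> 0" "g x = ennreal b" "b \<ge> 0"
          using elim by (metis ennreal_enn2real_if enn2real_nonneg infinity_ennreal_def)
        have "(h x)\<^sup>2 \<le> ennreal (a * b)" using le[OF elim(3)] ab by (simp add: ennreal_mult)
        then have "h x \<noteq> \<infinity>" by (auto simp: power2_eq_square ennreal_top_mult top_unique)
        then obtain c where c: "h x = ennreal c" "c \<ge> 0"
          by (metis ennreal_enn2real_if enn2real_nonneg infinity_ennreal_def)
        have "c\<^sup>2 \<le> a * b" using \<open>(h x)\<^sup>2 \<le> ennreal (a * b)\<close> c ab
          by (simp add: ennreal_power)
        then have "c \<le> sqrt a * sqrt b" using c by (simp add: real_le_rsqrt real_sqrt_mult[symmetric])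
        then show ?case using ab c by (simp add: ennreal_mult[symmetric])
      qed
      then have "(\<integral>\<^sup>+x. h x \<partial>M)\<^sup>2 \<le> (\<integral>\<^sup>+x. ?u x * ?v x \<partial>M)\<^sup>2"
        by (intro power_mono nn_integral_mono_AE) auto
      also have "\<dots> \<le> (\<integral>\<^sup>+x. (?u x)\<^sup>2 \<partial>M) * (\<integral>\<^sup>+x. (?v x)\<^sup>2 \<partial>M)"
        by (intro Cauchy_Schwarz_nn_integral) auto
      also have "(\<integral>\<^sup>+x. (?u x)\<^sup>2 \<partial>M) = ?F"
        by (intro nn_integral_cong_AE) (use ff in eventually_elim, auto simp: ennreal_power enn2real_nonneg less_top)
      also have "(\<integral>\<^sup>+x. (?v x)\<^sup>2 \<partial>M) = ?G"
        by (intro nn_integral_cong_AE) (use gf in eventually_elim, auto simp: ennreal_power enn2real_nonneg less_top)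
      finally show ?thesis .
    qed
  qed
qed

text \<open>
A measure \<open>\<nu>\<close> with this property is a substitute for \<open>\<surd>(dP dQ)\<close>, whose total mass is the Hellinger
affinity of \<open>P\<close> and \<open>Q\<close>. The property refers to integrals only, so it passes to image measures and
to products without the choice of densities. The factor \<open>c\<close> takes out a scalar, so that \<open>\<nu>\<close>
can be kept fixed while the pair \<open>P\<close>, \<open>Q\<close> depends on a parameter.
\<close>

definition affinity :: "ennreal \<Rightarrow> 'a measure \<Rightarrow> 'a measure \<Rightarrow> 'a measure \<Rightarrow> bool" where
  "affinity c P Q \<nu> \<longleftrightarrow>
     finite_measure P \<and> finite_measure Q \<and> finite_measure \<nu> \<and>
     sets P = sets \<nu> \<and> sets Q = sets \<nu> \<and>
     (\<forall>f\<in>borel_measurable \<nu>. \<forall>g\<in>borel_measurable \<nu>. \<forall>h\<in>borel_measurable \<nu>.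
        (\<forall>x\<in>space \<nu>. (h x)\<^sup>2 \<le> f x * g x) \<longrightarrow>
        (c * (\<integral>\<^sup>+x. h x \<partial>\<nu>))\<^sup>2 \<le> (\<integral>\<^sup>+x. f x \<partial>P) * (\<integral>\<^sup>+x. g x \<partial>Q))"

lemma affinityD:
  assumes "affinity c P Q \<nu>" "f \<in> borel_measurable \<nu>" "g \<in> borel_measurable \<nu>" "h \<in> borel_measurable \<nu>"
    "\<And>x. x \<in> space \<nu> \<Longrightarrow> (h x)\<^sup>2 \<le> f x * g x"
  shows "(c * (\<integral>\<^sup>+x. h x \<partial>\<nu>))\<^sup>2 \<le> (\<integral>\<^sup>+x. f x \<partial>P) * (\<integral>\<^sup>+x. g x \<partial>Q)"
  using assms unfolding affinity_def by blast

lemma affinity_refl: "finite_measure P \<Longrightarrow> affinity 1 P P P"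
  unfolding affinity_def by (auto intro!: nn_integral_Cauchy_Schwarz_le)

lemma affinity_distr:
  assumes "affinity c P Q \<nu>" and T: "T \<in> measurable \<nu> N"
  shows "affinity c (distr P N T) (distr Q N T) (distr \<nu> N T)"
proof -
  have s: "sets P = sets \<nu>" "sets Q = sets \<nu>" and fm: "finite_measure P" "finite_measure Q" "finite_measure \<nu>"
    using assms by (auto simp: affinity_def)
  have m: "T \<in> measurable P N" "T \<in> measurable Q N"
    using T s by (auto cong: measurable_cong_sets)
  show ?thesis unfolding affinity_def
  proof (intro conjI ballI impI)
    fix f g h :: "_ \<Rightarrow> ennreal"
    assume [measurable]: "f \<in> borel_measurable (distr \<nu> N T)" "g \<in> borel_measurable (distr \<nu> N T)" "h \<in> borel_measurable (distr \<nu> N T)"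
      and le: "\<forall>x\<in>space (distr \<nu> N T). (h x)\<^sup>2 \<le> f x * g x"
    note [measurable] = m T
    have "(c * (\<integral>\<^sup>+x. h (T x) \<partial>\<nu>))\<^sup>2 \<le> (\<integral>\<^sup>+x. f (T x) \<partial>P) * (\<integral>\<^sup>+x. g (T x) \<partial>Q)"
      by (rule affinityD[OF assms(1)]) (use le measurable_space[OF T] in auto)
    then show "(c * (\<integral>\<^sup>+x. h x \<partial>distr \<nu> N T))\<^sup>2 \<le> (\<integral>\<^sup>+x. f x \<partial>distr P N T) * (\<integral>\<^sup>+x. g x \<partial>distr Q N T)"
      by (simp add: nn_integral_distr)
  qed (auto intro!: finite_measure.finite_measure_distr fm m T)
qed

lemma affinity_pair:
  assumes 1: "affinity c P Q \<nu>" and 2: "affinity c' P' Q' \<nu>'"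
  shows "affinity (c * c') (P \<Otimes>\<^sub>M P') (Q \<Otimes>\<^sub>M Q') (\<nu> \<Otimes>\<^sub>M \<nu>')"
proof -
  have s: "sets P = sets \<nu>" "sets Q = sets \<nu>" "sets P' = sets \<nu>'" "sets Q' = sets \<nu>'"
    and fm: "finite_measure P" "finite_measure Q" "finite_measure \<nu>" "finite_measure P'" "finite_measure Q'" "finite_measure \<nu>'"
    using assms by (auto simp: affinity_def)
  interpret P': finite_measure P' by fact
  interpret Q': finite_measure Q' by fact
  interpret n': finite_measure \<nu>' by fact
  have sp: "sets (P \<Otimes>\<^sub>M P') = sets (\<nu> \<Otimes>\<^sub>M \<nu>')" "sets (Q \<Otimes>\<^sub>M Q') = sets (\<nu> \<Otimes>\<^sub>M \<nu>')"
    by (intro sets_pair_measure_cong s)+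
  show ?thesis unfolding affinity_def
  proof (intro conjI ballI impI)
    fix f g h :: "_ \<Rightarrow> ennreal"
    assume m[measurable]: "f \<in> borel_measurable (\<nu> \<Otimes>\<^sub>M \<nu>')" "g \<in> borel_measurable (\<nu> \<Otimes>\<^sub>M \<nu>')" "h \<in> borel_measurable (\<nu> \<Otimes>\<^sub>M \<nu>')"
      and le: "\<forall>x\<in>space (\<nu> \<Otimes>\<^sub>M \<nu>'). (h x)\<^sup>2 \<le> f x * g x"
    have fm: "f \<in> borel_measurable (P \<Otimes>\<^sub>M P')" using m(1) measurable_cong_sets[OF sp(1) refl] by blast
    have gm: "g \<in> borel_measurable (Q \<Otimes>\<^sub>M Q')" using m(2) measurable_cong_sets[OF sp(2) refl] by blast
    have fm': "f \<in> borel_measurable (\<nu> \<Otimes>\<^sub>M P')" using m(1) measurable_cong_sets[OF sets_pair_measure_cong[OF refl s(3)] refl] by blast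
    have gm': "g \<in> borel_measurable (\<nu> \<Otimes>\<^sub>M Q')" using m(2) measurable_cong_sets[OF sets_pair_measure_cong[OF refl s(4)] refl] by blast
    have "(c * (\<integral>\<^sup>+x. c' * (\<integral>\<^sup>+y. h (x, y) \<partial>\<nu>') \<partial>\<nu>))\<^sup>2
       \<le> (\<integral>\<^sup>+x. (\<integral>\<^sup>+y. f (x, y) \<partial>P') \<partial>P) * (\<integral>\<^sup>+x. (\<integral>\<^sup>+y. g (x, y) \<partial>Q') \<partial>Q)"
    proof (rule affinityD[OF 1])
      fix x assume x: "x \<in> space \<nu>"
      show "(c' * (\<integral>\<^sup>+y. h (x, y) \<partial>\<nu>'))\<^sup>2 \<le> (\<integral>\<^sup>+y. f (x, y) \<partial>P') * (\<integral>\<^sup>+y. g (x, y) \<partial>Q')"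
        by (rule affinityD[OF 2]) (use le x in \<open>auto simp: space_pair_measure\<close>)
    next
      show "(\<lambda>x. \<integral>\<^sup>+y. f (x, y) \<partial>P') \<in> borel_measurable \<nu>"
        by (rule P'.borel_measurable_nn_integral_fst[OF fm'])
      show "(\<lambda>x. \<integral>\<^sup>+y. g (x, y) \<partial>Q') \<in> borel_measurable \<nu>"
        by (rule Q'.borel_measurable_nn_integral_fst[OF gm'])
    qed measurable
    then show "(c * c' * (\<integral>\<^sup>+x. h x \<partial>(\<nu> \<Otimes>\<^sub>M \<nu>')))\<^sup>2 \<le> (\<integral>\<^sup>+x. f x \<partial>(P \<Otimes>\<^sub>M P')) * (\<integral>\<^sup>+x. g x \<partial>(Q \<Otimes>\<^sub>M Q'))"
      by (simp add: nn_integral_cmult P'.nn_integral_fst[OF fm] Q'.nn_integral_fst[OF gm] n'.nn_integral_fst[OF m(3)] mult.assoc)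
  qed (auto intro!: finite_measure_pair_measure fm sets_pair_measure_cong s)
qed

lemma finite_measure_PiM_finite:
  assumes "finite I" "\<And>i. i \<in> I \<Longrightarrow> finite_measure (M i)"
  shows "finite_measure (PiM I M)"
proof -
  define M' where "M' i = (if i \<in> I then M i else count_space {})" for i
  have fm: "finite_measure (M' i)" for i
    using assms by (auto simp: M'_def intro: finite_measure_count_space)
  interpret product_sigma_finite M'
    unfolding product_sigma_finite_def by (auto intro: finite_measure.sigma_finite_measure fm)
  have "emeasure (PiM I M') (space (PiM I M')) = (\<Prod>i\<in>I. emeasure (M' i) (space (M' i)))"
    unfolding space_PiM by (rule emeasure_PiM) (use assms in auto)
  also have "\<dots> \<noteq> \<infinity>"
    using finite_measure.emeasure_finite[OF fm] by (simp add: ennreal_prod_eq_top)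
  finally have "finite_measure (PiM I M')" by (intro finite_measureI)
  also have "PiM I M' = PiM I M" by (intro PiM_cong) (auto simp: M'_def)
  finally show ?thesis .
qed

lemma affinity_PiM:
  assumes I: "finite I" and A: "\<And>i. i \<in> I \<Longrightarrow> affinity (c i) (P i) (Q i) (\<nu> i)"
  shows "affinity (\<Prod>i\<in>I. c i) (PiM I P) (PiM I Q) (PiM I \<nu>)"
proof -
  define d where "d M i = (if i \<in> I then M i else count_space {})" for M :: "'a \<Rightarrow> 'b measure" and i
  have fm: "finite_measure (d P i)" "finite_measure (d Q i)" "finite_measure (d \<nu> i)" for i
    using A by (auto simp: d_def affinity_def intro!: finite_measure_count_space)
  have s: "sets (d P i) = sets (d \<nu> i)" "sets (d Q i) = sets (d \<nu> i)" for i
    using A by (auto simp: d_def affinity_def)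
  interpret P: product_sigma_finite "d P" unfolding product_sigma_finite_def by (auto intro: finite_measure.sigma_finite_measure fm)
  interpret Q: product_sigma_finite "d Q" unfolding product_sigma_finite_def by (auto intro: finite_measure.sigma_finite_measure fm)
  interpret n: product_sigma_finite "d \<nu>" unfolding product_sigma_finite_def by (auto intro: finite_measure.sigma_finite_measure fm)
  have A': "affinity (c i) (d P i) (d Q i) (d \<nu> i)" if "i \<in> I" for i
    using A[OF that] that by (simp add: d_def)
  have sP: "sets (PiM J (d P)) = sets (PiM J (d \<nu>))" "sets (PiM J (d Q)) = sets (PiM J (d \<nu>))" for J
    by (intro sets_PiM_cong s refl)+
  have main: "affinity (\<Prod>i\<in>J. c i) (PiM J (d P)) (PiM J (d Q)) (PiM J (d \<nu>))" if "finite J" "J \<subseteq> I" for J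
    using that
  proof (induction J)
    case empty
    have "PiM {} (d P) = PiM {} (d \<nu>)" "PiM {} (d Q) = PiM {} (d \<nu>)" by (simp_all add: PiM_empty)
    moreover have "finite_measure (PiM {} (d \<nu>))" by (rule finite_measure_PiM_finite) auto
    ultimately show ?case by (simp add: affinity_refl)
  next
    case (insert i J)
    have IH: "affinity (\<Prod>i\<in>J. c i) (PiM J (d P)) (PiM J (d Q)) (PiM J (d \<nu>))" and iI: "i \<in> I"
      and Ji: "finite J" "i \<notin> J" using insert by auto
    show ?case unfolding affinity_def
    proof (intro conjI ballI impI)
      fix f g h :: "_ \<Rightarrow> ennreal"
    assume m[measurable]: "f \<in> borel_measurable (PiM (insert i J) (d \<nu>))"
         "g \<in> borel_measurable (PiM (insert i J) (d \<nu>))" "h \<in> borel_measurable (PiM (insert i J) (d \<nu>))"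
        and le: "\<forall>x\<in>space (PiM (insert i J) (d \<nu>)). (h x)\<^sup>2 \<le> f x * g x"
      have fP: "f \<in> borel_measurable (PiM (insert i J) (d P))" using m(1) measurable_cong_sets[OF sP(1) refl] by blast
      have gQ: "g \<in> borel_measurable (PiM (insert i J) (d Q))" using m(2) measurable_cong_sets[OF sP(2) refl] by blast
      interpret Pi: finite_measure "d P i" by (rule fm)
      interpret Qi: finite_measure "d Q i" by (rule fm)
      interpret ni: finite_measure "d \<nu> i" by (rule fm)
      have m1: "(\<lambda>z. f ((fst z)(i := snd z))) \<in> borel_measurable (PiM J (d \<nu>) \<Otimes>\<^sub>M d \<nu> i)"
        "(\<lambda>z. g ((fst z)(i := snd z))) \<in> borel_measurable (PiM J (d \<nu>) \<Otimes>\<^sub>M d \<nu> i)"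
        "(\<lambda>z. h ((fst z)(i := snd z))) \<in> borel_measurable (PiM J (d \<nu>) \<Otimes>\<^sub>M d \<nu> i)"
        by measurable
      have m2: "(\<lambda>(x, y). f (x(i := y))) \<in> borel_measurable (PiM J (d \<nu>) \<Otimes>\<^sub>M d P i)"
        unfolding split_beta' measurable_cong_sets[OF sets_pair_measure_cong[OF refl s(1)] refl] by (rule m1(1))
      have m3: "(\<lambda>(x, y). g (x(i := y))) \<in> borel_measurable (PiM J (d \<nu>) \<Otimes>\<^sub>M d Q i)"
        unfolding split_beta' measurable_cong_sets[OF sets_pair_measure_cong[OF refl s(2)] refl] by (rule m1(2))
      have "((\<Prod>i\<in>J. c i) * (\<integral>\<^sup>+x. c i * (\<integral>\<^sup>+y. h (x(i := y)) \<partial>d \<nu> i) \<partial>PiM J (d \<nu>)))\<^sup>2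
       \<le> (\<integral>\<^sup>+x. (\<integral>\<^sup>+y. f (x(i := y)) \<partial>d P i) \<partial>PiM J (d P)) * (\<integral>\<^sup>+x. (\<integral>\<^sup>+y. g (x(i := y)) \<partial>d Q i) \<partial>PiM J (d Q))"
      proof (rule affinityD[OF IH])
        fix x assume x: "x \<in> space (PiM J (d \<nu>))"
        note [measurable] = x
        have u: "(\<lambda>y. x(i := y)) \<in> measurable (d \<nu> i) (PiM (insert i J) (d \<nu>))"
          by measurable
        show "(c i * (\<integral>\<^sup>+y. h (x(i := y)) \<partial>d \<nu> i))\<^sup>2 \<le> (\<integral>\<^sup>+y. f (x(i := y)) \<partial>d P i) * (\<integral>\<^sup>+y. g (x(i := y)) \<partial>d Q i)"
          by (rule affinityD[OF A'[OF iI]])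
             (use le measurable_space[OF u] measurable_compose[OF u] m in auto)
      next
        show "(\<lambda>x. \<integral>\<^sup>+y. f (x(i := y)) \<partial>d P i) \<in> borel_measurable (PiM J (d \<nu>))"
          using sigma_finite_measure.borel_measurable_nn_integral_fst[OF finite_measure.sigma_finite_measure[OF fm(1)] m2] by simp
        show "(\<lambda>x. \<integral>\<^sup>+y. g (x(i := y)) \<partial>d Q i) \<in> borel_measurable (PiM J (d \<nu>))"
          using sigma_finite_measure.borel_measurable_nn_integral_fst[OF finite_measure.sigma_finite_measure[OF fm(2)] m3] by simp
        show "(\<lambda>x. c i * \<integral>\<^sup>+y. h (x(i := y)) \<partial>d \<nu> i) \<in> borel_measurable (PiM J (d \<nu>))"
          using m1(3) by measurable
      qed
      moreover have "(\<lambda>x. \<integral>\<^sup>+y. h (x(i := y)) \<partial>d \<nu> i) \<in> borel_measurable (PiM J (d \<nu>))"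
        using m1(3) by measurable
      ultimately show "((\<Prod>i\<in>insert i J. c i) * (\<integral>\<^sup>+x. h x \<partial>(PiM (insert i J) (d \<nu>))))\<^sup>2
          \<le> (\<integral>\<^sup>+x. f x \<partial>(PiM (insert i J) (d P))) * (\<integral>\<^sup>+x. g x \<partial>(PiM (insert i J) (d Q)))"
        using Ji by (simp add: nn_integral_cmult P.product_nn_integral_insert[OF Ji fP]
            Q.product_nn_integral_insert[OF Ji gQ] n.product_nn_integral_insert[OF Ji m(3)] mult_ac)
    qed (use Ji in \<open>auto intro!: finite_measure_PiM_finite fm sP\<close>)
  qed
  have e: "PiM I (d M) = PiM I M" for M by (intro PiM_cong) (auto simp: d_def)
  from main[OF I subset_refl] show ?thesis by (simp add: e)
qed

text \<open>
One minus the Hellinger affinity of \<open>P\<close> and \<open>Q\<close> is at most \<open>\<eta>\<close>.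
\<close>

definition hellinger_close :: "real \<Rightarrow> 'a measure \<Rightarrow> 'a measure \<Rightarrow> bool" where
  "hellinger_close \<eta> P Q \<longleftrightarrow> (\<exists>\<nu>. affinity 1 P Q \<nu> \<and> ennreal (1 - \<eta>) \<le> emeasure \<nu> (space \<nu>))"

lemma hellinger_close_refl: "prob_space P \<Longrightarrow> hellinger_close 0 P P"
  unfolding hellinger_close_def
  by (intro exI[of _ P]) (auto simp: affinity_refl prob_space_imp_sigma_finite prob_space.emeasure_space_1 prob_space.finite_measure)

lemma hellinger_close_mono: "hellinger_close \<eta> P Q \<Longrightarrow> \<eta> \<le> \<eta>' \<Longrightarrow> hellinger_close \<eta>' P Q"
  unfolding hellinger_close_def by (meson diff_left_mono ennreal_leI order_trans)

lemma hellinger_close_distr: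
  assumes "hellinger_close \<eta> P Q" "T \<in> measurable P N"
  shows "hellinger_close \<eta> (distr P N T) (distr Q N T)"
proof -
  obtain \<nu> where n: "affinity 1 P Q \<nu>" "ennreal (1 - \<eta>) \<le> emeasure \<nu> (space \<nu>)"
    using assms by (auto simp: hellinger_close_def)
  then have T: "T \<in> measurable \<nu> N" using assms(2) by (auto simp: affinity_def cong: measurable_cong_sets)
  have "T -` space N \<inter> space \<nu> = space \<nu>" using measurable_space[OF T] by auto
  then show ?thesis unfolding hellinger_close_def
    using affinity_distr[OF n(1) T] n(2) T
    by (intro exI[of _ "distr \<nu> N T"]) (simp add: emeasure_distr)
qed

lemma one_minus_add_le_mult:
  fixes a b :: real assumes "0 \<le> a" "0 \<le> b"
  shows "ennreal (1 - (a + b)) \<le> ennreal (1 - a) * ennreal (1 - b)"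
proof (cases "a + b \<le> 1")
  case True
  have "1 - (a + b) \<le> (1 - a) * (1 - b)" using assms by (simp add: algebra_simps)
  then show ?thesis using True assms by (simp add: ennreal_mult[symmetric])
next
  case False then show ?thesis by (simp add: ennreal_neg)
qed

lemma hellinger_close_pair:
  assumes "hellinger_close a P Q" "hellinger_close b P' Q'" "0 \<le> a" "0 \<le> b"
  shows "hellinger_close (a + b) (P \<Otimes>\<^sub>M P') (Q \<Otimes>\<^sub>M Q')"
proof -
  obtain \<nu> \<nu>' where n: "affinity 1 P Q \<nu>" "ennreal (1 - a) \<le> emeasure \<nu> (space \<nu>)"
      "affinity 1 P' Q' \<nu>'" "ennreal (1 - b) \<le> emeasure \<nu>' (space \<nu>')"
    using assms by (auto simp: hellinger_close_def)
  interpret finite_measure \<nu>' using n by (simp add: affinity_def)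
  have "ennreal (1 - (a + b)) \<le> emeasure \<nu> (space \<nu>) * emeasure \<nu>' (space \<nu>')"
    using one_minus_add_le_mult[OF assms(3,4)] n(2,4) by (meson mult_mono order_trans zero_le)
  also have "\<dots> = emeasure (\<nu> \<Otimes>\<^sub>M \<nu>') (space (\<nu> \<Otimes>\<^sub>M \<nu>'))"
    by (simp add: space_pair_measure emeasure_pair_measure_Times)
  finally show ?thesis unfolding hellinger_close_def using affinity_pair[OF n(1,3)] by auto
qed

text \<open>
Bounds on one minus the affinity add up over independent components, because
\<open>(1 - a) (1 - b) \<ge> 1 - (a + b)\<close>.
\<close>

lemma hellinger_close_PiM:
  assumes I: "finite I" and c: "\<And>i. i \<in> I \<Longrightarrow> hellinger_close (a i) (P i) (Q i)" "\<And>i. i \<in> I \<Longrightarrow> 0 \<le> a i"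
  shows "hellinger_close (\<Sum>i\<in>I. a i) (PiM I P) (PiM I Q)"
proof -
  have "\<exists>\<nu>. \<forall>i\<in>I. affinity 1 (P i) (Q i) (\<nu> i) \<and> ennreal (1 - a i) \<le> emeasure (\<nu> i) (space (\<nu> i))"
    using c by (intro bchoice) (auto simp: hellinger_close_def)
  then obtain \<nu> where n: "\<And>i. i \<in> I \<Longrightarrow> affinity 1 (P i) (Q i) (\<nu> i)"
     "\<And>i. i \<in> I \<Longrightarrow> ennreal (1 - a i) \<le> emeasure (\<nu> i) (space (\<nu> i))" by auto
  have "affinity 1 (PiM I P) (PiM I Q) (PiM I \<nu>)"
    using affinity_PiM[OF I n(1)] by simp
  moreover have "ennreal (1 - (\<Sum>i\<in>I. a i)) \<le> emeasure (PiM I \<nu>) (space (PiM I \<nu>))"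
  proof -
    define M' where "M' i = (if i \<in> I then \<nu> i else count_space {})" for i
    have fm: "finite_measure (M' i)" for i
      using n by (auto simp: M'_def affinity_def intro: finite_measure_count_space)
    interpret product_sigma_finite M'
      unfolding product_sigma_finite_def by (auto intro: finite_measure.sigma_finite_measure fm)
    have "ennreal (1 - (\<Sum>i\<in>J. a i)) \<le> (\<Prod>i\<in>J. emeasure (M' i) (space (M' i)))" if "finite J" "J \<subseteq> I" for J
      using that
    proof (induction J)
      case (insert i J)
      have "ennreal (1 - (a i + (\<Sum>i\<in>J. a i))) \<le> ennreal (1 - a i) * ennreal (1 - (\<Sum>i\<in>J. a i))"
        by (rule one_minus_add_le_mult) (use insert c(2) in \<open>auto intro!: sum_nonneg\<close>)
      also have "\<dots> \<le> emeasure (M' i) (space (M' i)) * (\<Prod>i\<in>J. emeasure (M' i) (space (M' i)))"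
        using insert n(2) by (intro mult_mono) (auto simp: M'_def)
      finally show ?case using insert by simp
    qed simp
    from this[OF I subset_refl] have "ennreal (1 - (\<Sum>i\<in>I. a i)) \<le> emeasure (PiM I M') (space (PiM I M'))"
      unfolding space_PiM using I by (subst emeasure_PiM) auto
    also have "PiM I M' = PiM I \<nu>" by (intro PiM_cong) (auto simp: M'_def)
    finally show ?thesis .
  qed
  ultimately show ?thesis unfolding hellinger_close_def by blast
qed

section \<open>Shears of a standard Gaussian vector\<close>

abbreviation std_normal :: "real measure" where
  "std_normal \<equiv> density lborel (\<lambda>x. ennreal (std_normal_density x))"

abbreviation gauss :: "'i set \<Rightarrow> ('i \<Rightarrow> real) measure" where
  "gauss I \<equiv> PiM I (\<lambda>_. std_normal)"

lemma prob_space_std_normal: "prob_space std_normal"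
  by (rule prob_space_normal_density) simp

lemma prob_space_gauss: "prob_space (gauss I)"
  by (intro prob_space_PiM prob_space_std_normal)

lemma distr_PiM_coordwise:
  assumes fin: "finite I"
    and M: "\<And>i. prob_space (M i)" and F[measurable]: "\<And>i. F i \<in> measurable (M i) (M' i)"
  shows "distr (PiM I M) (PiM I M') (\<lambda>x. \<lambda>i\<in>I. F i (x i)) = PiM I (\<lambda>i. distr (M i) (M' i) (F i))"
proof -
  interpret M: product_prob_space M by (intro product_prob_spaceI M)
  interpret N: product_prob_space "\<lambda>i. distr (M i) (M' i) (F i)"
    by (intro product_prob_spaceI prob_space.prob_space_distr M F)
  show ?thesis
  proof (rule N.PiM_eqI[OF fin])
    have e: "sets (PiM I (\<lambda>i. distr (M i) (M' i) (F i))) = sets (PiM I M')"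
      by (intro sets_PiM_cong) auto
    then show "sets (distr (PiM I M) (PiM I M') (\<lambda>x. \<lambda>i\<in>I. F i (x i))) = sets (PiM I (\<lambda>i. distr (M i) (M' i) (F i)))"
      by simp
    fix A assume A: "\<And>i. i \<in> I \<Longrightarrow> A i \<in> sets (distr (M i) (M' i) (F i))"
    have "(\<lambda>x. \<lambda>i\<in>I. F i (x i)) -` Pi\<^sub>E I A \<inter> space (PiM I M) = Pi\<^sub>E I (\<lambda>i. F i -` A i \<inter> space (M i))"
      by (auto simp: space_PiM PiE_iff)
    moreover have "emeasure (PiM I M) (Pi\<^sub>E I (\<lambda>i. F i -` A i \<inter> space (M i))) = (\<Prod>i\<in>I. emeasure (M i) (F i -` A i \<inter> space (M i)))"
      by (rule M.emeasure_PiM[OF fin]) (use A in \<open>auto intro!: measurable_sets[OF F]\<close>)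
    ultimately show "emeasure (distr (PiM I M) (PiM I M') (\<lambda>x. \<lambda>i\<in>I. F i (x i))) (Pi\<^sub>E I A)
       = (\<Prod>i\<in>I. emeasure (distr (M i) (M' i) (F i)) (A i))"
      using A fin by (subst emeasure_distr) (auto simp: emeasure_distr intro!: sets_PiM_I_finite prod.cong)
  qed
qed

lemma nn_integral_std_normal_shift:
  fixes f :: "real \<Rightarrow> ennreal"
  assumes [measurable]: "f \<in> borel_measurable borel"
  shows "(\<integral>\<^sup>+y. f (y + m) \<partial>std_normal) = (\<integral>\<^sup>+y. ennreal (std_normal_density (y - m)) * f y \<partial>lborel)"
proof -
  have "(\<integral>\<^sup>+y. f (y + m) \<partial>std_normal) = (\<integral>\<^sup>+y. ennreal (std_normal_density y) * f (y + m) \<partial>lborel)"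
    by (subst nn_integral_density) auto
  also have "\<dots> = (\<integral>\<^sup>+y. ennreal (std_normal_density (y - m)) * f y \<partial>lborel)"
    by (subst nn_integral_real_affine[where c=1 and t="-m"]) auto
  finally show ?thesis .
qed

lemma std_normal_density_shift_prod:
  "std_normal_density (y - m) * std_normal_density (y + m) = (exp (- m\<^sup>2 / 2) * std_normal_density y)\<^sup>2"
proof -
  have "exp (- (y - m)\<^sup>2 / 2) * exp (- (y + m)\<^sup>2 / 2) = (exp (- m\<^sup>2 / 2) * exp (- y\<^sup>2 / 2))\<^sup>2"
    unfolding exp_add[symmetric] exp_double[symmetric] by (simp add: power2_eq_square field_simps exp_add[symmetric])
  then show ?thesis
    by (simp add: std_normal_density_def power_mult_distrib power_divide field_simps power2_eq_square)
qed

text \<open>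
Two standard normal laws shifted in opposite directions by \<open>m\<close> have \<open>\<surd>(dP dQ)\<close> equal to
\<open>exp (-m\<^sup>2/2)\<close> times the unshifted law, since the product of the two densities completes to a square.
\<close>

lemma affinity_shift:
  "affinity (ennreal (exp (- m\<^sup>2 / 2))) (distr std_normal std_normal (\<lambda>y. y + m)) (distr std_normal std_normal (\<lambda>y. y - m)) std_normal"
  unfolding affinity_def
proof (intro conjI ballI impI)
  have "prob_space (distr std_normal std_normal (\<lambda>y. y + m))" "prob_space (distr std_normal std_normal (\<lambda>y. y - m))"
    by (auto intro!: prob_space.prob_space_distr prob_space_std_normal)
  then show "finite_measure (distr std_normal std_normal (\<lambda>y. y + m))" "finite_measure (distr std_normal std_normal (\<lambda>y. y - m))"
    by (auto intro: prob_space.finite_measure)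
  show "finite_measure std_normal" using prob_space_std_normal by (auto intro: prob_space.finite_measure)
  fix f g h :: "real \<Rightarrow> ennreal"
  assume m: "f \<in> borel_measurable std_normal" "g \<in> borel_measurable std_normal" "h \<in> borel_measurable std_normal"
    and le: "\<forall>x\<in>space std_normal. (h x)\<^sup>2 \<le> f x * g x"
  have [measurable]: "f \<in> borel_measurable borel" "g \<in> borel_measurable borel" "h \<in> borel_measurable borel"
    using m by simp_all
  have "(ennreal (exp (- m\<^sup>2 / 2)) * (\<integral>\<^sup>+x. h x \<partial>std_normal))\<^sup>2
      = (\<integral>\<^sup>+x. ennreal (exp (- m\<^sup>2 / 2) * std_normal_density x) * h x \<partial>lborel)\<^sup>2"
    by (simp add: nn_integral_density nn_integral_cmult[symmetric] ennreal_mult mult.assoc)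
  also have "\<dots> \<le> (\<integral>\<^sup>+x. ennreal (std_normal_density (x - m)) * f x \<partial>lborel) * (\<integral>\<^sup>+x. ennreal (std_normal_density (x + m)) * g x \<partial>lborel)"
  proof (rule nn_integral_Cauchy_Schwarz_le)
    fix x
    have "(ennreal (exp (- m\<^sup>2 / 2) * std_normal_density x) * h x)\<^sup>2
       = ennreal (std_normal_density (x - m) * std_normal_density (x + m)) * (h x)\<^sup>2"
      unfolding std_normal_density_shift_prod
      by (subst power_mult_distrib, subst ennreal_power) auto
    also have "\<dots> \<le> ennreal (std_normal_density (x - m) * std_normal_density (x + m)) * (f x * g x)"
      using le by (intro mult_left_mono) auto
    also have "\<dots> = ennreal (std_normal_density (x - m)) * f x * (ennreal (std_normal_density (x + m)) * g x)"
      by (simp add: ennreal_mult mult_ac)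
    finally show "(ennreal (exp (- m\<^sup>2 / 2) * std_normal_density x) * h x)\<^sup>2
       \<le> ennreal (std_normal_density (x - m)) * f x * (ennreal (std_normal_density (x + m)) * g x)" .
  qed measurable
  also have "\<dots> = (\<integral>\<^sup>+x. f x \<partial>distr std_normal std_normal (\<lambda>y. y + m)) * (\<integral>\<^sup>+x. g x \<partial>distr std_normal std_normal (\<lambda>y. y - m))"
    using nn_integral_std_normal_shift[of f m] nn_integral_std_normal_shift[of g "-m"]
    by (simp add: nn_integral_distr)
  finally show "(ennreal (exp (- m\<^sup>2 / 2)) * (\<integral>\<^sup>+x. h x \<partial>std_normal))\<^sup>2 \<le>
     (\<integral>\<^sup>+x. f x \<partial>distr std_normal std_normal (\<lambda>y. y + m)) * (\<integral>\<^sup>+x. g x \<partial>distr std_normal std_normal (\<lambda>y. y - m))" .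
qed auto

lemma affinity_gauss_shift:
  assumes "finite I"
  shows "affinity (ennreal (exp (- (\<Sum>i\<in>I. (m i)\<^sup>2) / 2)))
     (distr (gauss I) (gauss I) (\<lambda>x. \<lambda>i\<in>I. x i + m i))
     (distr (gauss I) (gauss I) (\<lambda>x. \<lambda>i\<in>I. x i - m i)) (gauss I)"
proof -
  have "(\<Prod>i\<in>I. ennreal (exp (- (m i)\<^sup>2 / 2))) = ennreal (exp (- (\<Sum>i\<in>I. (m i)\<^sup>2) / 2))"
    using assms by (simp add: prod_ennreal exp_sum[symmetric] sum_divide_distrib sum_negf)
  then show ?thesis
    using affinity_PiM[OF assms affinity_shift, of m]
      distr_PiM_coordwise[OF assms prob_space_std_normal, of "\<lambda>i y. y + m i" "\<lambda>_. std_normal"]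
      distr_PiM_coordwise[OF assms prob_space_std_normal, of "\<lambda>i y. y - m i" "\<lambda>_. std_normal"]
    by simp
qed

lemma nn_integral_std_normal_square: "(\<integral>\<^sup>+x. ennreal (x\<^sup>2) \<partial>std_normal) = 1"
proof -
  have "has_bochner_integral lborel (\<lambda>x. std_normal_density x * x\<^sup>2) 1"
    using std_normal_moment_even[of 1] by simp
  then have "(\<integral>\<^sup>+x. ennreal (std_normal_density x * x\<^sup>2) \<partial>lborel) = 1"
    by (subst nn_integral_eq_integral) (auto simp: has_bochner_integral_iff)
  then show ?thesis by (subst nn_integral_density) (auto simp: ennreal_mult)
qed

text \<open>
From \<open>exp (-x) \<ge> 1 - x\<close> and the unit second moment.
\<close>

lemma nn_integral_std_normal_exp_square:
  assumes "0 \<le> W"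
  shows "ennreal (1 - W / 2) \<le> (\<integral>\<^sup>+t. ennreal (exp (- (t\<^sup>2 * W) / 2)) \<partial>std_normal)"
proof -
  interpret prob_space std_normal by (rule prob_space_std_normal)
  have "1 = (\<integral>\<^sup>+t. 1 \<partial>std_normal)" using emeasure_space_1 by simp
  also have "\<dots> \<le> (\<integral>\<^sup>+t. ennreal (exp (- (t\<^sup>2 * W) / 2)) + ennreal (W / 2) * ennreal (t\<^sup>2) \<partial>std_normal)"
  proof (rule nn_integral_mono)
    fix t
    have "1 \<le> exp (- (t\<^sup>2 * W) / 2) + W / 2 * t\<^sup>2"
      using exp_ge_add_one_self[of "- (t\<^sup>2 * W) / 2"] by (simp add: field_simps)
    then show "1 \<le> ennreal (exp (- (t\<^sup>2 * W) / 2)) + ennreal (W / 2) * ennreal (t\<^sup>2)"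
      using assms by (simp add: ennreal_mult[symmetric] ennreal_plus[symmetric] del: ennreal_plus)
  qed
  also have "\<dots> = (\<integral>\<^sup>+t. ennreal (exp (- (t\<^sup>2 * W) / 2)) \<partial>std_normal) + ennreal (W / 2)"
    by (simp add: nn_integral_add nn_integral_cmult nn_integral_std_normal_square)
  finally have "1 \<le> (\<integral>\<^sup>+t. ennreal (exp (- (t\<^sup>2 * W) / 2)) \<partial>std_normal) + ennreal (W / 2)" .
  then have "1 - ennreal (W / 2) \<le> (\<integral>\<^sup>+t. ennreal (exp (- (t\<^sup>2 * W) / 2)) \<partial>std_normal)"
    by (simp add: ennreal_minus_le_iff add.commute)
  then show ?thesis using assms by (simp add: ennreal_minus flip: ennreal_1)
qed

definition shear :: "'i set \<Rightarrow> 'i \<Rightarrow> ('i \<Rightarrow> real) \<Rightarrow> ('i \<Rightarrow> real) \<Rightarrow> 'i \<Rightarrow> real" where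
  "shear I j w z = (\<lambda>i\<in>I. z i + z j * w i)"

lemma measurable_shear[measurable]: "j \<in> I \<Longrightarrow> shear I j w \<in> measurable (gauss I) (gauss I)"
  unfolding shear_def by measurable

text \<open>
Conditionally on the coordinate \<open>z\<^sub>j = t\<close>, the two shears are shifts by \<open>\<plusminus>t w\<close> of the remaining
coordinates, with affinity \<open>exp (-t\<^sup>2 \<parallel>w\<parallel>\<^sup>2 / 2)\<close>; this factor is the density of the witness.
\<close>

lemma hellinger_close_gauss_shear:
  assumes I: "finite I" and j: "j \<in> I" and w: "w j = 0"
  shows "hellinger_close ((\<Sum>i\<in>I. (w i)\<^sup>2) / 2) (distr (gauss I) (gauss I) (shear I j w))
     (distr (gauss I) (gauss I) (shear I j (\<lambda>i. - w i)))"
proof -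
  define J where "J = I - {j}"
  have J: "finite J" "j \<notin> J" "insert j J = I" using I j by (auto simp: J_def)
  define W where "W = (\<Sum>i\<in>I. (w i)\<^sup>2)"
  have WJ: "W = (\<Sum>i\<in>J. (w i)\<^sup>2)" using sum.insert[OF J(1,2), of "\<lambda>i. (w i)\<^sup>2"] J(3) w by (simp add: W_def)
  have W0: "0 \<le> W" unfolding W_def by (intro sum_nonneg) auto
  define r where "r = (\<lambda>z::'a \<Rightarrow> real. ennreal (exp (- ((z j)\<^sup>2 * W) / 2)))"
  have r[measurable]: "r \<in> borel_measurable (gauss I)" unfolding r_def using j by measurable
  interpret g: prob_space "gauss I" by (rule prob_space_gauss)
  interpret s: prob_space std_normal by (rule prob_space_std_normal)
  interpret product_sigma_finite "\<lambda>_. std_normal"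
    unfolding product_sigma_finite_def using s.sigma_finite_measure_axioms by simp
  note ins = product_nn_integral_insert_rev[OF J(1,2), unfolded J(3)]
  let ?\<nu> = "density (gauss I) r"
  let ?P = "distr (gauss I) (gauss I) (shear I j w)" and ?Q = "distr (gauss I) (gauss I) (shear I j (\<lambda>i. - w i))"
  have mass: "emeasure ?\<nu> (space ?\<nu>) = (\<integral>\<^sup>+z. r z \<partial>gauss I)"
    by (auto simp: emeasure_density intro!: nn_integral_cong)
  have "\<dots> = (\<integral>\<^sup>+t. (\<integral>\<^sup>+y. r (y(j := t)) \<partial>gauss J) \<partial>std_normal)" by (rule ins[OF r])
  also have "\<dots> = (\<integral>\<^sup>+t. ennreal (exp (- (t\<^sup>2 * W) / 2)) \<partial>std_normal)"
    using prob_space.emeasure_space_1[OF prob_space_gauss[of J]] by (simp add: r_def)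
  finally have mass2: "emeasure ?\<nu> (space ?\<nu>) = (\<integral>\<^sup>+t. ennreal (exp (- (t\<^sup>2 * W) / 2)) \<partial>std_normal)"
    using mass by simp
  have "emeasure ?\<nu> (space ?\<nu>) \<le> (\<integral>\<^sup>+z. 1 \<partial>gauss I)"
    unfolding mass by (intro nn_integral_mono) (use W0 in \<open>auto simp: r_def\<close>)
  then have fin: "finite_measure ?\<nu>"
    using g.emeasure_space_1 by (intro finite_measureI) (auto simp: top_unique)
  have "affinity 1 (?P) (?Q) ?\<nu>"
    unfolding affinity_def
  proof (intro conjI ballI impI fin)
    show "finite_measure (?P)" "finite_measure (?Q)"
      using j by (auto intro!: g.finite_measure_distr)
    fix f g h :: "('a \<Rightarrow> real) \<Rightarrow> ennreal"
    assume m: "f \<in> borel_measurable ?\<nu>" "g \<in> borel_measurable ?\<nu>" "h \<in> borel_measurable ?\<nu>"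
      and le: "\<forall>x\<in>space ?\<nu>. (h x)\<^sup>2 \<le> f x * g x"
    have [measurable]: "f \<in> borel_measurable (gauss I)" "g \<in> borel_measurable (gauss I)" "h \<in> borel_measurable (gauss I)"
      using m by simp_all
    have IJ: "I = J \<union> {j}" using J(3) by auto
    have upd[measurable]: "(\<lambda>z. (snd z)(j := fst z)) \<in> measurable (std_normal \<Otimes>\<^sub>M gauss J) (gauss I)"
      by (rule measurable_fun_upd[OF IJ measurable_snd measurable_fst])
    have upd2: "(\<lambda>y. y(j := t)) \<in> measurable (gauss J) (gauss I)" for t
      using measurable_fun_upd[OF IJ measurable_ident measurable_const[of t]] by simp
    have upd3: "(\<lambda>z. (fst z)(j := snd z)) \<in> measurable (gauss J \<Otimes>\<^sub>M std_normal) (gauss I)"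
      by (rule measurable_fun_upd[OF IJ measurable_fst measurable_snd])
    interpret gJ: prob_space "gauss J" by (rule prob_space_gauss)
    \<comment> \<open>disintegration of a sheared Gaussian along the coordinate j\<close>
    have sh: "(\<integral>\<^sup>+z. u (shear I j (\<lambda>i. c * w i) z) \<partial>gauss I)
        = (\<integral>\<^sup>+t. (\<integral>\<^sup>+y. u (y(j := t)) \<partial>distr (gauss J) (gauss J) (\<lambda>x. \<lambda>i\<in>J. x i + t * (c * w i))) \<partial>std_normal)"
      if u[measurable]: "u \<in> borel_measurable (gauss I)" for u :: "_ \<Rightarrow> ennreal" and c
    proof -
      have "(\<integral>\<^sup>+z. u (shear I j (\<lambda>i. c * w i) z) \<partial>gauss I) = (\<integral>\<^sup>+t. (\<integral>\<^sup>+y. u (shear I j (\<lambda>i. c * w i) (y(j := t))) \<partial>gauss J) \<partial>std_normal)"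
        by (rule ins) (use j in measurable)
      also have "\<dots> = (\<integral>\<^sup>+t. (\<integral>\<^sup>+y. u (y(j := t)) \<partial>distr (gauss J) (gauss J) (\<lambda>x. \<lambda>i\<in>J. x i + t * (c * w i))) \<partial>std_normal)"
      proof (rule nn_integral_cong)
        fix t
        have "shear I j (\<lambda>i. c * w i) (y(j := t)) = (\<lambda>i\<in>J. y i + t * (c * w i))(j := t)" for y
          unfolding shear_def using J w by (auto simp: fun_eq_iff)
        then show "(\<integral>\<^sup>+y. u (shear I j (\<lambda>i. c * w i) (y(j := t))) \<partial>gauss J)
           = (\<integral>\<^sup>+y. u (y(j := t)) \<partial>distr (gauss J) (gauss J) (\<lambda>x. \<lambda>i\<in>J. x i + t * (c * w i)))"
          by (subst nn_integral_distr) (auto intro!: measurable_compose[OF upd2 u])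
      qed
      finally show ?thesis .
    qed
    have meas_aux: "(\<lambda>t. \<integral>\<^sup>+y. u (y(j := t)) \<partial>distr (gauss J) (gauss J) (\<lambda>x. \<lambda>i\<in>J. x i + t * (c * w i))) \<in> borel_measurable std_normal"
      if u[measurable]: "u \<in> borel_measurable (gauss I)" for u :: "_ \<Rightarrow> ennreal" and c
    proof -
      have "(\<lambda>t. \<integral>\<^sup>+y. u (y(j := t)) \<partial>distr (gauss J) (gauss J) (\<lambda>x. \<lambda>i\<in>J. x i + t * (c * w i)))
          = (\<lambda>t. \<integral>\<^sup>+y. u ((\<lambda>i\<in>J. y i + t * (c * w i))(j := t)) \<partial>gauss J)"
        by (rule ext, subst nn_integral_distr) (auto intro!: measurable_compose[OF upd2 u])
      also have "\<dots> \<in> borel_measurable std_normal"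
      proof -
        have "(\<lambda>z. (\<lambda>i\<in>J. snd z i + fst z * (c * w i), fst z)) \<in> measurable (std_normal \<Otimes>\<^sub>M gauss J) (gauss J \<Otimes>\<^sub>M std_normal)"
          by measurable
        from measurable_compose[OF this, of "\<lambda>q. (fst q)(j := snd q)" "gauss I"]
        have "(\<lambda>z. (\<lambda>i\<in>J. snd z i + fst z * (c * w i))(j := fst z)) \<in> measurable (std_normal \<Otimes>\<^sub>M gauss J) (gauss I)"
          using upd3 by simp
        from measurable_compose[OF this u]
        have "(\<lambda>(t, y). u ((\<lambda>i\<in>J. y i + t * (c * w i))(j := t))) \<in> borel_measurable (std_normal \<Otimes>\<^sub>M gauss J)"
          by (simp add: split_beta')
        from gJ.borel_measurable_nn_integral_fst[OF this] show ?thesis by simp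
      qed
      finally show ?thesis .
    qed
    have "(1 * (\<integral>\<^sup>+x. h x \<partial>?\<nu>))\<^sup>2 = (\<integral>\<^sup>+x. r x * h x \<partial>gauss I)\<^sup>2"
      by (simp add: nn_integral_density)
    also have "(\<integral>\<^sup>+x. r x * h x \<partial>gauss I) = (\<integral>\<^sup>+t. (\<integral>\<^sup>+y. r (y(j := t)) * h (y(j := t)) \<partial>gauss J) \<partial>std_normal)"
      by (rule ins) measurable
    also have "\<dots> = (\<integral>\<^sup>+t. ennreal (exp (- (t\<^sup>2 * W) / 2)) * (\<integral>\<^sup>+y. h (y(j := t)) \<partial>gauss J) \<partial>std_normal)"
      unfolding r_def by (simp add: nn_integral_cmult measurable_compose[OF upd2])
    also have "\<dots>\<^sup>2 \<le> (\<integral>\<^sup>+t. (\<integral>\<^sup>+y. f (y(j := t)) \<partial>distr (gauss J) (gauss J) (\<lambda>x. \<lambda>i\<in>J. x i + t * (1 * w i))) \<partial>std_normal)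
        * (\<integral>\<^sup>+t. (\<integral>\<^sup>+y. g (y(j := t)) \<partial>distr (gauss J) (gauss J) (\<lambda>x. \<lambda>i\<in>J. x i + t * ((-1) * w i))) \<partial>std_normal)"
    proof (rule nn_integral_Cauchy_Schwarz_le)
      fix t
      have s: "(\<Sum>i\<in>J. (t * w i)\<^sup>2) = t\<^sup>2 * W"
        unfolding WJ by (simp add: power_mult_distrib sum_distrib_left)
      have "affinity (ennreal (exp (- (t\<^sup>2 * W) / 2))) (distr (gauss J) (gauss J) (\<lambda>x. \<lambda>i\<in>J. x i + t * (1 * w i)))
         (distr (gauss J) (gauss J) (\<lambda>x. \<lambda>i\<in>J. x i + t * ((-1) * w i))) (gauss J)"
        using affinity_gauss_shift[OF J(1), of "\<lambda>i. t * w i"] unfolding s by simp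
      then show "(ennreal (exp (- (t\<^sup>2 * W) / 2)) * (\<integral>\<^sup>+y. h (y(j := t)) \<partial>gauss J))\<^sup>2
        \<le> (\<integral>\<^sup>+y. f (y(j := t)) \<partial>distr (gauss J) (gauss J) (\<lambda>x. \<lambda>i\<in>J. x i + t * (1 * w i)))
        * (\<integral>\<^sup>+y. g (y(j := t)) \<partial>distr (gauss J) (gauss J) (\<lambda>x. \<lambda>i\<in>J. x i + t * ((-1) * w i)))"
        by (rule affinityD) (use le measurable_space[OF upd2] in \<open>auto intro!: measurable_compose[OF upd2]\<close>)
    next
      have "(\<lambda>(t, y). h (y(j := t))) \<in> borel_measurable (std_normal \<Otimes>\<^sub>M gauss J)"
        using measurable_compose[OF upd, of h] by (simp add: split_beta')
      from gJ.borel_measurable_nn_integral_fst[OF this]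
      have hm: "(\<lambda>t. \<integral>\<^sup>+y. h (y(j := t)) \<partial>gauss J) \<in> borel_measurable std_normal" by simp
      show "(\<lambda>t. ennreal (exp (- (t\<^sup>2 * W) / 2)) * (\<integral>\<^sup>+y. h (y(j := t)) \<partial>gauss J)) \<in> borel_measurable std_normal"
        by (intro borel_measurable_times_ennreal hm) measurable
    next
      show "(\<lambda>t. \<integral>\<^sup>+y. f (y(j := t)) \<partial>distr (gauss J) (gauss J) (\<lambda>x. \<lambda>i\<in>J. x i + t * (1 * w i))) \<in> borel_measurable std_normal"
        by (rule meas_aux) measurable
      show "(\<lambda>t. \<integral>\<^sup>+y. g (y(j := t)) \<partial>distr (gauss J) (gauss J) (\<lambda>x. \<lambda>i\<in>J. x i + t * ((-1) * w i))) \<in> borel_measurable std_normal"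
        by (rule meas_aux) measurable
    qed
    also have "\<dots> = (\<integral>\<^sup>+x. f x \<partial>?P) * (\<integral>\<^sup>+x. g x \<partial>?Q)"
      using sh[of f 1] sh[of g "-1"] j by (simp add: nn_integral_distr)
    finally show "(1 * (\<integral>\<^sup>+x. h x \<partial>?\<nu>))\<^sup>2 \<le> (\<integral>\<^sup>+x. f x \<partial>?P) * (\<integral>\<^sup>+x. g x \<partial>?Q)" .
  qed auto
  moreover have "ennreal (1 - W / 2) \<le> emeasure ?\<nu> (space ?\<nu>)"
    unfolding mass2 by (rule nn_integral_std_normal_exp_square[OF W0])
  ultimately show ?thesis unfolding hellinger_close_def W_def by blast
qed

lemma distr_std_normal_uminus: "distr std_normal std_normal uminus = std_normal"
proof -
  interpret prob_space std_normal by (rule prob_space_std_normal)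
  show ?thesis
  proof (rule measure_eqI)
    fix A assume "A \<in> sets (distr std_normal std_normal uminus)"
    then have [measurable]: "A \<in> sets borel" by simp
    have "emeasure (distr std_normal std_normal uminus) A = (\<integral>\<^sup>+x. indicator A x \<partial>distr std_normal std_normal uminus)" by simp
    also have "\<dots> = (\<integral>\<^sup>+x. ennreal (std_normal_density x) * indicator A (- x) \<partial>lborel)"
      by (subst nn_integral_distr, simp, simp, subst nn_integral_density) auto
    also have "\<dots> = (\<integral>\<^sup>+x. ennreal (std_normal_density x) * indicator A x \<partial>lborel)"
      by (subst nn_integral_real_affine[where c="-1" and t=0]) (auto simp: std_normal_density_def)
    also have "\<dots> = emeasure std_normal A" by (subst emeasure_density) auto
    finally show "emeasure (distr std_normal std_normal uminus) A = emeasure std_normal A" .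
  qed simp
qed

lemma distr_gauss_flip:
  assumes "finite I" "j \<in> I"
  shows "distr (gauss I) (gauss I) (\<lambda>z. z(j := - z j)) = gauss I"
proof -
  define F where "F i = (if i = j then uminus else (\<lambda>x::real. x))" for i
  have Fm: "F i \<in> measurable std_normal std_normal" for i by (auto simp: F_def)
  have "distr (gauss I) (gauss I) (\<lambda>z. z(j := - z j)) = distr (gauss I) (gauss I) (\<lambda>x. \<lambda>i\<in>I. F i (x i))"
    using assms by (intro distr_cong) (auto simp: F_def space_PiM fun_eq_iff PiE_iff extensional_def)
  also have "\<dots> = PiM I (\<lambda>i. distr std_normal std_normal (F i))"
    by (rule distr_PiM_coordwise[OF assms(1) prob_space_std_normal Fm])
  also have "\<dots> = gauss I"
    by (intro PiM_cong refl) (auto simp: F_def distr_std_normal_uminus distr_id2)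
  finally show ?thesis .
qed

section \<open>Normal laws, spectra and conditional expectations\<close>

lemma sets_normal_law[measurable_cong, simp]: "sets (normal_law m s) = sets borel"
  by (simp add: normal_law_def)

lemma indep_vars_gauss_coordinates:
  assumes "I \<noteq> {}"
  shows "prob_space.indep_vars (gauss I) (\<lambda>_. borel) (\<lambda>i z. z i) I"
proof -
  interpret prob_space "gauss I" by (rule prob_space_gauss)
  have "(\<lambda>x. \<lambda>i\<in>I. x i) \<in> measurable (gauss I) (PiM I (\<lambda>_. borel))" by measurable
  have "distr (gauss I) (PiM I (\<lambda>_. borel)) (\<lambda>x. \<lambda>i\<in>I. x i) = distr (gauss I) (gauss I) (\<lambda>x. x)"
    by (intro distr_cong sets_PiM_cong) (auto simp: space_PiM)
  also have "\<dots> = gauss I" by (rule distr_id2) simp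
  also have "gauss I = PiM I (\<lambda>i. distr (gauss I) borel (\<lambda>x. x i))"
  proof (rule PiM_cong[OF refl])
    fix i assume "i \<in> I"
    then have "distr (gauss I) std_normal (\<lambda>x. x i) = std_normal"
      by (intro distr_PiM_component prob_space_std_normal)
    moreover have "distr (gauss I) std_normal (\<lambda>x. x i) = distr (gauss I) borel (\<lambda>x. x i)"
      by (intro distr_cong) auto
    ultimately show "std_normal = distr (gauss I) borel (\<lambda>x. x i)" by simp
  qed
  finally have eq: "distr (gauss I) (PiM I (\<lambda>_. borel)) (\<lambda>x. \<lambda>i\<in>I. x i) = PiM I (\<lambda>i. distr (gauss I) borel (\<lambda>x. x i))" .
  show ?thesis
    by (subst indep_vars_iff_distr_eq_PiM'[OF assms]) (use eq in auto)
qed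

text \<open>
The coordinates with coefficient zero are removed first: a normal density needs a positive
standard deviation.
\<close>

lemma distr_gauss_linear:
  assumes I: "finite I"
  shows "distr (gauss I) borel (\<lambda>z. \<Sum>i\<in>I. u i * z i) = normal_law 0 (sqrt (\<Sum>i\<in>I. (u i)\<^sup>2))"
proof -
  interpret prob_space "gauss I" by (rule prob_space_gauss)
  define J where "J = {i\<in>I. u i \<noteq> 0}"
  have J: "finite J" "J \<subseteq> I" using I by (auto simp: J_def)
  have s: "(\<Sum>i\<in>I. u i * z i) = (\<Sum>i\<in>J. u i * z i)" for z
    using I by (intro sum.mono_neutral_right) (auto simp: J_def)
  have s2: "(\<Sum>i\<in>I. (u i)\<^sup>2) = (\<Sum>i\<in>J. (u i)\<^sup>2)"
    using I by (intro sum.mono_neutral_right) (auto simp: J_def)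
  show ?thesis
  proof (cases "J = {}")
    case True
    then show ?thesis unfolding s s2 by (simp add: normal_law_def)
  next
    case False
    then have "I \<noteq> {}" using J by auto
    have ind: "indep_vars (\<lambda>_. borel) (\<lambda>i z. u i * z i) J"
      by (rule indep_vars_compose2[OF indep_vars_subset[OF indep_vars_gauss_coordinates[OF \<open>I \<noteq> {}\<close>] J(2)]]) auto
    have d: "distributed (gauss I) lborel (\<lambda>z. u i * z i) (normal_density 0 \<bar>u i\<bar>)" if i: "i \<in> J" for i
    proof -
      have iI: "i \<in> I" using i J by auto
      have "distr (gauss I) std_normal (\<lambda>x. x i) = std_normal"
        using iI by (intro distr_PiM_component prob_space_std_normal)
      moreover have "distr (gauss I) std_normal (\<lambda>x. x i) = distr (gauss I) lborel (\<lambda>x. x i)"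
        by (intro distr_cong) auto
      ultimately have "distributed (gauss I) lborel (\<lambda>x. x i) std_normal_density"
        using iI by (auto simp: distributed_def)
      from normal_density_affine[OF this, of "u i" 0] i show ?thesis by (simp add: J_def)
    qed
    have "distributed (gauss I) lborel (\<lambda>z. \<Sum>i\<in>J. u i * z i) (normal_density (\<Sum>i\<in>J. 0) (sqrt (\<Sum>i\<in>J. \<bar>u i\<bar>\<^sup>2)))"
      by (rule sum_indep_normal[OF J(1) False ind _ d]) (auto simp: J_def)
    then have "distr (gauss I) lborel (\<lambda>z. \<Sum>i\<in>J. u i * z i) = density lborel (normal_density 0 (sqrt (\<Sum>i\<in>J. (u i)\<^sup>2)))"
      by (simp add: distributed_def)
    moreover have "distr (gauss I) lborel (\<lambda>z. \<Sum>i\<in>J. u i * z i) = distr (gauss I) borel (\<lambda>z. \<Sum>i\<in>J. u i * z i)"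
      by (intro distr_cong) auto
    moreover have "(\<Sum>i\<in>J. (u i)\<^sup>2) > 0"
      using J False by (intro sum_pos) (auto simp: J_def)
    ultimately show ?thesis unfolding s s2 by (simp add: normal_law_def)
  qed
qed

lemma normal_law_moments:
  assumes "0 \<le> s"
  shows "integrable (normal_law 0 s) (\<lambda>x. x ^ k)"
    "(\<integral>x. x \<partial>normal_law 0 s) = 0" "(\<integral>x. x\<^sup>2 \<partial>normal_law 0 s) = s\<^sup>2" "(\<integral>x. x ^ 8 \<partial>normal_law 0 s) = 105 * s ^ 8"
proof -
  show "integrable (normal_law 0 s) (\<lambda>x. x ^ k)"
  proof (cases "s = 0")
    case True
    interpret prob_space "return borel (0::real)" by (rule prob_space_return) simp
    have "integrable (return borel (0::real)) (\<lambda>x. x ^ k)"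
      by (rule integrable_const_bound[where B="\<bar>0 ^ k\<bar>"]) (auto simp: AE_return)
    then show ?thesis using True by (simp add: normal_law_def)
  next
    case False
    then have "integrable lborel (\<lambda>x. normal_density 0 s x * (x - 0) ^ k)"
      using assms by (intro integrable_normal_moment) auto
    then show ?thesis using False by (simp add: normal_law_def integrable_density)
  qed
  show "(\<integral>x. x \<partial>normal_law 0 s) = 0"
    using assms integral_normal_moment_nz_1[of s 0]
    by (cases "s = 0") (auto simp: normal_law_def integral_return integral_density)
  show "(\<integral>x. x\<^sup>2 \<partial>normal_law 0 s) = s\<^sup>2"
    using assms integral_normal_moment_even[of s 0 1]
    by (cases "s = 0") (auto simp: normal_law_def integral_return integral_density)
  show "(\<integral>x. x ^ 8 \<partial>normal_law 0 s) = 105 * s ^ 8"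
    using assms integral_normal_moment_even[of s 0 4]
    by (cases "s = 0") (auto simp: normal_law_def integral_return integral_density fact_numeral power_divide power_mult[symmetric])
qed

text \<open>
The normal density with standard deviation \<open>s\<close> is at most \<open>1 / (2 s)\<close>, because \<open>2 \<pi> \<ge> 4\<close>.
\<close>

lemma normal_law_small_ball:
  assumes "0 < s" "0 < t"
  shows "measure (normal_law 0 s) {x. \<bar>x\<bar> \<le> t * s} \<le> t"
proof -
  have pi: "2 \<le> sqrt (2 * pi)" using pi_gt3 by (intro real_le_rsqrt) auto
  have "emeasure (normal_law 0 s) {x. \<bar>x\<bar> \<le> t * s} = (\<integral>\<^sup>+x. ennreal (normal_density 0 s x) * indicator {x. \<bar>x\<bar> \<le> t * s} x \<partial>lborel)"
    using assms by (simp add: normal_law_def emeasure_density)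
  also have "\<dots> \<le> (\<integral>\<^sup>+x. ennreal (1 / (2 * s)) * indicator {- (t * s)..t * s} x \<partial>lborel)"
  proof (rule nn_integral_mono)
    fix x
    have "normal_density 0 s x \<le> 1 / sqrt (2 * pi * s\<^sup>2)"
      by (simp add: normal_density_def divide_right_mono)
    also have "\<dots> = 1 / (sqrt (2 * pi) * s)" using assms by (simp add: real_sqrt_mult)
    also have "\<dots> \<le> 1 / (2 * s)" using pi assms by (intro divide_left_mono mult_right_mono) auto
    finally show "ennreal (normal_density 0 s x) * indicator {x. \<bar>x\<bar> \<le> t * s} x \<le> ennreal (1 / (2 * s)) * indicator {- (t * s)..t * s} x"
      by (auto simp: indicator_def abs_le_iff intro!: ennreal_leI)
  qed
  also have "\<dots> = ennreal (1 / (2 * s)) * emeasure lborel {- (t * s)..t * s}"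
    by (subst nn_integral_cmult_indicator) auto
  also have "\<dots> = ennreal (1 / (2 * s) * (2 * (t * s)))" using assms by (simp add: ennreal_mult[symmetric])
  also have "1 / (2 * s) * (2 * (t * s)) = t" using assms by simp
  finally show ?thesis using assms by (simp add: measure_def enn2real_leI)
qed

text \<open>
Multiplying the density by \<open>exp (x\<^sup>2 / c\<^sup>2)\<close> gives \<open>1 / \<surd>(1 - 2 s\<^sup>2 / c\<^sup>2)\<close> times another normal
density. The constant \<open>8 / 3\<close> is exactly what makes this factor at most two.
\<close>

lemma normal_law_exp_square:
  assumes s: "0 \<le> s" and c: "0 < c" and le: "8 * s\<^sup>2 / 3 \<le> c\<^sup>2"
  shows "(\<integral>\<^sup>+x. ennreal (exp (x\<^sup>2 / c\<^sup>2)) \<partial>normal_law 0 s) \<le> 2"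
proof (cases "s = 0")
  case True
  then show ?thesis by (simp add: normal_law_def nn_integral_return)
next
  case False
  then have s: "0 < s" using s by simp
  define q where "q = 1 - 2 * s\<^sup>2 / c\<^sup>2"
  have q: "1 / 4 \<le> q" "0 < q" 
  proof -
    have "0 < c\<^sup>2" using c by simp
    then have "2 * s\<^sup>2 / c\<^sup>2 \<le> 3 / 4" using le by (simp add: field_simps)
    then show "1 / 4 \<le> q" "0 < q" by (auto simp: q_def)
  qed
  define r where "r = s / sqrt q"
  have r: "0 < r" "r\<^sup>2 = s\<^sup>2 / q" using s q by (auto simp: r_def power_divide)
  have "normal_density 0 s x * exp (x\<^sup>2 / c\<^sup>2) = 1 / sqrt q * normal_density 0 r x" for x
  proof -
    have "- x\<^sup>2 / (2 * s\<^sup>2) + x\<^sup>2 / c\<^sup>2 = - x\<^sup>2 / (2 * r\<^sup>2)"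
      unfolding r(2) q_def using s c q by (simp add: field_simps)
    then have "exp (- x\<^sup>2 / (2 * s\<^sup>2)) * exp (x\<^sup>2 / c\<^sup>2) = exp (- x\<^sup>2 / (2 * r\<^sup>2))"
      by (simp add: exp_add[symmetric])
    moreover have "1 / sqrt (2 * pi * s\<^sup>2) = 1 / sqrt q * (1 / sqrt (2 * pi * r\<^sup>2))"
      unfolding r(2) using s q by (simp add: real_sqrt_mult real_sqrt_divide)
    ultimately show ?thesis
      by (simp add: normal_density_def mult.assoc)
  qed
  note eq = this
  have "(\<integral>\<^sup>+x. ennreal (exp (x\<^sup>2 / c\<^sup>2)) \<partial>normal_law 0 s) = (\<integral>\<^sup>+x. ennreal (normal_density 0 s x * exp (x\<^sup>2 / c\<^sup>2)) \<partial>lborel)"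
    using s by (simp add: normal_law_def nn_integral_density ennreal_mult)
  also have "\<dots> = (\<integral>\<^sup>+x. ennreal (1 / sqrt q) * ennreal (normal_density 0 r x) \<partial>lborel)"
    unfolding eq using q by (simp add: ennreal_mult[symmetric])
  also have "\<dots> = ennreal (1 / sqrt q)"
    using prob_space.emeasure_space_1[OF prob_space_normal_density[OF r(1), of 0]]
    by (simp add: nn_integral_cmult emeasure_density)
  also have "\<dots> \<le> ennreal 2"
  proof (rule ennreal_leI)
    have "1 / 2 \<le> sqrt q" using q by (intro real_le_rsqrt) (auto simp: power2_eq_square)
    then show "1 / sqrt q \<le> 2" using q by (simp add: field_simps)
  qed
  finally show ?thesis by simp
qed

text \<open>
Over the reals the spectrum of a matrix may be empty, in which case its minimum means nothing; the
eigenvector \<open>v\<close> excludes this.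
\<close>

lemma lambda_bounds:
  assumes q: "\<And>\<theta>. lm * (\<Sum>i<p. (\<theta> i)\<^sup>2) \<le> quad_form p S \<theta>" "\<And>\<theta>. quad_form p S \<theta> \<le> lp * (\<Sum>i<p. (\<theta> i)\<^sup>2)"
    and ev: "\<exists>i<p. v i \<noteq> 0" "\<And>i. i < p \<Longrightarrow> (\<Sum>j<p. S i j * v j) = \<mu> * v i"
  shows "lm \<le> lambda_min p S" "lambda_max p S \<le> lp"
proof -
  let ?A = "mat p p (\<lambda>(i, j). S i j)"
  have A: "?A \<in> carrier_mat p p" by simp
  have fin: "finite (spectrum ?A)" by (rule card_finite_spectrum(1)[OF A])
  have "vec p v \<noteq> 0\<^sub>v p"
  proof
    assume eq: "vec p v = 0\<^sub>v p"
    obtain i where "i < p" "v i \<noteq> 0" using ev by auto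
    then show False using arg_cong[OF eq, of "\<lambda>w. w $ i"] by simp
  qed
  moreover have "?A *\<^sub>v vec p v = \<mu> \<cdot>\<^sub>v vec p v"
    by (rule eq_vecI) (use ev(2) in \<open>simp_all add: scalar_prod_def atLeast0LessThan\<close>)
  ultimately have "eigenvector ?A (vec p v) \<mu>"
    unfolding eigenvector_def by simp
  then have ne: "spectrum ?A \<noteq> {}" unfolding spectrum_def eigenvalue_def by blast
  have "lm \<le> k \<and> k \<le> lp" if k: "k \<in> spectrum ?A" for k
  proof -
    obtain w where w: "w \<in> carrier_vec p" "w \<noteq> 0\<^sub>v p" "?A *\<^sub>v w = k \<cdot>\<^sub>v w"
      using k unfolding spectrum_def eigenvalue_def eigenvector_def mem_Collect_eq dim_row_mat by blast
    define \<theta> where "\<theta> i = w $ i" for i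
    have e: "(\<Sum>j<p. S i j * \<theta> j) = k * \<theta> i" if i: "i < p" for i
    proof -
      have "(?A *\<^sub>v w) $ i = (\<Sum>j<p. S i j * \<theta> j)"
        using i w(1) by (simp add: scalar_prod_def atLeast0LessThan \<theta>_def)
      then show ?thesis using w i by (simp add: \<theta>_def)
    qed
    have "quad_form p S \<theta> = (\<Sum>i<p. \<theta> i * (\<Sum>j<p. S i j * \<theta> j))"
      by (simp add: quad_form_def sum_distrib_left mult.assoc)
    also have "\<dots> = k * (\<Sum>i<p. (\<theta> i)\<^sup>2)"
      using e by (simp add: sum_distrib_left power2_eq_square mult_ac)
    finally have qk: "quad_form p S \<theta> = k * (\<Sum>i<p. (\<theta> i)\<^sup>2)" .
    obtain i where "i < p" "\<theta> i \<noteq> 0"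
      using w(1,2) unfolding \<theta>_def by (metis carrier_vecD eq_vecI index_zero_vec(1,2))
    then have "0 < (\<Sum>i<p. (\<theta> i)\<^sup>2)" by (intro sum_pos2[where i=i]) auto
    then show ?thesis using q[of \<theta>] qk by simp
  qed
  then show "lm \<le> lambda_min p S" "lambda_max p S \<le> lp"
    unfolding lambda_min_def lambda_max_def using fin ne by auto
qed

lemma real_cond_exp_pair_snd:
  fixes f :: "'b \<Rightarrow> real"
  assumes A: "prob_space A" and B: "prob_space B" and f: "integrable B f" and s: "sets A' = sets A"
  shows "AE \<omega> in A \<Otimes>\<^sub>M B. real_cond_exp (A \<Otimes>\<^sub>M B) (vimage_algebra (space (A \<Otimes>\<^sub>M B)) fst A') (\<lambda>\<omega>. f (snd \<omega>)) \<omega> = (\<integral>x. f x \<partial>B)"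
    and "subalgebra (A \<Otimes>\<^sub>M B) (vimage_algebra (space (A \<Otimes>\<^sub>M B)) fst A')"
proof -
  let ?M = "A \<Otimes>\<^sub>M B"
  let ?F = "vimage_algebra (space ?M) fst A'"
  interpret A: prob_space A by fact
  interpret B: prob_space B by fact
  interpret P: pair_prob_space A B ..
  have sp: "space A' = space A" by (rule sets_eq_imp_space_eq[OF s])
  have F: "sets ?F = {fst -` S \<inter> space ?M | S. S \<in> sets A}"
    using s sp by (subst sets_vimage_algebra2) (auto simp: space_pair_measure)
  show sub: "subalgebra ?M ?F"
    unfolding subalgebra_def F by (auto intro!: measurable_sets[OF measurable_fst])
  interpret finite_measure_subalgebra ?M ?F by standard (rule sub)
  have fi: "integrable ?M (\<lambda>\<omega>. f (snd \<omega>))"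
  proof -
    have "distr ?M B snd = B"
    proof (rule measure_eqI)
      fix T assume "T \<in> sets (distr ?M B snd)"
      then have T: "T \<in> sets B" by simp
      have "snd -` T \<inter> space ?M = space A \<times> T"
        using sets.sets_into_space[OF T] by (auto simp: space_pair_measure)
      then show "emeasure (distr ?M B snd) T = emeasure B T"
        using T by (simp add: emeasure_distr B.emeasure_pair_measure_Times A.emeasure_space_1)
    qed simp
    then have "integrable (distr ?M B snd) f" using f by simp
    then show ?thesis by (rule integrable_distr[OF measurable_snd])
  qed
  show "AE \<omega> in ?M. real_cond_exp ?M ?F (\<lambda>\<omega>. f (snd \<omega>)) \<omega> = (\<integral>x. f x \<partial>B)"
  proof (rule real_cond_exp_charact)
    fix S' assume "S' \<in> sets ?F"
    then obtain S where S: "S \<in> sets A" "S' = fst -` S \<inter> space ?M" using F by auto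
    have S'm: "S' \<in> sets ?M" using S by (auto intro!: measurable_sets[OF measurable_fst])
    have gen: "(\<integral>\<omega>\<in>S'. h (snd \<omega>) \<partial>?M) = measure A S * (\<integral>x. h x \<partial>B)" if h: "integrable ?M (\<lambda>\<omega>. h (snd \<omega>))" for h :: "'b \<Rightarrow> real"
    proof -
      have i: "integrable ?M (\<lambda>\<omega>. indicator S' \<omega> *\<^sub>R h (snd \<omega>))"
        by (rule integrable_mult_indicator[OF S'm h])
      have "(\<integral>\<omega>\<in>S'. h (snd \<omega>) \<partial>?M) = (\<integral>x. (\<integral>y. indicator S' (x, y) *\<^sub>R h y \<partial>B) \<partial>A)"
        unfolding set_lebesgue_integral_def using P.integral_fst'[OF i] by simp
      also have "\<dots> = (\<integral>x. indicator S x * (\<integral>y. h y \<partial>B) \<partial>A)"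
      proof (intro Bochner_Integration.integral_cong refl)
        fix x assume x: "x \<in> space A"
        have "(\<integral>y. indicator S' (x, y) *\<^sub>R h y \<partial>B) = (\<integral>y. indicator S x * h y \<partial>B)"
          using x by (intro Bochner_Integration.integral_cong) (auto simp: S indicator_def space_pair_measure)
        then show "(\<integral>y. indicator S' (x, y) *\<^sub>R h y \<partial>B) = indicator S x * (\<integral>y. h y \<partial>B)" by simp
      qed
      also have "\<dots> = measure A S * (\<integral>x. h x \<partial>B)" using S A.emeasure_finite by simp
      finally show ?thesis .
    qed
    show "(\<integral>\<omega>\<in>S'. f (snd \<omega>) \<partial>?M) = (\<integral>\<omega>\<in>S'. (\<integral>x. f x \<partial>B) \<partial>?M)"
      using gen[OF fi] gen[of "\<lambda>_. \<integral>x. f x \<partial>B"] by (simp add: B.prob_space)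
  qed (use fi in auto)
qed

section \<open>Gaussian linear mechanisms\<close>

definition lin_map :: "nat \<Rightarrow> (nat \<Rightarrow> nat \<Rightarrow> real) \<Rightarrow> (nat \<Rightarrow> real) \<Rightarrow> nat \<Rightarrow> real" where
  "lin_map p A z = (\<lambda>a\<in>{..<p}. \<Sum>c<p. A a c * z c)"

text \<open>
The coordinates below \<open>p\<close> of a standard Gaussian vector produce \<open>X = A z\<close>, the coordinate \<open>p\<close>
produces the noise. Having one Gaussian vector for both lets a shear trade covariates against noise.
\<close>

definition gauss_mech :: "nat \<Rightarrow> real \<Rightarrow> (nat \<Rightarrow> nat \<Rightarrow> real) \<Rightarrow> (nat \<Rightarrow> real) \<Rightarrow> mechanism" where
  "gauss_mech p R A b =
     \<lparr>law = distr (gauss {..p}) (rvec {..<p} \<Otimes>\<^sub>M borel) (\<lambda>z. (lin_map p A z, R * z p)), coef = b, noise_sd = R\<rparr>"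

lemma gauss_mech_simps[simp]:
  "coef (gauss_mech p R A b) = b" "noise_sd (gauss_mech p R A b) = R"
  "law (gauss_mech p R A b) = distr (gauss {..p}) (rvec {..<p} \<Otimes>\<^sub>M borel) (\<lambda>z. (lin_map p A z, R * z p))"
  by (simp_all add: gauss_mech_def)

lemma measurable_lin_map[measurable]: "{..<p} \<subseteq> I \<Longrightarrow> lin_map p A \<in> measurable (gauss I) (rvec {..<p})"
  unfolding lin_map_def by (intro measurable_restrict borel_measurable_sum borel_measurable_times) auto

lemma measurable_pair_lin_map:
  "(\<lambda>z. (lin_map p A z, R * z p)) \<in> measurable (gauss {..p}) (rvec {..<p} \<Otimes>\<^sub>M borel)"
  by (intro measurable_Pair measurable_lin_map borel_measurable_times) auto

lemma measurable_dotp[measurable]: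
  "dotp p \<theta> \<in> borel_measurable (rvec {..<p})"
  "(\<lambda>x. dotp p x \<theta>) \<in> borel_measurable (rvec {..<p})"
  unfolding dotp_def by (intro borel_measurable_sum borel_measurable_times; simp)+

lemma dotp_lin_map: "dotp p \<theta> (lin_map p A z) = (\<Sum>c<p. (\<Sum>a<p. \<theta> a * A a c) * z c)"
proof -
  have "dotp p \<theta> (lin_map p A z) = (\<Sum>a<p. \<Sum>c<p. \<theta> a * A a c * z c)"
    by (simp add: dotp_def lin_map_def sum_distrib_left mult.assoc)
  also have "\<dots> = (\<Sum>c<p. \<Sum>a<p. \<theta> a * A a c * z c)" by (rule sum.swap)
  finally show ?thesis by (simp add: sum_distrib_right)
qed

lemma dotp_commute: "dotp p u v = dotp p v u"
  by (simp add: dotp_def mult.commute)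

text \<open>
The quadratic form of \<open>A A\<^sup>T\<close>, which is the covariance of \<open>A z\<close> for a standard Gaussian \<open>z\<close>.
\<close>

definition fac_quad :: "nat \<Rightarrow> (nat \<Rightarrow> nat \<Rightarrow> real) \<Rightarrow> (nat \<Rightarrow> real) \<Rightarrow> real" where
  "fac_quad p A \<theta> = (\<Sum>c<p. (\<Sum>a<p. \<theta> a * A a c)\<^sup>2)"

lemma fac_quad_nonneg: "0 \<le> fac_quad p A \<theta>" unfolding fac_quad_def by (intro sum_nonneg) auto

lemma distr_gauss_mech_dotp:
  "distr (law (gauss_mech p R A b)) borel (\<lambda>\<omega>. dotp p \<theta> (fst \<omega>)) = normal_law 0 (sqrt (fac_quad p A \<theta>))"
proof -
  define u where "u c = (if c < p then \<Sum>a<p. \<theta> a * A a c else 0)" for c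
  have "distr (law (gauss_mech p R A b)) borel (\<lambda>\<omega>. dotp p \<theta> (fst \<omega>))
      = distr (gauss {..p}) borel (\<lambda>z. dotp p \<theta> (lin_map p A z))"
    unfolding gauss_mech_simps by (subst distr_distr[OF _ measurable_pair_lin_map]) (auto simp: comp_def)
  also have "(\<lambda>z. dotp p \<theta> (lin_map p A z)) = (\<lambda>z. \<Sum>i\<le>p. u i * z i)"
    by (simp add: dotp_lin_map fun_eq_iff u_def lessThan_Suc_atMost[symmetric])
  also have "distr (gauss {..p}) borel \<dots> = normal_law 0 (sqrt (\<Sum>i\<le>p. (u i)\<^sup>2))"
    by (rule distr_gauss_linear) simp
  also have "(\<Sum>i\<le>p. (u i)\<^sup>2) = fac_quad p A \<theta>"
    by (simp add: fac_quad_def u_def lessThan_Suc_atMost[symmetric])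
  finally show ?thesis .
qed

lemma distr_gauss_mech_noise:
  assumes "0 \<le> R"
  shows "distr (law (gauss_mech p R A b)) borel snd = normal_law 0 R"
proof -
  have "distr (law (gauss_mech p R A b)) borel snd = distr (gauss {..p}) borel (\<lambda>z. \<Sum>i\<le>p. (if i = p then R else 0) * z i)"
    unfolding gauss_mech_simps by (subst distr_distr[OF _ measurable_pair_lin_map]) (auto simp: comp_def if_distrib[of "\<lambda>x. x * _"] cong: if_cong)
  also have "\<dots> = normal_law 0 (sqrt (\<Sum>i\<le>p. (if i = p then R else 0)\<^sup>2))"
    by (rule distr_gauss_linear) simp
  also have "(\<Sum>i\<le>p. (if i = p then R else 0)\<^sup>2) = R\<^sup>2"
    by (simp add: if_distrib[of "\<lambda>x. x\<^sup>2"] cong: if_cong)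
  finally show ?thesis using assms by simp
qed

lemma gauss_mech_product:
  "law (gauss_mech p R A b) = distr (gauss {..<p}) (rvec {..<p}) (lin_map p A) \<Otimes>\<^sub>M distr std_normal borel (\<lambda>x. R * x)"
proof -
  interpret S: prob_space std_normal by (rule prob_space_std_normal)
  interpret G: prob_space "gauss {..<p}" by (rule prob_space_gauss)
  interpret P: pair_prob_space "gauss {..<p}" std_normal ..
  have m1[measurable]: "lin_map p A \<in> measurable (gauss {..<p}) (rvec {..<p})" by (rule measurable_lin_map) simp
  have ins: "insert p {..<p} = {..p}" by auto
  have IJ: "{..p} = {..<p} \<union> {p}" by auto
  have upd: "(\<lambda>(x, X). X(p := x)) \<in> measurable (std_normal \<Otimes>\<^sub>M gauss {..<p}) (gauss {..p})"
    unfolding split_beta' by (rule measurable_fun_upd[OF IJ measurable_snd measurable_fst])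
  have swap: "(\<lambda>(x, y). (y, x)) \<in> measurable (gauss {..<p} \<Otimes>\<^sub>M std_normal) (std_normal \<Otimes>\<^sub>M gauss {..<p})"
    by (rule measurable_pair_swap')
  have "gauss {..p} = distr (std_normal \<Otimes>\<^sub>M gauss {..<p}) (gauss {..p}) (\<lambda>(x, X). X(p := x))"
    using distr_pair_PiM_eq_PiM[of "{..<p}" "\<lambda>_. std_normal" p] prob_space_std_normal unfolding ins by simp
  also have "std_normal \<Otimes>\<^sub>M gauss {..<p} = distr (gauss {..<p} \<Otimes>\<^sub>M std_normal) (std_normal \<Otimes>\<^sub>M gauss {..<p}) (\<lambda>(x, y). (y, x))"
    by (rule pair_sigma_finite.distr_pair_swap) (unfold_locales)
  finally have g: "gauss {..p} = distr (gauss {..<p} \<Otimes>\<^sub>M std_normal) (gauss {..p}) (\<lambda>q. (fst q)(p := snd q))"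
    unfolding distr_distr[OF upd swap] by (simp add: comp_def split_beta')
  have upd2: "(\<lambda>q. (fst q)(p := snd q)) \<in> measurable (gauss {..<p} \<Otimes>\<^sub>M std_normal) (gauss {..p})"
    by (rule measurable_fun_upd[OF IJ measurable_fst measurable_snd])
  have lin_upd: "lin_map p A (x(p := y)) = lin_map p A x" for x y
    by (auto simp: lin_map_def fun_eq_iff intro!: sum.cong)
  have "law (gauss_mech p R A b) = distr (distr (gauss {..<p} \<Otimes>\<^sub>M std_normal) (gauss {..p}) (\<lambda>q. (fst q)(p := snd q)))
      (rvec {..<p} \<Otimes>\<^sub>M borel) (\<lambda>z. (lin_map p A z, R * z p))"
    using g by simp
  also have "\<dots> = distr (gauss {..<p} \<Otimes>\<^sub>M std_normal) (rvec {..<p} \<Otimes>\<^sub>M borel) (\<lambda>(x, y). (lin_map p A x, R * y))"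
    by (subst distr_distr[OF measurable_pair_lin_map upd2]) (simp add: comp_def lin_upd split_beta')
  also have "\<dots> = distr (gauss {..<p}) (rvec {..<p}) (lin_map p A) \<Otimes>\<^sub>M distr std_normal borel (\<lambda>x. R * x)"
    by (rule pair_measure_distr[symmetric, OF m1])
       (auto intro!: prob_space_imp_sigma_finite S.prob_space_distr)
  finally show ?thesis .
qed

text \<open>
By polarisation from the variances of linear combinations, which are known from the normal laws.
\<close>

lemma second_moment_gauss_mech:
  assumes ij: "i < p" "j < p"
  shows "second_moment p (gauss_mech p R A b) i j = (\<Sum>c<p. A i c * A j c)"
proof -
  let ?M = "law (gauss_mech p R A b)"
  let ?P = "gauss_mech p R A b"
  have fm: "fst \<in> measurable ?M (rvec {..<p})" by simp
  have sq: "integrable ?M (\<lambda>\<omega>. (dotp p \<theta> (fst \<omega>))\<^sup>2) \<and> (\<integral>\<omega>. (dotp p \<theta> (fst \<omega>))\<^sup>2 \<partial>?M) = fac_quad p A \<theta>" for \<theta>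
  proof -
    have m: "(\<lambda>\<omega>. dotp p \<theta> (fst \<omega>)) \<in> borel_measurable ?M"
      by (rule measurable_compose[OF fm measurable_dotp(1)])
    have s: "0 \<le> sqrt (fac_quad p A \<theta>)" using fac_quad_nonneg by simp
    have "integrable (distr ?M borel (\<lambda>\<omega>. dotp p \<theta> (fst \<omega>))) (\<lambda>x. x\<^sup>2)"
      unfolding distr_gauss_mech_dotp by (rule normal_law_moments(1)[OF s])
    moreover have "(\<integral>x. x\<^sup>2 \<partial>distr ?M borel (\<lambda>\<omega>. dotp p \<theta> (fst \<omega>))) = fac_quad p A \<theta>"
      unfolding distr_gauss_mech_dotp normal_law_moments(3)[OF s] using fac_quad_nonneg by simp
    ultimately show ?thesis
      using integrable_distr_eq[OF m, of "\<lambda>x. x\<^sup>2"] integral_distr[OF m, of "\<lambda>x. x\<^sup>2"] by simp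
  qed
  define e where "e i a = (if a = i then 1 else (0::real))" for i a :: nat
  have d: "dotp p (\<lambda>a. e i a + s * e j a) x = x i + s * x j" for s x
  proof -
    have "dotp p (\<lambda>a. e i a + s * e j a) x = (\<Sum>a<p. if a = i then x a else 0) + (\<Sum>a<p. if a = j then s * x a else 0)"
      unfolding dotp_def sum.distrib[symmetric] by (intro sum.cong) (auto simp: e_def algebra_simps)
    then show ?thesis using ij by simp
  qed
  have q: "fac_quad p A (\<lambda>a. e i a + s * e j a) = (\<Sum>c<p. (A i c + s * A j c)\<^sup>2)" for s
    using d[of s "\<lambda>a. A a c" for c] unfolding fac_quad_def dotp_def by simp
  have p: "(\<integral>\<omega>. (fst \<omega> i + s * fst \<omega> j)\<^sup>2 \<partial>?M) = (\<Sum>c<p. (A i c + s * A j c)\<^sup>2)"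
     and pi: "integrable ?M (\<lambda>\<omega>. (fst \<omega> i + s * fst \<omega> j)\<^sup>2)" for s
    using sq[of "\<lambda>a. e i a + s * e j a"] unfolding d q by auto
  have "second_moment p ?P i j = (\<integral>\<omega>. ((fst \<omega> i + 1 * fst \<omega> j)\<^sup>2 - (fst \<omega> i + (-1) * fst \<omega> j)\<^sup>2) / 4 \<partial>?M)"
    unfolding second_moment_def by (intro Bochner_Integration.integral_cong) (auto simp: power2_eq_square algebra_simps)
  also have "\<dots> = ((\<Sum>c<p. (A i c + 1 * A j c)\<^sup>2) - (\<Sum>c<p. (A i c + (-1) * A j c)\<^sup>2)) / 4"
    by (simp only: Bochner_Integration.integral_divide_zero Bochner_Integration.integral_diff[OF pi pi] p)
  also have "\<dots> = (\<Sum>c<p. A i c * A j c)"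
    unfolding sum_subtractf[symmetric] sum_divide_distrib by (intro sum.cong) (auto simp: power2_eq_square algebra_simps)
  finally show ?thesis .
qed

lemma quad_form_gauss_mech: "quad_form p (second_moment p (gauss_mech p R A b)) \<theta> = fac_quad p A \<theta>"
proof -
  have "quad_form p (second_moment p (gauss_mech p R A b)) \<theta> = (\<Sum>i<p. \<Sum>j<p. \<Sum>c<p. (\<theta> i * A i c) * (\<theta> j * A j c))"
    unfolding quad_form_def by (intro sum.cong refl) (simp add: second_moment_gauss_mech sum_distrib_left sum_distrib_right mult_ac)
  also have "\<dots> = (\<Sum>i<p. \<Sum>c<p. \<Sum>j<p. (\<theta> i * A i c) * (\<theta> j * A j c))"
    by (intro sum.cong refl sum.swap)
  also have "\<dots> = (\<Sum>c<p. \<Sum>i<p. \<Sum>j<p. (\<theta> i * A i c) * (\<theta> j * A j c))"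
    by (rule sum.swap)
  also have "\<dots> = fac_quad p A \<theta>"
    unfolding fac_quad_def power2_eq_square sum_product ..
  finally show ?thesis .
qed

lemma L2_set_square: "(L2_set f I)\<^sup>2 = (\<Sum>i\<in>I. (f i)\<^sup>2)"
  by (simp add: L2_set_def sum_nonneg)

text \<open>
Membership in the class comes down to the spectrum of \<open>A A\<^sup>T\<close> and the norm of \<open>b\<close>. The
conditions on the constants are those that a normal law needs: \<open>\<surd>(8/3)\<close> for the \<open>\<psi>\<^sub>2\<close>-norm and
\<open>105\<close>, the eighth moment of a standard normal variable, for the noise.
\<close>

lemma gauss_mech_in_class:
  assumes R: "0 < R" and lm: "0 < lm"
    and lo: "\<And>\<theta>. lm * (\<Sum>a<p. (\<theta> a)\<^sup>2) \<le> fac_quad p A \<theta>"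
    and hi: "\<And>\<theta>. fac_quad p A \<theta> \<le> lp * (\<Sum>a<p. (\<theta> a)\<^sup>2)"
    and ev: "\<exists>i<p. v i \<noteq> 0" "\<And>i. i < p \<Longrightarrow> (\<Sum>j<p. (\<Sum>c<p. A i c * A j c) * v j) = \<mu> * v i"
    and b: "b \<in> space (rvec {..<p})" "L2_set b {..<p} \<le> B"
    and cst: "0 < chi" "chi \<le> 1" "1 \<le> C" "0 < CX" "sqrt (8 * lp / 3) \<le> CX" "105 powr (1 / 4) \<le> \<kappa>"
  shows "gauss_mech p R A b \<in> P_OSS_Gauss p R B lm lp chi C \<kappa> CX"
proof -
  let ?P = "gauss_mech p R A b"
  let ?M = "law ?P"
  define M1 where "M1 = distr (gauss {..<p}) (rvec {..<p}) (lin_map p A)"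
  define M2 where "M2 = distr std_normal borel (\<lambda>x. R * x)"
  have M: "?M = M1 \<Otimes>\<^sub>M M2" unfolding M1_def M2_def by (rule gauss_mech_product)
  have m1: "lin_map p A \<in> measurable (gauss {..<p}) (rvec {..<p})" by (rule measurable_lin_map) simp
  have P1: "prob_space M1" unfolding M1_def by (intro prob_space.prob_space_distr prob_space_gauss m1)
  have P2: "prob_space M2" unfolding M2_def by (intro prob_space.prob_space_distr prob_space_std_normal) simp
  interpret P1: prob_space M1 by fact
  interpret P2: prob_space M2 by fact
  interpret pp: pair_prob_space M1 M2 ..
  interpret PM: prob_space ?M unfolding M by (rule pp.prob_space_axioms)
  have s1: "sets M1 = sets (rvec {..<p})" and s2: "sets M2 = sets borel" by (simp_all add: M1_def M2_def)
  have sets_M: "sets ?M = sets (rvec {..<p} \<Otimes>\<^sub>M borel)" by simp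
  have noise: "distr ?M borel snd = normal_law 0 R" using R by (intro distr_gauss_mech_noise) simp
  have fstm: "fst \<in> measurable ?M (rvec {..<p})" and sndm: "snd \<in> measurable ?M borel" by simp_all
  have R0: "0 \<le> R" using R by simp
  have snd_int: "integrable ?M (\<lambda>\<omega>. (snd \<omega>) ^ k)" for k
  proof -
    have "integrable (distr ?M borel snd) (\<lambda>x. x ^ k)" unfolding noise by (rule normal_law_moments(1)[OF R0])
    then show ?thesis by (rule integrable_distr[OF sndm])
  qed
  have M2: "M2 = normal_law 0 R"
  proof -
    have "distr ?M borel snd = distr std_normal borel (\<lambda>z. R * z)"
    proof -
      have "distr ?M borel snd = distr (gauss {..p}) borel (\<lambda>z. R * z p)"
        unfolding gauss_mech_simps by (subst distr_distr[OF _ measurable_pair_lin_map]) (auto simp: comp_def)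
      also have "\<dots> = distr (distr (gauss {..p}) std_normal (\<lambda>z. z p)) borel (\<lambda>x. R * x)"
        by (subst distr_distr) (auto simp: comp_def)
      also have "distr (gauss {..p}) std_normal (\<lambda>z. z p) = std_normal"
        by (rule distr_PiM_component) (auto intro: prob_space_std_normal)
      finally show ?thesis .
    qed
    then show ?thesis using noise M2_def by simp
  qed
  note ce = real_cond_exp_pair_snd[OF P1 P2 _ s1[symmetric], folded M, folded sigma_X_def]
  have i1: "integrable M2 (\<lambda>x. x)" "integrable M2 (\<lambda>x. x\<^sup>2)"
    unfolding M2 using normal_law_moments(1)[OF R0, of 1] normal_law_moments(1)[OF R0, of 2] by simp_all
  have sub: "subalgebra ?M (sigma_X p ?P)" using ce(2)[OF i1(1)] .
  interpret fs: finite_measure_subalgebra ?M "sigma_X p ?P" by standard (rule sub)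
  have ce1: "AE \<omega> in ?M. real_cond_exp ?M (sigma_X p ?P) snd \<omega> = 0"
    using ce(1)[OF i1(1)] normal_law_moments(2)[OF R0] unfolding M2 by simp
  have ce2: "AE \<omega> in ?M. cond_var ?M (sigma_X p ?P) snd \<omega> = R\<^sup>2"
  proof -
    have "AE \<omega> in ?M. real_cond_exp ?M (sigma_X p ?P) (\<lambda>x. (snd x - real_cond_exp ?M (sigma_X p ?P) snd x)\<^sup>2) \<omega>
        = real_cond_exp ?M (sigma_X p ?P) (\<lambda>x. (snd x)\<^sup>2) \<omega>"
    proof (rule fs.real_cond_exp_cong)
      show "AE x in ?M. (snd x - real_cond_exp ?M (sigma_X p ?P) snd x)\<^sup>2 = (snd x)\<^sup>2"
        using ce1 by eventually_elim simp
      have rc: "real_cond_exp ?M (sigma_X p ?P) snd \<in> borel_measurable ?M"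
        by (rule borel_measurable_cond_exp2)
      show "(\<lambda>x. (snd x - real_cond_exp ?M (sigma_X p ?P) snd x)\<^sup>2) \<in> borel_measurable ?M"
        by (intro borel_measurable_power borel_measurable_diff sndm rc)
      show "(\<lambda>x. (snd x)\<^sup>2) \<in> borel_measurable ?M" by (intro borel_measurable_power sndm)
    qed
    moreover have "AE \<omega> in ?M. real_cond_exp ?M (sigma_X p ?P) (\<lambda>x. (snd x)\<^sup>2) \<omega> = R\<^sup>2"
      using ce(1)[OF i1(2)] normal_law_moments(3)[OF R0] unfolding M2 by simp
    ultimately show ?thesis unfolding cond_var_def by eventually_elim simp
  qed
  have lin_mod: "linear_model p ?P"
    unfolding linear_model_def using ce1 ce2 b R snd_int[of 1] snd_int[of 2] PM.prob_space_axioms by simp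
  have qf: "quad_form p (second_moment p ?P) = fac_quad p A"
    by (rule ext) (rule quad_form_gauss_mech)
  have gaussX: "centred_gaussian p ?M fst (second_moment p ?P)"
    unfolding centred_gaussian_def qf by (intro allI distr_gauss_mech_dotp)
  have dm: "(\<lambda>\<omega>. dotp p \<theta> (fst \<omega>)) \<in> borel_measurable ?M" for \<theta>
    by (rule measurable_compose[OF fstm measurable_dotp(1)])
  have small: "measure ?M {\<omega> \<in> space ?M. \<bar>dotp p (fst \<omega>) \<theta>\<bar> \<le> t * sqrt (quad_form p (second_moment p ?P) \<theta>)} \<le> (C * t) powr chi"
    if \<theta>: "\<exists>i<p. \<theta> i \<noteq> 0" and t: "0 < t" for \<theta> t
  proof -
    obtain i where i: "i < p" "\<theta> i \<noteq> 0" using \<theta> by auto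
    then have "0 < (\<Sum>a<p. (\<theta> a)\<^sup>2)" by (intro sum_pos2[where i=i]) auto
    then have q: "0 < fac_quad p A \<theta>" using lo[of \<theta>] lm by (meson less_le_trans mult_pos_pos)
    have "measure ?M {\<omega> \<in> space ?M. \<bar>dotp p (fst \<omega>) \<theta>\<bar> \<le> t * sqrt (fac_quad p A \<theta>)}
       = measure (distr ?M borel (\<lambda>\<omega>. dotp p \<theta> (fst \<omega>))) {x. \<bar>x\<bar> \<le> t * sqrt (fac_quad p A \<theta>)}"
      by (subst measure_distr[OF dm]) (auto simp: dotp_commute[of p _ \<theta>] vimage_def Int_def conj_commute)
    also have "\<dots> \<le> t"
      unfolding distr_gauss_mech_dotp using q t by (intro normal_law_small_ball) auto
    finally have le_t: "measure ?M {\<omega> \<in> space ?M. \<bar>dotp p (fst \<omega>) \<theta>\<bar> \<le> t * sqrt (fac_quad p A \<theta>)} \<le> t" .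
    show ?thesis unfolding qf
    proof (cases "C * t \<le> 1")
      case True
      have "t \<le> C * t" using cst t by simp
      also have "\<dots> = (C * t) powr 1" using cst t by simp
      also have "\<dots> \<le> (C * t) powr chi"
        by (rule powr_mono') (use True cst t in auto)
      finally show "measure ?M {\<omega> \<in> space ?M. \<bar>dotp p (fst \<omega>) \<theta>\<bar> \<le> t * sqrt (fac_quad p A \<theta>)} \<le> (C * t) powr chi"
        using le_t by linarith
    next
      case False
      then have "1 \<le> (C * t) powr chi" using cst by (intro ge_one_powr_ge_zero) auto
      then show "measure ?M {\<omega> \<in> space ?M. \<bar>dotp p (fst \<omega>) \<theta>\<bar> \<le> t * sqrt (fac_quad p A \<theta>)} \<le> (C * t) powr chi"
        using PM.prob_le_1 order_trans by blast
    qed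
  qed
  have psi: "psi2_norm_vec p ?M fst \<le> ennreal CX"
    unfolding psi2_norm_vec_def
  proof (rule SUP_least)
    fix u assume "u \<in> {u \<in> space (rvec {..<p}). L2_set u {..<p} = 1}"
    then have u: "(\<Sum>a<p. (u a)\<^sup>2) = 1" using L2_set_square[of u "{..<p}"] by simp
    have q: "fac_quad p A u \<le> lp" using hi[of u] u by simp
    have "8 * (sqrt (fac_quad p A u))\<^sup>2 / 3 \<le> 8 * lp / 3" using q fac_quad_nonneg[of p A u] by simp
    also have "\<dots> \<le> CX\<^sup>2"
      using cst(4,5) by (metis less_eq_real_def sqrt_le_D)
    finally have "(\<integral>\<^sup>+x. ennreal (exp (x\<^sup>2 / CX\<^sup>2)) \<partial>normal_law 0 (sqrt (fac_quad p A u))) \<le> 2"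
      using cst fac_quad_nonneg by (intro normal_law_exp_square) auto
    then have "(\<integral>\<^sup>+\<omega>. ennreal (exp ((dotp p u (fst \<omega>))\<^sup>2 / CX\<^sup>2)) \<partial>?M) \<le> 2"
      unfolding distr_gauss_mech_dotp[of p R A b u, symmetric]
      by (subst (asm) nn_integral_distr[OF dm]) auto
    then show "psi2_norm ?M (\<lambda>\<omega>. dotp p u (fst \<omega>)) \<le> ennreal CX"
      unfolding psi2_norm_def using cst by (intro Inf_lower imageI) auto
  qed
  have sm: "(\<Sum>j<p. second_moment p ?P i j * v j) = \<mu> * v i" if "i < p" for i
    using ev(2)[OF that] that by (simp add: second_moment_gauss_mech)
  have lam: "lm \<le> lambda_min p (second_moment p ?P)" "lambda_max p (second_moment p ?P) \<le> lp"
    using lambda_bounds[of lm p "second_moment p ?P" lp v \<mu>, OF _ _ ev(1) sm] lo hi by (simp_all add: qf)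
  have m8: "(\<integral>\<omega>. (snd \<omega>) ^ 8 \<partial>?M) powr (1 / 4) \<le> \<kappa> * R\<^sup>2"
  proof -
    have "(\<integral>\<omega>. (snd \<omega>) ^ 8 \<partial>?M) = (\<integral>x. x ^ 8 \<partial>distr ?M borel snd)"
      by (subst integral_distr[OF sndm]) auto
    also have "\<dots> = 105 * R ^ 8" unfolding noise by (rule normal_law_moments(4)[OF R0])
    finally have "(\<integral>\<omega>. (snd \<omega>) ^ 8 \<partial>?M) powr (1 / 4) = 105 powr (1 / 4) * (R ^ 8) powr (1 / 4)"
      using R by (simp add: powr_mult)
    also have "(R ^ 8) powr (1 / 4) = R\<^sup>2"
    proof -
      have "(R ^ 8) powr (1 / 4) = (R powr 8) powr (1 / 4)" using R by simp
      also have "\<dots> = R powr (8 * (1 / 4))" by (rule powr_powr)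
      also have "\<dots> = R\<^sup>2" using R by simp
      finally show ?thesis .
    qed
    finally show ?thesis using cst by (simp add: mult_right_mono)
  qed
  have ind: "prob_space.indep_set ?M (sets (sigma_X p ?P)) (sets (vimage_algebra (space ?M) snd borel))"
  proof (rule PM.indep_setI)
    have F: "sets (sigma_X p ?P) = {fst -` S \<inter> space ?M | S. S \<in> sets (rvec {..<p})}"
      unfolding sigma_X_def using measurable_space[OF fstm] by (intro sets_vimage_algebra2) auto
    have G: "sets (vimage_algebra (space ?M) snd borel) = {snd -` T \<inter> space ?M | T. T \<in> sets borel}"
      by (intro sets_vimage_algebra2) auto
    show "sets (sigma_X p ?P) \<subseteq> PM.events" using sub by (simp add: subalgebra_def)
    show "sets (vimage_algebra (space ?M) snd borel) \<subseteq> PM.events"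
      unfolding G using measurable_sets[OF sndm] by auto
    fix a c assume "a \<in> sets (sigma_X p ?P)" "c \<in> sets (vimage_algebra (space ?M) snd borel)"
    then obtain S T where ST: "S \<in> sets M1" "a = fst -` S \<inter> space ?M" "T \<in> sets M2" "c = snd -` T \<inter> space ?M"
      unfolding F G s1 s2 by auto
    have sub1: "S \<subseteq> space M1" "T \<subseteq> space M2" using ST sets.sets_into_space by auto
    have sp: "space ?M = space M1 \<times> space M2" unfolding M by (rule space_pair_measure)
    have e: "a \<inter> c = S \<times> T" "a = S \<times> space M2" "c = space M1 \<times> T" using ST sub1 sp by auto
    have meas: "measure (M1 \<Otimes>\<^sub>M M2) (U \<times> V) = measure M1 U * measure M2 V" if "U \<in> sets M1" "V \<in> sets M2" for U V
      using that by (simp add: measure_def P2.emeasure_pair_measure_Times enn2real_mult)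
    show "measure ?M (a \<inter> c) = measure ?M a * measure ?M c"
      unfolding e(1) unfolding e(2,3) M using ST(1,3) by (simp add: meas P1.prob_space P2.prob_space)
  qed
  show ?thesis
    unfolding P_OSS_Gauss_def P_OSS_def mem_Collect_eq
    using lin_mod small psi lam b(2) snd_int[of 8] m8 gaussX noise ind by auto
qed

section \<open>Assouad's method for the missing-data problem\<close>

text \<open>
Cauchy--Schwarz on \<open>A\<close> and on its complement bounds the two parts \<open>x\<close>, \<open>y\<close> of the mass of the
witness by the square roots of the error probabilities; \<open>x + y \<ge> 1/2\<close> gives \<open>x\<^sup>2 + y\<^sup>2 \<ge> 1/8\<close>.
\<close>

lemma hellinger_close_test:
  assumes c: "hellinger_close \<eta> P Q" "\<eta> \<le> 1 / 2" and P: "prob_space P" and Q: "prob_space Q" and A: "A \<in> sets P"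
  shows "1 / 8 \<le> measure P (space P - A) + measure Q A"
proof -
  interpret P: prob_space P by fact
  interpret Q: prob_space Q by fact
  obtain \<nu> where n: "affinity 1 P Q \<nu>" "ennreal (1 - \<eta>) \<le> emeasure \<nu> (space \<nu>)"
    using c by (auto simp: hellinger_close_def)
  then have s: "sets P = sets \<nu>" "sets Q = sets \<nu>" and fin: "finite_measure \<nu>" by (auto simp: affinity_def)
  interpret n: finite_measure \<nu> by fact
  have sp: "space P = space \<nu>" "space Q = space \<nu>" using s sets_eq_imp_space_eq by blast+
  have "(measure \<nu> S)\<^sup>2 \<le> measure P S * measure Q S" if S: "S \<in> sets \<nu>" for S
  proof -
    have "(1 * (\<integral>\<^sup>+x. indicator S x \<partial>\<nu>))\<^sup>2 \<le> (\<integral>\<^sup>+x. indicator S x \<partial>P) * (\<integral>\<^sup>+x. indicator S x \<partial>Q)"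
      by (rule affinityD[OF n(1)]) (use S in \<open>auto simp: indicator_def\<close>)
    then have "ennreal ((measure \<nu> S)\<^sup>2) \<le> ennreal (measure P S * measure Q S)"
      using S s by (simp add: n.emeasure_eq_measure P.emeasure_eq_measure Q.emeasure_eq_measure ennreal_mult ennreal_power)
    then show ?thesis by simp
  qed
  note cs = this
  have A': "A \<in> sets \<nu>" "space \<nu> - A \<in> sets \<nu>" using A s by auto
  define x y where "x = measure \<nu> A" and "y = measure \<nu> (space \<nu> - A)"
  have "x\<^sup>2 \<le> measure P A * measure Q A" using cs[OF A'(1)] by (simp add: x_def)
  also have "\<dots> \<le> 1 * measure Q A" by (intro mult_right_mono) auto
  finally have 1: "x\<^sup>2 \<le> measure Q A" by simp
  have "y\<^sup>2 \<le> measure P (space P - A) * measure Q (space P - A)" using cs[OF A'(2)] by (simp add: y_def sp)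
  also have "\<dots> \<le> measure P (space P - A) * 1" by (intro mult_left_mono) auto
  finally have 2: "y\<^sup>2 \<le> measure P (space P - A)" by simp
  have "x + y = measure \<nu> (space \<nu>)" using A'(1) n.finite_measure_compl[OF A'(1)] by (simp add: x_def y_def)
  moreover have "1 - \<eta> \<le> measure \<nu> (space \<nu>)" using n(2) by (simp add: n.emeasure_eq_measure)
  ultimately have xy: "1 / 2 \<le> x + y" using c by simp
  have "(1 / 2)\<^sup>2 \<le> (x + y)\<^sup>2" using xy by (intro power_mono) auto
  also have "\<dots> \<le> 2 * (x\<^sup>2 + y\<^sup>2)" using sum_squares_bound[of x y] by (simp add: power2_sum)
  finally show ?thesis using 1 2 by (simp add: power2_eq_square)
qed

text \<open>
The sign of \<open>g\<close> is a test between \<open>-a\<close> and \<open>a\<close>, and an error of the test costs at least \<open>a\<^sup>2\<close>.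
\<close>

lemma hellinger_close_two_point:
  assumes c: "hellinger_close \<eta> P Q" "\<eta> \<le> 1 / 2" and P: "prob_space P" and Q: "prob_space Q"
    and s: "sets Q = sets P" and g: "g \<in> borel_measurable P" and a: "0 \<le> a"
  shows "ennreal (a\<^sup>2 / 8) \<le> (\<integral>\<^sup>+x. ennreal ((g x + a)\<^sup>2) \<partial>P) + (\<integral>\<^sup>+x. ennreal ((g x - a)\<^sup>2) \<partial>Q)"
proof -
  interpret P: prob_space P by fact
  interpret Q: prob_space Q by fact
  have sp: "space Q = space P" by (rule sets_eq_imp_space_eq[OF s])
  define A where "A = {x \<in> space P. g x < 0}"
  have A: "A \<in> sets P" unfolding A_def using g by measurable
  have sq: "a\<^sup>2 \<le> t\<^sup>2" if "a \<le> \<bar>t\<bar>" for t using power_mono[OF that a, of 2] by simp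
  have 1: "ennreal (a\<^sup>2) * emeasure P (space P - A) \<le> (\<integral>\<^sup>+x. ennreal ((g x + a)\<^sup>2) \<partial>P)"
  proof -
    have "ennreal (a\<^sup>2) * emeasure P (space P - A) = (\<integral>\<^sup>+x. ennreal (a\<^sup>2) * indicator (space P - A) x \<partial>P)"
      using A by (subst nn_integral_cmult_indicator) auto
    also have "\<dots> \<le> (\<integral>\<^sup>+x. ennreal ((g x + a)\<^sup>2) \<partial>P)"
      by (intro nn_integral_mono) (use a in \<open>auto simp: indicator_def A_def intro!: ennreal_leI sq\<close>)
    finally show ?thesis .
  qed
  have 2: "ennreal (a\<^sup>2) * emeasure Q A \<le> (\<integral>\<^sup>+x. ennreal ((g x - a)\<^sup>2) \<partial>Q)"
  proof -
    have "ennreal (a\<^sup>2) * emeasure Q A = (\<integral>\<^sup>+x. ennreal (a\<^sup>2) * indicator A x \<partial>Q)"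
      using A s by (subst nn_integral_cmult_indicator) auto
    also have "\<dots> \<le> (\<integral>\<^sup>+x. ennreal ((g x - a)\<^sup>2) \<partial>Q)"
      by (intro nn_integral_mono) (use a in \<open>auto simp: indicator_def A_def intro!: ennreal_leI sq\<close>)
    finally show ?thesis .
  qed
  have "ennreal (a\<^sup>2 / 8) = ennreal (a\<^sup>2 * (1 / 8))" by simp
  also have "\<dots> \<le> ennreal (a\<^sup>2 * (measure P (space P - A) + measure Q A))"
    using hellinger_close_test[OF c P Q A] by (intro ennreal_leI mult_left_mono) auto
  also have "\<dots> = ennreal (a\<^sup>2) * emeasure P (space P - A) + ennreal (a\<^sup>2) * emeasure Q A"
    by (simp add: ennreal_mult' P.emeasure_eq_measure Q.emeasure_eq_measure distrib_left[symmetric])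
  also have "\<dots> \<le> (\<integral>\<^sup>+x. ennreal ((g x + a)\<^sup>2) \<partial>P) + (\<integral>\<^sup>+x. ennreal ((g x - a)\<^sup>2) \<partial>Q)"
    by (rule add_mono[OF 1 2])
  finally show ?thesis .
qed

definition sign_in :: "nat set \<Rightarrow> nat \<Rightarrow> real" where
  "sign_in v j = (if j \<in> v then 1 else - 1)"

lemma sign_in_square[simp]: "(sign_in v j)\<^sup>2 = 1" by (simp add: sign_in_def)

text \<open>
The sum of the losses over all sign vectors splits, for each \<open>j\<close>, into pairs that differ in \<open>j\<close> only.
\<close>

lemma assouad:
  fixes Q :: "nat set \<Rightarrow> 'd measure" and g :: "'d \<Rightarrow> nat \<Rightarrow> real"
  assumes J: "finite J" and a: "\<And>j. j \<in> J \<Longrightarrow> 0 \<le> a j"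
    and g: "\<And>j. j \<in> J \<Longrightarrow> (\<lambda>x. g x j) \<in> borel_measurable D"
    and Q: "\<And>v. v \<subseteq> J \<Longrightarrow> prob_space (Q v)" "\<And>v. v \<subseteq> J \<Longrightarrow> sets (Q v) = sets D"
    and cl: "\<And>v j. j \<in> J \<Longrightarrow> v \<subseteq> J - {j} \<Longrightarrow> hellinger_close (1 / 2) (Q v) (Q (insert j v))"
    and S: "\<And>v. v \<subseteq> J \<Longrightarrow> (\<integral>\<^sup>+x. ennreal (\<Sum>j\<in>J. (g x j - sign_in v j * a j)\<^sup>2) \<partial>Q v) \<le> S"
  shows "ennreal (1 / 16 * (\<Sum>j\<in>J. (a j)\<^sup>2)) \<le> S"
proof -
  define F where "F v j = (\<integral>\<^sup>+x. ennreal ((g x j - sign_in v j * a j)\<^sup>2) \<partial>Q v)" for v j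
  have gm: "(\<lambda>x. g x j) \<in> borel_measurable (Q v)" if "j \<in> J" "v \<subseteq> J" for j v
    using g[OF that(1)] measurable_cong_sets[OF Q(2)[OF that(2)] refl] by blast
  have pair: "ennreal ((a j)\<^sup>2 / 8) \<le> F v j + F (insert j v) j" if "j \<in> J" "v \<subseteq> J - {j}" for j v
  proof -
    have v: "v \<subseteq> J" "insert j v \<subseteq> J" "j \<notin> v" using that by auto
    have "ennreal ((a j)\<^sup>2 / 8) \<le> (\<integral>\<^sup>+x. ennreal ((g x j + a j)\<^sup>2) \<partial>Q v) + (\<integral>\<^sup>+x. ennreal ((g x j - a j)\<^sup>2) \<partial>Q (insert j v))"
      using Q v by (intro hellinger_close_two_point[OF cl[OF that]] a that gm) auto
    then show ?thesis unfolding F_def using v by (simp add: sign_in_def)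
  qed
  have flip: "(\<Sum>v\<in>Pow J. F v j) = (\<Sum>v\<in>Pow (J - {j}). F v j + F (insert j v) j)" if j: "j \<in> J" for j
  proof -
    have "Pow J = Pow (J - {j}) \<union> insert j ` Pow (J - {j})"
      using j Pow_insert[of j "J - {j}"] by (simp add: insert_absorb)
    moreover have "Pow (J - {j}) \<inter> insert j ` Pow (J - {j}) = {}" by auto
    moreover have "inj_on (insert j) (Pow (J - {j}))" by (auto simp: inj_on_def)
    ultimately show ?thesis using J
      by (simp add: sum.union_disjoint sum.reindex sum.distrib)
  qed
  have n: "2 ^ card (J - {j}) * 2 = (2 ^ card J :: real)" if "j \<in> J" for j
    using J that by (metis card_Suc_Diff1 power_Suc2)
  have "ennreal (2 ^ card J * (1 / 16 * (\<Sum>j\<in>J. (a j)\<^sup>2))) = (\<Sum>j\<in>J. ennreal (2 ^ card J / 16 * (a j)\<^sup>2))"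
    by (simp add: sum_distrib_left)
  also have "\<dots> \<le> (\<Sum>j\<in>J. \<Sum>v\<in>Pow (J - {j}). F v j + F (insert j v) j)"
  proof (rule sum_mono)
    fix j assume j: "j \<in> J"
    have "ennreal (2 ^ card J / 16 * (a j)\<^sup>2) = ennreal (2 ^ card (J - {j}) * ((a j)\<^sup>2 / 8))"
      using n[OF j] by simp
    also have "\<dots> = (\<Sum>v\<in>Pow (J - {j}). ennreal ((a j)\<^sup>2 / 8))"
      using J ennreal_power[of 2 "card (J - {j})"] ennreal_mult'[of "2 ^ card (J - {j})" "(a j)\<^sup>2 / 8"]
      by (simp add: card_Pow)
    also have "\<dots> \<le> (\<Sum>v\<in>Pow (J - {j}). F v j + F (insert j v) j)"
      by (intro sum_mono pair j) auto
    finally show "ennreal (2 ^ card J / 16 * (a j)\<^sup>2) \<le> (\<Sum>v\<in>Pow (J - {j}). F v j + F (insert j v) j)" .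
  qed
  also have "\<dots> = (\<Sum>j\<in>J. \<Sum>v\<in>Pow J. F v j)" using flip by simp
  also have "\<dots> = (\<Sum>v\<in>Pow J. \<Sum>j\<in>J. F v j)" by (rule sum.swap)
  also have "\<dots> \<le> (\<Sum>v\<in>Pow J. S)"
  proof (rule sum_mono)
    fix v assume v: "v \<in> Pow J"
    have "(\<Sum>j\<in>J. F v j) = (\<integral>\<^sup>+x. (\<Sum>j\<in>J. ennreal ((g x j - sign_in v j * a j)\<^sup>2)) \<partial>Q v)"
      unfolding F_def using gm v by (subst nn_integral_sum) auto
    also have "\<dots> = (\<integral>\<^sup>+x. ennreal (\<Sum>j\<in>J. (g x j - sign_in v j * a j)\<^sup>2) \<partial>Q v)" by simp
    finally show "(\<Sum>j\<in>J. F v j) \<le> S" using S v by auto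
  qed
  also have "\<dots> = ennreal (2 ^ card J) * S"
    using J by (simp add: card_Pow ennreal_power[symmetric] of_nat_power)
  finally have main: "ennreal (2 ^ card J * (1 / 16 * (\<Sum>j\<in>J. (a j)\<^sup>2))) \<le> ennreal (2 ^ card J) * S" .
  show ?thesis
  proof (cases S)
    case (real s)
    then have "ennreal (2 ^ card J * (1 / 16 * (\<Sum>j\<in>J. (a j)\<^sup>2))) \<le> ennreal (2 ^ card J * s)"
      using main by (simp add: ennreal_mult)
    then have "2 ^ card J * (1 / 16 * (\<Sum>j\<in>J. (a j)\<^sup>2)) \<le> 2 ^ card J * s"
      using real by (subst (asm) ennreal_le_iff) auto
    then have "1 / 16 * (\<Sum>j\<in>J. (a j)\<^sup>2) \<le> s" by (subst (asm) mult_le_cancel_left_pos) auto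
    then show ?thesis using real by (simp add: ennreal_leI)
  qed simp
qed

lemma sets_data_law[simp]: "sets (data_law p K Obs n N P) = sets (data_space p K Obs n N)"
  unfolding data_law_def data_space_def labelled_law_def
  by (intro sets_pair_measure_cong sets_PiM_cong refl) auto

lemma est_error_square: "(est_error p bhat P x)\<^sup>2 = (\<Sum>i<p. (bhat x i - coef P i)\<^sup>2)"
  by (simp add: est_error_def L2_set_square)

text \<open>
An estimator is only required to have measurable losses \<open>\<parallel>bhat - \<beta>\<parallel>\<close>. Its \<open>j\<close>-th coordinate is still
measurable, since the squared losses at two hypotheses that differ in \<open>\<beta>\<^sub>j\<close> only have the difference
\<open>4 a\<^sub>j bhat\<^sub>j\<close>.
\<close>

lemma minimax_risk_ge:
  assumes J: "J \<subseteq> {..<p}" and a: "\<And>j. j \<in> J \<Longrightarrow> 0 < a j"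
    and P: "\<And>v. v \<subseteq> J \<Longrightarrow> P v \<in> P_OSS_Gauss p R B lm lp chi C \<kappa> CX"
    and coef: "\<And>v j. v \<subseteq> J \<Longrightarrow> j \<in> J \<Longrightarrow> coef (P v) j = sign_in v j * a j"
      "\<And>v i. v \<subseteq> J \<Longrightarrow> i < p \<Longrightarrow> i \<notin> J \<Longrightarrow> coef (P v) i = coef (P {}) i"
    and pr: "\<And>v. v \<subseteq> J \<Longrightarrow> prob_space (data_law p K Obs n N (P v))"
    and cl: "\<And>v j. j \<in> J \<Longrightarrow> v \<subseteq> J - {j} \<Longrightarrow>
        hellinger_close (1 / 2) (data_law p K Obs n N (P v)) (data_law p K Obs n N (P (insert j v)))"
    and bhat: "bhat \<in> estimators p K Obs n N (P_OSS p R B lm lp chi C \<kappa> CX)"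
  shows "ennreal (1 / 16 * (\<Sum>j\<in>J. (a j)\<^sup>2)) \<le> (SUP P\<in>P_OSS_Gauss p R B lm lp chi C \<kappa> CX. risk p K Obs n N bhat P)"
proof (rule assouad[where Q = "\<lambda>v. data_law p K Obs n N (P v)" and g = bhat and D = "data_space p K Obs n N"])
  let ?D = "data_space p K Obs n N"
  show fin: "finite J" using J finite_subset by blast
  show "\<And>j. j \<in> J \<Longrightarrow> 0 \<le> a j" using a by (simp add: less_imp_le)
  show "\<And>v. v \<subseteq> J \<Longrightarrow> sets (data_law p K Obs n N (P v)) = sets ?D" by simp
  show "(\<lambda>x. bhat x j) \<in> borel_measurable ?D" if j: "j \<in> J" for j
  proof -
    have em: "est_error p bhat (P v) \<in> borel_measurable ?D" if "v \<subseteq> J" for v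
      using P[OF that] bhat by (auto simp: estimators_def P_OSS_Gauss_def)
    have jp: "j \<in> {..<p}" using J j by auto
    have cf: "coef (P {j}) i = coef (P {}) i" if "i < p" "i \<noteq> j" for i
      using coef(1)[of "{j}" i] coef(1)[of "{}" i] coef(2)[of "{j}" i] j that by (cases "i \<in> J") (auto simp: sign_in_def)
    have "(est_error p bhat (P {}) x)\<^sup>2 - (est_error p bhat (P {j}) x)\<^sup>2 = 4 * a j * bhat x j" for x
    proof -
      have "(est_error p bhat (P {}) x)\<^sup>2 - (est_error p bhat (P {j}) x)\<^sup>2
         = (\<Sum>i<p. (bhat x i - coef (P {}) i)\<^sup>2 - (bhat x i - coef (P {j}) i)\<^sup>2)"
        by (simp add: est_error_square sum_subtractf)
      also have "\<dots> = (bhat x j - coef (P {}) j)\<^sup>2 - (bhat x j - coef (P {j}) j)\<^sup>2"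
        using jp cf by (subst sum.remove[OF _ jp]) (auto intro!: sum.neutral)
      also have "\<dots> = 4 * a j * bhat x j"
        using coef(1)[of "{j}" j] coef(1)[of "{}" j] j by (simp add: sign_in_def power2_eq_square algebra_simps)
      finally show ?thesis .
    qed
    then have "(\<lambda>x. bhat x j) = (\<lambda>x. ((est_error p bhat (P {}) x)\<^sup>2 - (est_error p bhat (P {j}) x)\<^sup>2) / (4 * a j))"
      using a[OF j] by (simp add: fun_eq_iff)
    also have "\<dots> \<in> borel_measurable ?D"
      by (intro borel_measurable_divide borel_measurable_diff borel_measurable_power em borel_measurable_const) (use j in auto)
    finally show ?thesis .
  qed
  show "(\<integral>\<^sup>+x. ennreal (\<Sum>j\<in>J. (bhat x j - sign_in v j * a j)\<^sup>2) \<partial>data_law p K Obs n N (P v))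
      \<le> (SUP P\<in>P_OSS_Gauss p R B lm lp chi C \<kappa> CX. risk p K Obs n N bhat P)" if v: "v \<subseteq> J" for v
  proof -
    have "(\<integral>\<^sup>+x. ennreal (\<Sum>j\<in>J. (bhat x j - sign_in v j * a j)\<^sup>2) \<partial>data_law p K Obs n N (P v)) \<le> risk p K Obs n N bhat (P v)"
      unfolding risk_def
    proof (intro nn_integral_mono ennreal_leI)
      fix x
      have "(\<Sum>j\<in>J. (bhat x j - sign_in v j * a j)\<^sup>2) = (\<Sum>j\<in>J. (bhat x j - coef (P v) j)\<^sup>2)"
        using coef(1)[OF v] by simp
      also have "\<dots> \<le> (\<Sum>i<p. (bhat x i - coef (P v) i)\<^sup>2)" using J by (intro sum_mono2) auto
      finally show "(\<Sum>j\<in>J. (bhat x j - sign_in v j * a j)\<^sup>2) \<le> (est_error p bhat (P v) x)\<^sup>2"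
        by (simp add: est_error_square)
    qed
    also have "\<dots> \<le> (SUP P\<in>P_OSS_Gauss p R B lm lp chi C \<kappa> CX. risk p K Obs n N bhat P)"
      by (intro SUP_upper P v)
    finally show ?thesis .
  qed
qed (use pr cl in auto)

lemma hellinger_close_data_law:
  assumes "\<And>k. k < K \<Longrightarrow> hellinger_close (\<eta> k) (labelled_law p (Obs k) P) (labelled_law p (Obs k) P')"
    and "hellinger_close \<eta>' (distr (law P) (rvec {..<p}) fst) (distr (law P') (rvec {..<p}) fst)"
    and "\<And>k. k < K \<Longrightarrow> 0 \<le> \<eta> k" "0 \<le> \<eta>'"
  shows "hellinger_close ((\<Sum>k<K. real (n k) * \<eta> k) + real N * \<eta>') (data_law p K Obs n N P) (data_law p K Obs n N P')"
proof -
  have 1: "hellinger_close (real m * e) (PiM {..<m} (\<lambda>_. A)) (PiM {..<m} (\<lambda>_. A'))" if "hellinger_close e A A'" "0 \<le> e"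
    for m :: nat and e and A A' :: "'x measure"
    using hellinger_close_PiM[of "{..<m}" "\<lambda>_. e" "\<lambda>_. A" "\<lambda>_. A'"] that by simp
  show ?thesis unfolding data_law_def
    using assms by (intro hellinger_close_pair hellinger_close_PiM 1) (auto intro!: sum_nonneg)
qed

definition sample :: "nat \<Rightarrow> real \<Rightarrow> (nat \<Rightarrow> nat \<Rightarrow> real) \<Rightarrow> (nat \<Rightarrow> real) \<Rightarrow> nat set \<Rightarrow> (nat \<Rightarrow> real) \<Rightarrow> (nat \<Rightarrow> real) \<times> real" where
  "sample p R A b Ok z = (restrict (lin_map p A z) Ok, dotp p (lin_map p A z) b + R * z p)"

lemma sample_map_measurable:
  assumes "Ok \<subseteq> {..<p}"
  shows "(\<lambda>\<omega>. (restrict (fst \<omega>) Ok, dotp p (fst \<omega>) b + snd \<omega>)) \<in> measurable (rvec {..<p} \<Otimes>\<^sub>M borel) (rvec Ok \<Otimes>\<^sub>M borel)"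
proof (rule measurable_Pair)
  have "(\<lambda>x. restrict x Ok) \<in> measurable (rvec {..<p}) (rvec Ok)"
    using assms by (rule measurable_restrict_subset)
  then show "(\<lambda>\<omega>. restrict (fst \<omega>) Ok) \<in> measurable (rvec {..<p} \<Otimes>\<^sub>M borel) (rvec Ok)"
    by (rule measurable_compose[OF measurable_fst])
  show "(\<lambda>\<omega>. dotp p (fst \<omega>) b + snd \<omega>) \<in> borel_measurable (rvec {..<p} \<Otimes>\<^sub>M borel)"
    by (intro borel_measurable_add measurable_compose[OF measurable_fst measurable_dotp(2)] measurable_snd)
qed

lemma sample_measurable:
  "Ok \<subseteq> {..<p} \<Longrightarrow> sample p R A b Ok \<in> measurable (gauss {..p}) (rvec Ok \<Otimes>\<^sub>M borel)"
  using measurable_compose[OF measurable_pair_lin_map[of p A R] sample_map_measurable] by (simp add: sample_def[abs_def])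

lemma labelled_law_gauss_mech:
  assumes "Ok \<subseteq> {..<p}"
  shows "labelled_law p Ok (gauss_mech p R A b) = distr (gauss {..p}) (rvec Ok \<Otimes>\<^sub>M borel) (sample p R A b Ok)"
  unfolding labelled_law_def gauss_mech_simps
  by (subst distr_distr[OF sample_map_measurable[OF assms] measurable_pair_lin_map]) (simp add: comp_def sample_def[abs_def])

lemma unlabelled_law_gauss_mech:
  "distr (law (gauss_mech p R A b)) (rvec {..<p}) fst = distr (gauss {..p}) (rvec {..<p}) (lin_map p A)"
  unfolding gauss_mech_simps by (subst distr_distr[OF measurable_fst measurable_pair_lin_map]) (simp add: comp_def)

lemma prob_space_data_law_gauss_mech:
  assumes "\<And>k. k < K \<Longrightarrow> Obs k \<subseteq> {..<p}"
  shows "prob_space (data_law p K Obs n N (gauss_mech p R A b))"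
proof -
  have l: "lin_map p A \<in> measurable (gauss {..p}) (rvec {..<p})" by (rule measurable_lin_map) auto
  have 1: "prob_space (PiM {..<K} (\<lambda>k. PiM {..<n k} (\<lambda>_. labelled_law p (Obs k) (gauss_mech p R A b))))"
    using assms by (intro prob_space_PiM) (auto simp: labelled_law_gauss_mech intro!: prob_space.prob_space_distr prob_space_gauss sample_measurable)
  have 2: "prob_space (PiM {..<N} (\<lambda>_. distr (law (gauss_mech p R A b)) (rvec {..<p}) fst))"
    unfolding unlabelled_law_gauss_mech by (intro prob_space_PiM prob_space.prob_space_distr prob_space_gauss l)
  interpret A: prob_space "PiM {..<K} (\<lambda>k. PiM {..<n k} (\<lambda>_. labelled_law p (Obs k) (gauss_mech p R A b)))" by (rule 1)
  interpret B: prob_space "PiM {..<N} (\<lambda>_. distr (law (gauss_mech p R A b)) (rvec {..<p}) fst)" by (rule 2)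
  interpret pair_prob_space "PiM {..<K} (\<lambda>k. PiM {..<n k} (\<lambda>_. labelled_law p (Obs k) (gauss_mech p R A b)))" "PiM {..<N} (\<lambda>_. distr (law (gauss_mech p R A b)) (rvec {..<p}) fst)" ..
  show ?thesis unfolding data_law_def by (rule prob_space_axioms)
qed

lemma hellinger_close_distr_shear:
  assumes j: "j \<in> I" "finite I" and w: "w j = 0" and \<Psi>: "\<Psi> \<in> measurable (gauss I) N"
    and 1: "\<And>z. \<Phi> z = \<Psi> (shear I j (\<lambda>i. - w i) z)" and 2: "\<And>z. \<Phi>' z = \<Psi> (shear I j w z)"
  shows "hellinger_close ((\<Sum>i\<in>I. (w i)\<^sup>2) / 2) (distr (gauss I) N \<Phi>) (distr (gauss I) N \<Phi>')"
proof -
  have "distr (gauss I) N \<Phi> = distr (distr (gauss I) (gauss I) (shear I j (\<lambda>i. - w i))) N \<Psi>"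
    by (subst distr_distr[OF \<Psi> measurable_shear[OF j(1)]]) (simp add: comp_def flip: 1)
  moreover have "distr (gauss I) N \<Phi>' = distr (distr (gauss I) (gauss I) (shear I j w)) N \<Psi>"
    by (subst distr_distr[OF \<Psi> measurable_shear[OF j(1)]]) (simp add: comp_def flip: 2)
  moreover have "hellinger_close ((\<Sum>i\<in>I. (w i)\<^sup>2) / 2) (distr (gauss I) (gauss I) (shear I j (\<lambda>i. - w i))) (distr (gauss I) (gauss I) (shear I j w))"
    using hellinger_close_gauss_shear[OF j(2,1), of "\<lambda>i. - w i"] w by simp
  ultimately show ?thesis using hellinger_close_distr[OF _ , of _ _ _ \<Psi> N] \<Psi> by simp
qed

lemma distr_gauss_flip_eq:
  assumes j: "j \<in> I" "finite I" and m: "\<Phi> \<in> measurable (gauss I) N"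
    and 1: "\<And>z. \<Phi>' z = \<Phi> (z(j := - z j))"
  shows "distr (gauss I) N \<Phi>' = distr (gauss I) N \<Phi>"
proof -
  have fm: "(\<lambda>z. z(j := - z j)) \<in> measurable (gauss I) (gauss I)"
  proof -
    have "I = I \<union> {j}" using j by auto
    moreover have "(\<lambda>z. - z j) \<in> measurable (gauss I) std_normal" using j by simp
    ultimately show ?thesis by (intro measurable_fun_upd) auto
  qed
  have "distr (gauss I) N \<Phi> = distr (distr (gauss I) (gauss I) (\<lambda>z. z(j := - z j))) N \<Phi>"
    using distr_gauss_flip[OF j(2,1)] by simp
  also have "\<dots> = distr (gauss I) N \<Phi>'"
    by (subst distr_distr[OF m fm]) (simp add: comp_def flip: 1)
  finally show ?thesis by simp
qed

lemma hellinger_close_labelled_law_shear: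
  assumes Ok: "Ok \<subseteq> {..<p}" and j: "j < p" and w: "w j = 0"
    and 1: "\<And>z. sample p R A b Ok z = sample p R A0 b0 Ok (shear {..p} j (\<lambda>a. - w a) z)"
    and 2: "\<And>z. sample p R A' b' Ok z = sample p R A0 b0 Ok (shear {..p} j w z)"
  shows "hellinger_close ((\<Sum>a\<le>p. (w a)\<^sup>2) / 2) (labelled_law p Ok (gauss_mech p R A b)) (labelled_law p Ok (gauss_mech p R A' b'))"
  unfolding labelled_law_gauss_mech[OF Ok]
  by (rule hellinger_close_distr_shear[OF _ _ w sample_measurable[OF Ok] 1 2]) (use j in auto)

text \<open>
The second alternative is for samples that do not show \<open>X\<^sub>j\<close>: they cannot tell \<open>z\<^sub>j\<close> from \<open>-z\<^sub>j\<close>.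
\<close>

lemma hellinger_close_labelled_law_eq:
  assumes Ok: "Ok \<subseteq> {..<p}" and j: "j < p"
    and eq: "(\<forall>z. sample p R A' b' Ok z = sample p R A b Ok z) \<or> (\<forall>z. sample p R A' b' Ok z = sample p R A b Ok (z(j := - z j)))"
  shows "hellinger_close 0 (labelled_law p Ok (gauss_mech p R A b)) (labelled_law p Ok (gauss_mech p R A' b'))"
proof -
  have "labelled_law p Ok (gauss_mech p R A' b') = labelled_law p Ok (gauss_mech p R A b)"
    unfolding labelled_law_gauss_mech[OF Ok] using eq
  proof
    assume "\<forall>z. sample p R A' b' Ok z = sample p R A b Ok z"
    then show "distr (gauss {..p}) (rvec Ok \<Otimes>\<^sub>M borel) (sample p R A' b' Ok) = distr (gauss {..p}) (rvec Ok \<Otimes>\<^sub>M borel) (sample p R A b Ok)"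
      by (intro distr_cong) auto
  next
    assume "\<forall>z. sample p R A' b' Ok z = sample p R A b Ok (z(j := - z j))"
    then show "distr (gauss {..p}) (rvec Ok \<Otimes>\<^sub>M borel) (sample p R A' b' Ok) = distr (gauss {..p}) (rvec Ok \<Otimes>\<^sub>M borel) (sample p R A b Ok)"
      using j by (intro distr_gauss_flip_eq[OF _ _ sample_measurable[OF Ok]]) auto
  qed
  moreover have "prob_space (labelled_law p Ok (gauss_mech p R A b))"
    unfolding labelled_law_gauss_mech[OF Ok]
    by (intro prob_space.prob_space_distr prob_space_gauss sample_measurable[OF Ok])
  ultimately show ?thesis by (simp add: hellinger_close_refl)
qed

section \<open>The price of an unknown covariance\<close>

text \<open>
A factor \<open>A\<close> of the covariance matrix \<open>A A\<^sup>T\<close> with diagonal \<open>lam\<close>, entries \<open>-e\<^sub>c\<close> at \<open>(i, c)\<close> and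
\<open>(c, i)\<close>, and zeros elsewhere, provided that \<open>\<kappa> = lam - \<Sum> e\<^sub>c\<^sup>2 / lam\<close>.
\<close>

definition arrow :: "nat \<Rightarrow> real \<Rightarrow> real \<Rightarrow> (nat \<Rightarrow> real) \<Rightarrow> nat \<Rightarrow> nat \<Rightarrow> real" where
  "arrow i lam \<kappa> e a c =
     (if a = i then (if c = i then sqrt \<kappa> else - e c / sqrt lam) else if a = c then sqrt lam else 0)"

text \<open>
The regression vector for which the response depends on the \<open>i\<close>-th Gaussian coordinate and the noise
only: what \<open>X\<^sub>i\<close> inherits from the other covariates is cancelled.
\<close>

definition arrow_coef :: "nat \<Rightarrow> nat \<Rightarrow> real \<Rightarrow> real \<Rightarrow> (nat \<Rightarrow> real) \<Rightarrow> nat \<Rightarrow> real" where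
  "arrow_coef p i lam b0 e = (\<lambda>a\<in>{..<p}. if a = i then b0 else e a * b0 / lam)"

lemma sum_lessThan_split: "i < p \<Longrightarrow> (\<Sum>c<p. f c) = f i + (\<Sum>c\<in>{..<p} - {i}. f c)" for f :: "nat \<Rightarrow> real"
  by (rule sum.remove) auto

lemma sum_arrow_row:
  assumes "i < p" "a < p"
  shows "(\<Sum>c<p. arrow i lam \<kappa> e a c * x c) = (if a = i then sqrt \<kappa> * x i - (\<Sum>c\<in>{..<p} - {i}. e c / sqrt lam * x c) else sqrt lam * x a)"
proof (cases "a = i")
  case True
  then show ?thesis
    using assms by (subst sum_lessThan_split[of i]) (auto simp: arrow_def sum_negf intro!: sum.cong)
next
  case False
  have "(\<Sum>c<p. arrow i lam \<kappa> e a c * x c) = (\<Sum>c<p. if a = c then sqrt lam * x c else 0)"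
    using False by (intro sum.cong) (auto simp: arrow_def)
  then show ?thesis using False assms by simp
qed

lemma sum_arrow_column:
  assumes "i < p" "c < p"
  shows "(\<Sum>a<p. x a * arrow i lam \<kappa> e a c) = (if c = i then sqrt \<kappa> * x i else sqrt lam * x c - x i * e c / sqrt lam)"
proof (cases "c = i")
  case True
  then have "(\<Sum>a<p. x a * arrow i lam \<kappa> e a c) = (\<Sum>a<p. if a = i then sqrt \<kappa> * x i else 0)"
    by (intro sum.cong) (auto simp: arrow_def)
  then show ?thesis using True assms by simp
next
  case False
  have "(\<Sum>a<p. x a * arrow i lam \<kappa> e a c) = (\<Sum>a<p. (if a = c then sqrt lam * x c else 0) + (if a = i then - (x i * e c / sqrt lam) else 0))"
    using False by (intro sum.cong) (auto simp: arrow_def)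
  then show ?thesis using False assms by (simp add: sum.distrib)
qed

lemma lin_map_arrow:
  assumes "i < p" "a < p"
  shows "lin_map p (arrow i lam \<kappa> e) z a = (if a = i then sqrt \<kappa> * z i - (\<Sum>c\<in>{..<p} - {i}. e c / sqrt lam * z c) else sqrt lam * z a)"
  using sum_arrow_row[OF assms] assms(2) by (simp add: lin_map_def)

lemma sqrt_div_self: "0 < l \<Longrightarrow> sqrt l / l = 1 / sqrt l"
  by (simp add: real_div_sqrt field_simps)

lemma dotp_arrow:
  assumes "i < p" "0 < lam"
  shows "dotp p (lin_map p (arrow i lam \<kappa> e) z) (arrow_coef p i lam b0 e) = b0 * sqrt \<kappa> * z i"
proof -
  have "dotp p (lin_map p (arrow i lam \<kappa> e) z) (arrow_coef p i lam b0 e)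
    = (sqrt \<kappa> * z i - (\<Sum>c\<in>{..<p} - {i}. e c / sqrt lam * z c)) * b0 + (\<Sum>c\<in>{..<p} - {i}. sqrt lam * z c * (e c * b0 / lam))"
    unfolding dotp_def using assms
    by (subst sum_lessThan_split[of i]) (auto simp: lin_map_arrow arrow_coef_def intro!: sum.cong)
  also have "(\<Sum>c\<in>{..<p} - {i}. sqrt lam * z c * (e c * b0 / lam)) = (\<Sum>c\<in>{..<p} - {i}. e c / sqrt lam * z c) * b0"
    unfolding sum_distrib_right
  proof (rule sum.cong[OF refl])
    fix c
    have "sqrt lam * z c * (e c * b0 / lam) = (sqrt lam / lam) * (z c * e c * b0)" by simp
    then show "sqrt lam * z c * (e c * b0 / lam) = e c / sqrt lam * z c * b0"
      unfolding sqrt_div_self[OF assms(2)] by simp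
  qed
  finally show ?thesis by (simp add: algebra_simps)
qed

lemma sample_arrow:
  assumes "i < p" "0 < lam"
  shows "sample p R (arrow i lam \<kappa> e) (arrow_coef p i lam b0 e) Ok z
    = (restrict (lin_map p (arrow i lam \<kappa> e) z) Ok, b0 * sqrt \<kappa> * z i + R * z p)"
  by (simp add: sample_def dotp_arrow[OF assms])

text \<open>
Changing the coupling of \<open>X\<^sub>i\<close> with \<open>X\<^sub>j\<close> amounts to a shift of the \<open>i\<close>-th Gaussian coordinate by a
multiple of \<open>z\<^sub>j\<close>.
\<close>

lemma lin_map_arrow_shear:
  assumes ij: "i < p" "j < p" "j \<noteq> i" and lam: "0 < lam" "0 < \<kappa>"
    and w: "w i = - 1 / sqrt (lam * \<kappa>)" "\<And>a. a < p \<Longrightarrow> a \<noteq> i \<Longrightarrow> w a = 0"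
  shows "lin_map p (arrow i lam \<kappa> (e(j := t))) z = lin_map p (arrow i lam \<kappa> (e(j := 0))) (shear {..p} j (\<lambda>a. t * w a) z)"
proof
  fix a
  show "lin_map p (arrow i lam \<kappa> (e(j := t))) z a = lin_map p (arrow i lam \<kappa> (e(j := 0))) (shear {..p} j (\<lambda>a. t * w a) z) a"
  proof (cases "a < p")
    case False then show ?thesis by (simp add: lin_map_def)
  next
    case a: True
    show ?thesis
    proof (cases "a = i")
      case False
      then show ?thesis using a ij w by (simp add: lin_map_arrow shear_def)
    next
      case True
      have j: "j \<in> {..<p} - {i}" using ij by auto
      have 1: "(\<Sum>c\<in>{..<p} - {i}. (e(j := t)) c / sqrt lam * z c) = t / sqrt lam * z j + (\<Sum>c\<in>{..<p} - {i} - {j}. e c / sqrt lam * z c)"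
        by (subst sum.remove[OF _ j]) (auto intro!: sum.cong)
      have 2: "(\<Sum>c\<in>{..<p} - {i}. (e(j := 0)) c / sqrt lam * shear {..p} j (\<lambda>a. t * w a) z c) = (\<Sum>c\<in>{..<p} - {i} - {j}. e c / sqrt lam * z c)"
        by (subst sum.remove[OF _ j]) (auto simp: shear_def w intro!: sum.cong)
      have "sqrt \<kappa> * w i = - (1 / sqrt lam)" using lam unfolding w(1) by (simp add: real_sqrt_mult)
      moreover have "sqrt \<kappa> * (z i + z j * (t * w i)) = sqrt \<kappa> * z i + (sqrt \<kappa> * w i) * (z j * t)"
        by (simp only: distrib_left mult_ac)
      ultimately have "sqrt \<kappa> * (z i + z j * (t * w i)) = sqrt \<kappa> * z i - t / sqrt lam * z j"
        by simp
      then show ?thesis using a True ij 1 2 by (simp add: lin_map_arrow shear_def)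
    qed
  qed
qed

lemma fac_quad_arrow:
  assumes i: "i < p" and lam: "0 < lam" "0 \<le> \<kappa>" and \<kappa>: "\<kappa> = lam - (\<Sum>c\<in>{..<p} - {i}. (e c)\<^sup>2) / lam"
  shows "fac_quad p (arrow i lam \<kappa> e) \<theta> = lam * (\<Sum>a<p. (\<theta> a)\<^sup>2) - 2 * \<theta> i * (\<Sum>c\<in>{..<p} - {i}. e c * \<theta> c)"
proof -
  let ?J = "{..<p} - {i}"
  have "fac_quad p (arrow i lam \<kappa> e) \<theta> = \<kappa> * (\<theta> i)\<^sup>2 + (\<Sum>c\<in>?J. (sqrt lam * \<theta> c - \<theta> i * e c / sqrt lam)\<^sup>2)"
    unfolding fac_quad_def using i lam(2)
    by (subst sum_lessThan_split[OF i]) (auto simp: sum_arrow_column power_mult_distrib intro!: sum.cong)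
  also have "(\<Sum>c\<in>?J. (sqrt lam * \<theta> c - \<theta> i * e c / sqrt lam)\<^sup>2)
     = (\<Sum>c\<in>?J. lam * (\<theta> c)\<^sup>2 - 2 * \<theta> i * (e c * \<theta> c) + (\<theta> i)\<^sup>2 / lam * (e c)\<^sup>2)"
    using lam(1) by (intro sum.cong refl) (simp add: power2_diff power_mult_distrib power_divide)
  also have "\<dots> = lam * (\<Sum>c\<in>?J. (\<theta> c)\<^sup>2) - 2 * \<theta> i * (\<Sum>c\<in>?J. e c * \<theta> c) + (\<theta> i)\<^sup>2 / lam * (\<Sum>c\<in>?J. (e c)\<^sup>2)"
    by (simp add: sum.distrib sum_subtractf sum_distrib_left)
  finally have "fac_quad p (arrow i lam \<kappa> e) \<theta> = (\<kappa> + (\<Sum>c\<in>?J. (e c)\<^sup>2) / lam) * (\<theta> i)\<^sup>2 + lam * (\<Sum>c\<in>?J. (\<theta> c)\<^sup>2)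
      - 2 * \<theta> i * (\<Sum>c\<in>?J. e c * \<theta> c)"
    by (simp add: algebra_simps)
  moreover have "\<kappa> + (\<Sum>c\<in>?J. (e c)\<^sup>2) / lam = lam" using \<kappa> by simp
  ultimately show ?thesis
    unfolding sum_lessThan_split[OF i, of "\<lambda>a. (\<theta> a)\<^sup>2"] by (simp add: distrib_left)
qed

lemma arrow_cross_bound:
  fixes e \<theta> :: "nat \<Rightarrow> real"
  assumes i: "i < p"
  defines "r \<equiv> sqrt (\<Sum>c\<in>{..<p} - {i}. (e c)\<^sup>2)"
  shows "\<bar>2 * \<theta> i * (\<Sum>c\<in>{..<p} - {i}. e c * \<theta> c)\<bar> \<le> r * (\<Sum>a<p. (\<theta> a)\<^sup>2)"
proof -
  let ?J = "{..<p} - {i}"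
  define T where "T = L2_set \<theta> ?J"
  have r: "r = L2_set e ?J" by (simp add: r_def L2_set_def)
  have "\<bar>\<Sum>c\<in>?J. e c * \<theta> c\<bar> \<le> (\<Sum>c\<in>?J. \<bar>e c\<bar> * \<bar>\<theta> c\<bar>)"
    by (simp add: abs_mult[symmetric] sum_abs)
  also have "\<dots> \<le> r * T" unfolding r T_def by (rule L2_set_mult_ineq)
  finally have "\<bar>2 * \<theta> i * (\<Sum>c\<in>?J. e c * \<theta> c)\<bar> \<le> 2 * \<bar>\<theta> i\<bar> * (r * T)"
    by (simp add: abs_mult mult_left_mono)
  also have "\<dots> = r * (2 * \<bar>\<theta> i\<bar> * T)" by simp
  also have "\<dots> \<le> r * (\<bar>\<theta> i\<bar>\<^sup>2 + T\<^sup>2)"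
    using sum_squares_bound[of "\<bar>\<theta> i\<bar>" T] by (intro mult_left_mono) (auto simp: r)
  also have "\<bar>\<theta> i\<bar>\<^sup>2 + T\<^sup>2 = (\<Sum>a<p. (\<theta> a)\<^sup>2)"
    unfolding sum_lessThan_split[OF i, of "\<lambda>a. (\<theta> a)\<^sup>2"] T_def L2_set_square by simp
  finally show ?thesis .
qed

lemma arrow_eigenvector:
  fixes e :: "nat \<Rightarrow> real"
  assumes i: "i < p" and lam: "0 < lam" "0 \<le> \<kappa>" and \<kappa>: "\<kappa> = lam - (\<Sum>c\<in>{..<p} - {i}. (e c)\<^sup>2) / lam" and a: "a < p"
  defines "r \<equiv> sqrt (\<Sum>c\<in>{..<p} - {i}. (e c)\<^sup>2)"
  defines "v \<equiv> \<lambda>c. if c = i then r else - e c"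
  shows "(\<Sum>j<p. (\<Sum>c<p. arrow i lam \<kappa> e a c * arrow i lam \<kappa> e j c) * v j) = (lam + r) * v a"
proof -
  let ?J = "{..<p} - {i}"
  let ?A = "arrow i lam \<kappa> e"
  have r2: "r * r = (\<Sum>c\<in>?J. (e c)\<^sup>2)" unfolding r_def by (simp add: sum_nonneg)
  have "(\<Sum>j<p. (\<Sum>c<p. ?A a c * ?A j c) * v j) = (\<Sum>j<p. \<Sum>c<p. ?A a c * (v j * ?A j c))"
    by (simp add: sum_distrib_right sum_distrib_left mult_ac)
  also have "\<dots> = (\<Sum>c<p. \<Sum>j<p. ?A a c * (v j * ?A j c))" by (rule sum.swap)
  also have "\<dots> = (\<Sum>c<p. ?A a c * (\<Sum>j<p. v j * ?A j c))" by (simp add: sum_distrib_left)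
  also have "\<dots> = (\<Sum>c<p. ?A a c * (if c = i then sqrt \<kappa> * r else - (sqrt lam + r / sqrt lam) * e c))"
  proof (intro sum.cong refl arg_cong[where f = "\<lambda>y. _ * y"])
    fix c assume "c \<in> {..<p}"
    then have "(\<Sum>j<p. v j * ?A j c) = (if c = i then sqrt \<kappa> * v i else sqrt lam * v c - v i * e c / sqrt lam)"
      by (intro sum_arrow_column[OF i]) simp
    then show "(\<Sum>j<p. v j * ?A j c) = (if c = i then sqrt \<kappa> * r else - (sqrt lam + r / sqrt lam) * e c)"
      by (simp add: v_def algebra_simps)
  qed
  also have "\<dots> = (lam + r) * v a"
  proof (cases "a = i")
    case True
    have "(\<Sum>c\<in>?J. e c / sqrt lam * (if c = i then sqrt \<kappa> * r else - (sqrt lam + r / sqrt lam) * e c))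
       = (\<Sum>c\<in>?J. - (1 + r / lam) * (e c)\<^sup>2)"
    proof (rule sum.cong[OF refl])
      fix c assume "c \<in> ?J"
      have "e c / sqrt lam * (- (sqrt lam + r / sqrt lam) * e c) = - (sqrt lam / sqrt lam + r / (sqrt lam * sqrt lam)) * (e c)\<^sup>2"
        by (simp add: power2_eq_square add_divide_distrib algebra_simps)
      also have "\<dots> = - (1 + r / lam) * (e c)\<^sup>2" using lam(1) by simp
      finally show "e c / sqrt lam * (if c = i then sqrt \<kappa> * r else - (sqrt lam + r / sqrt lam) * e c) = - (1 + r / lam) * (e c)\<^sup>2"
        using \<open>c \<in> ?J\<close> by simp
    qed
    also have "\<dots> = - (1 + r / lam) * (r * r)" unfolding r2 by (rule sum_distrib_left[symmetric])
    finally have "(\<Sum>c<p. ?A a c * (if c = i then sqrt \<kappa> * r else - (sqrt lam + r / sqrt lam) * e c)) = \<kappa> * r + (1 + r / lam) * (r * r)"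
      unfolding sum_arrow_row[OF i a] using True lam by (simp add: algebra_simps)
    also have "\<dots> = (lam + r) * r"
      unfolding \<kappa> r2[symmetric] using lam(1) by (simp add: field_simps)
    finally show ?thesis using True by (simp add: v_def)
  next
    case False
    have "sqrt lam * (- (sqrt lam + r / sqrt lam) * e a) = (sqrt lam * (sqrt lam + r / sqrt lam)) * (- e a)"
      by (simp only: mult_minus_left mult_minus_right mult.assoc)
    also have "sqrt lam * (sqrt lam + r / sqrt lam) = lam + r" using lam(1) by (simp add: distrib_left)
    finally show ?thesis unfolding sum_arrow_row[OF i a] using False by (simp only: v_def if_False)
  qed
  finally show ?thesis .
qed

text \<open>
The hypothesis \<open>info\<close> bounds the total cost of the shears: every sample that contains both \<open>X\<^sub>i\<close>
and \<open>X\<^sub>j\<close> pays \<open>1 / (lam \<kappa>)\<close> for the shift of the \<open>i\<close>-th coordinate, and a labelled one pays in addition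
\<open>b0\<^sup>2 / (lam R\<^sup>2)\<close> for the shift of the noise.
\<close>

lemma cross_lower_bound_core:
  fixes n :: "nat \<Rightarrow> nat" and N :: nat and lm lp b0 :: real and d :: "nat \<Rightarrow> real"
  assumes i: "i < p" and p2: "2 \<le> p" and Obs: "\<And>k. k < K \<Longrightarrow> Obs k \<subseteq> {..<p}"
    and R: "0 < R" and lm: "0 < lm" "lm \<le> lp"
    and cst: "0 < chi" "chi \<le> 1" "1 \<le> C" "0 < CX" "sqrt (8 * lp / 3) \<le> CX" "105 powr (1 / 4) \<le> ke"
    and d: "\<And>j. j \<in> {..<p} - {i} \<Longrightarrow> 0 < d j" and b0: "0 < b0"
  defines "lam \<equiv> (lm + lp) / 2" and "D \<equiv> \<Sum>j\<in>{..<p} - {i}. (d j)\<^sup>2"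
  defines "\<kappa> \<equiv> lam - D / lam"
  defines "m \<equiv> \<lambda>j. \<Sum>k<K. if i \<in> Obs k \<and> j \<in> Obs k then n k else 0"
  assumes \<kappa>: "0 < \<kappa>" and D: "sqrt D \<le> (lp - lm) / 2" and b0B: "b0\<^sup>2 * (1 + D / lam\<^sup>2) \<le> B\<^sup>2" and B: "0 < B"
    and info: "\<And>j. j \<in> {..<p} - {i} \<Longrightarrow>
        (d j)\<^sup>2 * (real (N + m j) / (lam * \<kappa>) + real (m j) * b0\<^sup>2 / (lam * R\<^sup>2)) \<le> 1"
    and bhat: "bhat \<in> estimators p K Obs n N (P_OSS p R B lm lp chi C ke CX)"
  shows "ennreal (1 / 16 * (\<Sum>j\<in>{..<p} - {i}. (d j * b0 / lam)\<^sup>2))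
    \<le> (SUP P\<in>P_OSS_Gauss p R B lm lp chi C ke CX. risk p K Obs n N bhat P)"
proof -
  let ?J = "{..<p} - {i}"
  have lam: "0 < lam" using lm by (simp add: lam_def)
  define e where "e v j = sign_in v j * d j" for v j
  define A where "A s = arrow i lam \<kappa> s" for s
  define b where "b s = arrow_coef p i lam b0 s" for s
  define P where "P v = gauss_mech p R (A (e v)) (b (e v))" for v
  have e2: "(\<Sum>j\<in>?J. (e v j)\<^sup>2) = D" for v by (simp add: e_def D_def power_mult_distrib)
  have ke: "\<kappa> = lam - (\<Sum>c\<in>?J. (e v c)\<^sup>2) / lam" for v unfolding e2 \<kappa>_def ..
  show ?thesis
  proof (rule minimax_risk_ge[where P = P, OF _ _ _ _ _ _ _ bhat])
    show "?J \<subseteq> {..<p}" by auto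
    show "0 < d j * b0 / lam" if "j \<in> ?J" for j using d[OF that] b0 lam by simp
    show "coef (P v) j = sign_in v j * (d j * b0 / lam)" if "j \<in> ?J" for v j
      using that by (simp add: P_def b_def arrow_coef_def e_def)
    show "coef (P v) a = coef (P {}) a" if "a < p" "a \<notin> ?J" for v a
      using that by (simp add: P_def b_def arrow_coef_def)
    show "prob_space (data_law p K Obs n N (P v))" for v
      unfolding P_def by (rule prob_space_data_law_gauss_mech[OF Obs])
    show "P v \<in> P_OSS_Gauss p R B lm lp chi C ke CX" for v
    proof -
      have q: "\<bar>fac_quad p (A (e v)) \<theta> - lam * (\<Sum>a<p. (\<theta> a)\<^sup>2)\<bar> \<le> (lp - lm) / 2 * (\<Sum>a<p. (\<theta> a)\<^sup>2)" for \<theta>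
      proof -
        have "\<bar>fac_quad p (A (e v)) \<theta> - lam * (\<Sum>a<p. (\<theta> a)\<^sup>2)\<bar> \<le> sqrt D * (\<Sum>a<p. (\<theta> a)\<^sup>2)"
          using arrow_cross_bound[OF i, of \<theta> "e v"] \<kappa> unfolding A_def e2
          by (subst fac_quad_arrow[OF i lam _ ke]) auto
        also have "\<dots> \<le> (lp - lm) / 2 * (\<Sum>a<p. (\<theta> a)\<^sup>2)" by (intro mult_right_mono D sum_nonneg) auto
        finally show ?thesis .
      qed
      have lo: "lm * (\<Sum>a<p. (\<theta> a)\<^sup>2) \<le> fac_quad p (A (e v)) \<theta>" for \<theta>
        using q[of \<theta>] unfolding lam_def by (simp add: abs_le_iff field_simps)
      have hi: "fac_quad p (A (e v)) \<theta> \<le> lp * (\<Sum>a<p. (\<theta> a)\<^sup>2)" for \<theta>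
        using q[of \<theta>] unfolding lam_def by (simp add: abs_le_iff field_simps)
      obtain j where j: "j \<in> ?J"
      proof -
        have "(if i = 0 then 1 else 0) \<in> ?J" using p2 by auto
        then show thesis by (rule that)
      qed
      have "0 < D" unfolding D_def using j d[OF j] by (intro sum_pos2[where i = j]) auto
      then have ev1: "\<exists>a<p. (if a = i then sqrt (\<Sum>c\<in>?J. (e v c)\<^sup>2) else - e v a) \<noteq> 0"
        using i unfolding e2 by (intro exI[of _ i]) auto
      have bs: "b (e v) \<in> space (rvec {..<p})" by (simp add: b_def arrow_coef_def space_PiM)
      have bn: "L2_set (b (e v)) {..<p} \<le> B"
      proof -
        have "(L2_set (b (e v)) {..<p})\<^sup>2 = b0\<^sup>2 + (\<Sum>a\<in>?J. (e v a)\<^sup>2 * (b0\<^sup>2 / lam\<^sup>2))"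
          unfolding L2_set_square using i
          by (subst sum_lessThan_split[OF i]) (auto simp: b_def arrow_coef_def power_mult_distrib power_divide intro!: sum.cong)
        also have "\<dots> = b0\<^sup>2 * (1 + D / lam\<^sup>2)"
          unfolding sum_distrib_right[symmetric] e2 by (simp add: algebra_simps)
        finally have "(L2_set (b (e v)) {..<p})\<^sup>2 \<le> B\<^sup>2" using b0B by simp
        from power2_le_imp_le[OF this] B show ?thesis by simp
      qed
      have k0: "0 \<le> \<kappa>" using \<kappa> by simp
      have "gauss_mech p R (A (e v)) (b (e v)) \<in> P_OSS_Gauss p R B lm lp chi C ke CX"
        by (rule gauss_mech_in_class[OF R lm(1) lo hi ev1 _ bs bn cst], unfold A_def)
           (rule arrow_eigenvector[OF i lam k0 ke])
      then show ?thesis unfolding P_def .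
    qed
    show "hellinger_close (1 / 2) (data_law p K Obs n N (P v)) (data_law p K Obs n N (P (insert j v)))"
      if j: "j \<in> ?J" and v: "v \<subseteq> ?J - {j}" for v j
    proof -
      have ij: "i < p" "j < p" "j \<noteq> i" using i j by auto
      define u where "u = e v"
      have ev: "e v = u(j := - d j)" using v by (auto simp: u_def e_def sign_in_def fun_eq_iff)
      have ei: "e (insert j v) = u(j := d j)" by (auto simp: u_def e_def sign_in_def fun_eq_iff)
      define w where "w a = (if a = i then - 1 / sqrt (lam * \<kappa>) else if a = p then b0 / (sqrt lam * R) else 0)" for a
      define w' where "w' a = (if a = i then - 1 / sqrt (lam * \<kappa>) else 0)" for a :: nat
      have i_in: "i \<in> {..p}" and j_in: "j \<in> {..p}" using ij by auto
      have sumw: "(\<Sum>a\<le>p. (d j * w a)\<^sup>2) = (d j)\<^sup>2 * (1 / (lam * \<kappa>) + b0\<^sup>2 / (lam * R\<^sup>2))"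
      proof -
        have "(\<Sum>a\<le>p. (d j * w a)\<^sup>2) = (\<Sum>a\<le>p. (if a = i then (d j)\<^sup>2 * (1 / (lam * \<kappa>)) else 0) + (if a = p then (d j)\<^sup>2 * (b0\<^sup>2 / (lam * R\<^sup>2)) else 0))"
          using ij lam \<kappa> R by (intro sum.cong) (auto simp: w_def power_mult_distrib power_divide)
        then show ?thesis using ij by (simp add: sum.distrib algebra_simps)
      qed
      have sumw': "(\<Sum>a\<le>p. (d j * w' a)\<^sup>2) = (d j)\<^sup>2 * (1 / (lam * \<kappa>))"
      proof -
        have "(\<Sum>a\<le>p. (d j * w' a)\<^sup>2) = (\<Sum>a\<le>p. if a = i then (d j)\<^sup>2 * (1 / (lam * \<kappa>)) else 0)"
          using lam \<kappa> by (intro sum.cong) (auto simp: w'_def power_mult_distrib power_divide)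
        then show ?thesis using ij by simp
      qed
      have linw: "lin_map p (A (u(j := t))) z = lin_map p (A (u(j := 0))) (shear {..p} j (\<lambda>a. t * w a) z)" for t z
        unfolding A_def by (rule lin_map_arrow_shear[OF ij lam \<kappa>]) (auto simp: w_def)
      have linw': "lin_map p (A (u(j := t))) z = lin_map p (A (u(j := 0))) (shear {..p} j (\<lambda>a. t * w' a) z)" for t z
        unfolding A_def by (rule lin_map_arrow_shear[OF ij lam \<kappa>]) (auto simp: w'_def)
      define \<eta> where "\<eta> k = (if i \<in> Obs k \<and> j \<in> Obs k then (\<Sum>a\<le>p. (d j * w a)\<^sup>2) / 2 else 0)" for k
      have lab: "hellinger_close (\<eta> k) (labelled_law p (Obs k) (P v)) (labelled_law p (Obs k) (P (insert j v)))" if k: "k < K" for k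
      proof -
        have Ok: "Obs k \<subseteq> {..<p}" by (rule Obs[OF k])
        have oeq: "sample p R (A s) (b s) (Obs k) z = (restrict (lin_map p (A s) z) (Obs k), b0 * sqrt \<kappa> * z i + R * z p)" for s z
          unfolding A_def b_def by (rule sample_arrow[OF i lam])
        consider "i \<in> Obs k" "j \<in> Obs k" | "i \<in> Obs k" "j \<notin> Obs k" | "i \<notin> Obs k" by blast
        then show ?thesis
        proof cases
          case 1
          \<comment> \<open>the shift of the noise coordinate cancels the effect of the shift of coordinate i on the response\<close>
          have sh: "sample p R (A (u(j := t))) (b (u(j := t))) (Obs k) z
              = sample p R (A (u(j := 0))) (b (u(j := 0))) (Obs k) (shear {..p} j (\<lambda>a. t * w a) z)" for t z
          proof -
            have "b0 * sqrt \<kappa> * w i + R * w p = 0"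
              using ij R lam \<kappa> by (simp add: w_def real_sqrt_mult)
            moreover have "b0 * sqrt \<kappa> * (z i + z j * (t * w i)) + R * (z p + z j * (t * w p))
                = b0 * sqrt \<kappa> * z i + R * z p + z j * t * (b0 * sqrt \<kappa> * w i + R * w p)"
              by (simp add: algebra_simps)
            ultimately have "b0 * sqrt \<kappa> * (z i + z j * (t * w i)) + R * (z p + z j * (t * w p)) = b0 * sqrt \<kappa> * z i + R * z p"
              by simp
            then show ?thesis unfolding oeq linw[of t] using ij by (simp add: shear_def)
          qed
          have "hellinger_close ((\<Sum>a\<le>p. (d j * w a)\<^sup>2) / 2) (labelled_law p (Obs k) (P v)) (labelled_law p (Obs k) (P (insert j v)))"
            unfolding P_def ev ei
          proof (rule hellinger_close_labelled_law_shear[OF Ok ij(2)])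
            show "d j * w j = 0" using ij by (simp add: w_def)
            show "sample p R (A (u(j := - d j))) (b (u(j := - d j))) (Obs k) z
              = sample p R (A (u(j := 0))) (b (u(j := 0))) (Obs k) (shear {..p} j (\<lambda>a. - (d j * w a)) z)" for z
              using sh[of "- d j" z] by simp
            show "sample p R (A (u(j := d j))) (b (u(j := d j))) (Obs k) z
              = sample p R (A (u(j := 0))) (b (u(j := 0))) (Obs k) (shear {..p} j (\<lambda>a. d j * w a) z)" for z
              by (rule sh)
          qed
          then show ?thesis unfolding \<eta>_def using 1 by simp
        next
          case 2
          \<comment> \<open>without X_j the two laws differ by the sign of the j-th Gaussian coordinate\<close>
          have "sample p R (A (u(j := d j))) (b (u(j := d j))) (Obs k) z
              = sample p R (A (u(j := - d j))) (b (u(j := - d j))) (Obs k) (z(j := - z j))" for z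
          proof -
            have "lin_map p (A (u(j := d j))) z a = lin_map p (A (u(j := - d j))) (z(j := - z j)) a" if "a \<in> Obs k" for a
            proof -
              have a: "a < p" "a \<noteq> j" using that 2 Ok by auto
              have "(\<Sum>c\<in>?J. (u(j := d j)) c / sqrt lam * z c) = (\<Sum>c\<in>?J. (u(j := - d j)) c / sqrt lam * (z(j := - z j)) c)"
                by (intro sum.cong) auto
              then show ?thesis unfolding A_def using a ij by (simp add: lin_map_arrow)
            qed
            then show ?thesis
              unfolding oeq using ij by (auto simp: fun_eq_iff restrict_def)
          qed
          then have "hellinger_close 0 (labelled_law p (Obs k) (P v)) (labelled_law p (Obs k) (P (insert j v)))"
            unfolding P_def ev ei by (intro hellinger_close_labelled_law_eq[OF Ok ij(2)]) blast
          then show ?thesis unfolding \<eta>_def using 2 by simp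
        next
          case 3
          \<comment> \<open>without X_i the observation does not involve the couplings at all\<close>
          have "sample p R (A s) (b s) (Obs k) z = sample p R (A s') (b s') (Obs k) z" for s s' z
          proof -
            have "lin_map p (A s) z a = lin_map p (A s') z a" if "a \<in> Obs k" for a
            proof -
              have "a < p" "a \<noteq> i" using that Ok 3 by auto
              then show ?thesis unfolding A_def using i by (simp add: lin_map_arrow)
            qed
            then show ?thesis unfolding oeq by (auto simp: fun_eq_iff restrict_def)
          qed
          then have "hellinger_close 0 (labelled_law p (Obs k) (P v)) (labelled_law p (Obs k) (P (insert j v)))"
            unfolding P_def ev ei by (intro hellinger_close_labelled_law_eq[OF Ok ij(2)]) blast
          then show ?thesis unfolding \<eta>_def using 3 by simp
        qed
      qed
      define \<eta>' where "\<eta>' = (\<Sum>a\<le>p. (d j * w' a)\<^sup>2) / 2"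
      have unlab: "hellinger_close \<eta>' (distr (law (P v)) (rvec {..<p}) fst) (distr (law (P (insert j v))) (rvec {..<p}) fst)"
        unfolding P_def unlabelled_law_gauss_mech ev ei \<eta>'_def
      proof (rule hellinger_close_distr_shear[OF j_in])
        show "lin_map p (A (u(j := 0))) \<in> measurable (gauss {..p}) (rvec {..<p})" by (rule measurable_lin_map) auto
        show "d j * w' j = 0" using ij by (simp add: w'_def)
        show "lin_map p (A (u(j := - d j))) z = lin_map p (A (u(j := 0))) (shear {..p} j (\<lambda>a. - (d j * w' a)) z)" for z
          using linw'[of "- d j" z] by simp
        show "lin_map p (A (u(j := d j))) z = lin_map p (A (u(j := 0))) (shear {..p} j (\<lambda>a. d j * w' a) z)" for z
          by (rule linw')
      qed simp
      have nn: "0 \<le> \<eta> k" "0 \<le> \<eta>'" for k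
        unfolding \<eta>_def \<eta>'_def by (auto intro!: sum_nonneg divide_nonneg_pos)
      have "(\<Sum>k<K. real (n k) * \<eta> k) + real N * \<eta>' \<le> 1 / 2"
      proof -
        have "(\<Sum>k<K. real (n k) * \<eta> k) = (\<Sum>k<K. real (if i \<in> Obs k \<and> j \<in> Obs k then n k else 0) * ((\<Sum>a\<le>p. (d j * w a)\<^sup>2) / 2))"
          by (intro sum.cong) (auto simp: \<eta>_def)
        also have "\<dots> = real (m j) * ((\<Sum>a\<le>p. (d j * w a)\<^sup>2) / 2)"
          unfolding sum_distrib_right[symmetric] m_def of_nat_sum ..
        finally have "(\<Sum>k<K. real (n k) * \<eta> k) + real N * \<eta>'
           = 1 / 2 * ((d j)\<^sup>2 * (real (N + m j) / (lam * \<kappa>) + real (m j) * b0\<^sup>2 / (lam * R\<^sup>2)))"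
          unfolding \<eta>'_def sumw sumw' by (simp add: algebra_simps add_divide_distrib)
        also have "\<dots> \<le> 1 / 2 * 1" by (intro mult_left_mono info[OF j]) simp
        finally show ?thesis by simp
      qed
      then show ?thesis
        using hellinger_close_mono[OF hellinger_close_data_law[where \<eta> = \<eta> and \<eta>' = \<eta>', OF lab unlab nn]] by blast
    qed
  qed
qed

lemma part_subset_iff:
  assumes Q: "partition_on U Q" and S: "S \<in> Q" "x \<in> S" and O: "\<exists>T\<subseteq>Q. O' = \<Union>T"
  shows "S \<subseteq> O' \<longleftrightarrow> x \<in> O'"
proof
  assume "x \<in> O'"
  then obtain S' where S': "S' \<in> Q" "x \<in> S'" "S' \<subseteq> O'" using O by blast
  then have "S' = S" using Q S by (metis disjnt_iff pairwiseD partition_onD2 disjoint_def disjnt_def IntI empty_iff)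
  then show "S \<subseteq> O'" using S' by simp
qed (use S in auto)

lemma xi_props:
  assumes Lm: "partition_on {..<p} (Lm ` {..<L})" "inj_on Lm {..<L}" and j: "j < p"
  shows "xi L Lm j < L" "j \<in> Lm (xi L Lm j)"
proof -
  have "j \<in> \<Union>(Lm ` {..<L})" using Lm(1) j by (simp add: partition_on_def)
  then obtain g where g: "g < L" "j \<in> Lm g" by auto
  have "h = g" if "h < L" "j \<in> Lm h" for h
  proof -
    have "Lm h = Lm g"
      using partition_onD2[OF Lm(1)] g that unfolding disjoint_def by blast
    then show ?thesis using Lm(2) g that by (auto simp: inj_on_def)
  qed
  then have "\<exists>!i. i < L \<and> j \<in> Lm i" using g by blast
  from theI'[OF this] show "xi L Lm j < L" "j \<in> Lm (xi L Lm j)" unfolding xi_def by auto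
qed

text \<open>
Patterns are unions of modalities, so a pattern contains the modality of a coordinate as soon as it
contains the coordinate.
\<close>

lemma n_joint_xi:
  assumes Lm: "refines_patterns p K Obs (Lm ` {..<L})" "inj_on Lm {..<L}" and ij: "i < p" "j < p"
  shows "n_joint K Obs n Lm (xi L Lm j) (xi L Lm i) = (\<Sum>k<K. if i \<in> Obs k \<and> j \<in> Obs k then n k else 0)"
  unfolding n_joint_def
proof (intro sum.cong refl if_cong)
  fix k assume k: "k \<in> {..<K}"
  have P: "partition_on {..<p} (Lm ` {..<L})" and O: "\<exists>T\<subseteq>Lm ` {..<L}. Obs k = \<Union>T"
    using Lm k by (auto simp: refines_patterns_def)
  have "Lm (xi L Lm a) \<subseteq> Obs k \<longleftrightarrow> a \<in> Obs k" if "a < p" for a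
    using xi_props[OF P Lm(2) that] by (intro part_subset_iff[OF P _ _ O]) auto
  then show "(Lm (xi L Lm j) \<union> Lm (xi L Lm i) \<subseteq> Obs k) = (i \<in> Obs k \<and> j \<in> Obs k)"
    using ij by auto
qed

text \<open>
If at least one sample is available, the summand is a positive real number \<open>q\<close>. Its
two upper bounds are stated without quotients, so that the case \<open>m = 0\<close>, where \<open>R\<^sup>2 / m\<close> is
infinite, needs no separate treatment later.
\<close>

lemma min_cross_real:
  fixes N m :: nat
  assumes "0 < N + m" "0 < B" "0 < R"
  obtains q :: real where "0 < q" "min (ennreal (B\<^sup>2) / of_nat (N + m)) (ennreal (R\<^sup>2) / of_nat m) = ennreal q"
    "q * real (N + m) \<le> B\<^sup>2" "q * real m \<le> R\<^sup>2"
proof (cases "m = 0")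
  case True
  show ?thesis
  proof (rule that[of "B\<^sup>2 / real (N + m)"])
    show "min (ennreal (B\<^sup>2) / of_nat (N + m)) (ennreal (R\<^sup>2) / of_nat m) = ennreal (B\<^sup>2 / real (N + m))"
      using True assms by (simp add: ennreal_of_nat_eq_real_of_nat divide_ennreal)
  qed (use True assms in auto)
next
  case False
  define q where "q = min (B\<^sup>2 / real (N + m)) (R\<^sup>2 / real m)"
  show ?thesis
  proof (rule that[of q])
    show "0 < q" using False assms by (simp add: q_def)
    have "q * real (N + m) \<le> B\<^sup>2 / real (N + m) * real (N + m)" unfolding q_def by (intro mult_right_mono) auto
    then show "q * real (N + m) \<le> B\<^sup>2" using assms by simp
    have "q * real m \<le> R\<^sup>2 / real m * real m" unfolding q_def by (intro mult_right_mono) auto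
    then show "q * real m \<le> R\<^sup>2" using False by simp
    show "min (ennreal (B\<^sup>2) / of_nat (N + m)) (ennreal (R\<^sup>2) / of_nat m) = ennreal q"
    proof -
      have frac: "ennreal x / of_nat k = ennreal (x / real k)" if "0 < k" "0 \<le> x" for x and k :: nat
        using that by (simp add: ennreal_of_nat_eq_real_of_nat divide_ennreal)
      have "ennreal (B\<^sup>2) / of_nat (N + m) = ennreal (B\<^sup>2 / real (N + m))" by (rule frac) (use assms in auto)
      moreover have "ennreal (R\<^sup>2) / of_nat m = ennreal (R\<^sup>2 / real m)" by (rule frac) (use False in auto)
      ultimately show ?thesis unfolding q_def min_def by simp
    qed
  qed
qed

text \<open>
The choices \<open>d\<^sub>j\<^sup>2 = (min 1 lp\<^sup>2) q\<^sub>j / (16 B\<^sup>2)\<close> and \<open>b0\<^sup>2 = B\<^sup>2 / 2\<close> satisfy all constraints of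
\<open>cross_lower_bound_core\<close>.
With \<open>lam = (lm + lp) / 2\<close> one has \<open>lp \<le> 2 lam\<close>, and the hypothesis on \<open>cross_sum\<close> gives
\<open>D \<le> (lp - lm)\<^sup>2 / 8 \<le> lam\<^sup>2 / 2\<close>, hence \<open>\<kappa> \<ge> lam / 2\<close>.
\<close>

lemma cross_lower_bound:
  assumes i: "i < p" and p2: "2 \<le> p" and Obs: "\<And>k. k < K \<Longrightarrow> Obs k \<subseteq> {..<p}"
    and Lm: "refines_patterns p K Obs (Lm ` {..<L})" "inj_on Lm {..<L}"
    and R: "0 < R" and B: "0 < B" and lm: "0 < lm" "lm < lp"
    and cst: "0 < chi" "chi \<le> 1" "1 \<le> C" "0 < CX" "sqrt (8 * lp / 3) \<le> CX" "105 powr (1 / 4) \<le> ke"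
    and cross: "ennreal (min 1 (lp\<^sup>2)) * cross_sum p K Obs n N L Lm R B i \<le> ennreal (2 * B\<^sup>2 * (lp - lm)\<^sup>2)"
    and bhat: "bhat \<in> estimators p K Obs n N (P_OSS p R B lm lp chi C ke CX)"
  shows "ennreal (1 / 512) * (ennreal (min (1 / lp\<^sup>2) 1) * cross_sum p K Obs n N L Lm R B i)
    \<le> (SUP P\<in>P_OSS_Gauss p R B lm lp chi C ke CX. risk p K Obs n N bhat P)"
proof -
  let ?J = "{..<p} - {i}"
  define m where "m j = (\<Sum>k<K. if i \<in> Obs k \<and> j \<in> Obs k then n k else 0)" for j
  define T where "T j = min (ennreal (B\<^sup>2) / of_nat (N + m j)) (ennreal (R\<^sup>2) / of_nat (m j))" for j
  have lp: "0 < lp" using lm by simp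
  define mu where "mu = min 1 (lp\<^sup>2)"
  have mu: "0 < mu" "mu \<le> 1" "mu \<le> lp\<^sup>2" "mu \<le> lp"
  proof -
    show "0 < mu" "mu \<le> 1" "mu \<le> lp\<^sup>2" using lp by (auto simp: mu_def)
    show "mu \<le> lp"
    proof (cases "lp \<le> 1")
      case True
      then have "lp * lp \<le> 1 * lp" using lp by (intro mult_right_mono) auto
      then show ?thesis by (simp add: mu_def power2_eq_square min_def)
    next
      case False then show ?thesis by (simp add: mu_def)
    qed
  qed
  have cs: "cross_sum p K Obs n N L Lm R B i = (\<Sum>j\<in>?J. T j)"
    unfolding cross_sum_def T_def m_def
    by (intro sum.cong refl) (simp add: n_joint_xi[OF Lm i] Let_def)
  \<comment> \<open>otherwise the sum would be infinite, against the hypothesis\<close>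
  have pos: "0 < N + m j" if j: "j \<in> ?J" for j
  proof (rule ccontr)
    assume "\<not> 0 < N + m j"
    then have "T j = \<infinity>" using B R by (simp add: T_def ennreal_divide_zero)
    moreover have "T j \<le> cross_sum p K Obs n N L Lm R B i"
      unfolding cs using j by (intro member_le_sum) auto
    ultimately have "cross_sum p K Obs n N L Lm R B i = \<infinity>" by (simp add: top_unique)
    then show False using cross mu(1) unfolding mu_def[symmetric] by (simp add: ennreal_mult_top top_unique)
  qed
  have "\<exists>q. 0 < q \<and> T j = ennreal q \<and> q * real (N + m j) \<le> B\<^sup>2 \<and> q * real (m j) \<le> R\<^sup>2" if "j \<in> ?J" for j
    using min_cross_real[OF pos[OF that] B R] unfolding T_def by metis
  then obtain q where q: "\<And>j. j \<in> ?J \<Longrightarrow> 0 < q j" "\<And>j. j \<in> ?J \<Longrightarrow> T j = ennreal (q j)"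
     "\<And>j. j \<in> ?J \<Longrightarrow> q j * real (N + m j) \<le> B\<^sup>2" "\<And>j. j \<in> ?J \<Longrightarrow> q j * real (m j) \<le> R\<^sup>2"
    by metis
  define s where "s = (\<Sum>j\<in>?J. q j)"
  have s0: "0 \<le> s" unfolding s_def using q(1) by (intro sum_nonneg) (simp add: less_imp_le)
  have cs2: "cross_sum p K Obs n N L Lm R B i = ennreal s"
  proof -
    have "(\<Sum>j\<in>?J. T j) = (\<Sum>j\<in>?J. ennreal (q j))" by (intro sum.cong refl q(2))
    also have "\<dots> = ennreal s" unfolding s_def by (rule sum_ennreal) (use q(1) less_imp_le in blast)
    finally show ?thesis unfolding cs .
  qed
  have cross2: "mu * s \<le> 2 * B\<^sup>2 * (lp - lm)\<^sup>2"
    using cross mu s0 unfolding cs2 mu_def[symmetric] by (simp add: ennreal_mult[symmetric])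
  define lam where "lam = (lm + lp) / 2"
  have lam: "0 < lam" "lp \<le> 2 * lam" "lam \<le> lp" "lp - lm \<le> 2 * lam" using lm by (auto simp: lam_def)
  define d where "d j = sqrt (mu * q j / (16 * B\<^sup>2))" for j
  have d2: "(d j)\<^sup>2 = mu * q j / (16 * B\<^sup>2)" if "j \<in> ?J" for j
    using q(1)[OF that] mu by (simp add: d_def)
  have dpos: "0 < d j" if "j \<in> ?J" for j
    using q(1)[OF that] mu B by (simp add: d_def)
  define b0 where "b0 = B / sqrt 2"
  have b0: "0 < b0" "b0\<^sup>2 = B\<^sup>2 / 2" using B by (auto simp: b0_def power_divide)
  define D where "D = (\<Sum>j\<in>?J. (d j)\<^sup>2)"
  have D: "D = mu * s / (16 * B\<^sup>2)" unfolding D_def s_def using d2 by (simp add: sum_distrib_left sum_divide_distrib)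
  have D0: "0 \<le> D" unfolding D_def by (intro sum_nonneg) auto
  have D1: "D \<le> (lp - lm)\<^sup>2 / 8"
    unfolding D using cross2 B by (simp add: field_simps)
  have "(lp - lm)\<^sup>2 \<le> (2 * lam)\<^sup>2" using lam lm by (intro power_mono) auto
  then have D2: "D \<le> lam\<^sup>2 / 2" using D1 by (simp add: power_mult_distrib)
  have "sqrt D \<le> sqrt (((lp - lm) / 2)\<^sup>2)"
    using D1 D0 by (intro real_sqrt_le_mono) (simp add: power_divide)
  then have D3: "sqrt D \<le> (lp - lm) / 2" using lm by simp
  define kap where "kap = lam - D / lam"
  have kap: "lam / 2 \<le> kap"
  proof -
    have "D / lam \<le> lam / 2" using D2 lam by (simp add: field_simps power2_eq_square)
    then show ?thesis by (simp add: kap_def)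
  qed
  have kap0: "0 < kap" using kap lam by linarith
  have bB: "b0\<^sup>2 * (1 + D / lam\<^sup>2) \<le> B\<^sup>2"
  proof -
    have "D / lam\<^sup>2 \<le> 1" using D2 D0 lam by (simp add: field_simps)
    then have "b0\<^sup>2 * (1 + D / lam\<^sup>2) \<le> b0\<^sup>2 * 2" by (intro mult_left_mono) auto
    also have "\<dots> = B\<^sup>2" unfolding b0(2) by simp
    finally show ?thesis .
  qed
  have info: "(d j)\<^sup>2 * (real (N + m j) / (lam * kap) + real (m j) * b0\<^sup>2 / (lam * R\<^sup>2)) \<le> 1" if j: "j \<in> ?J" for j
  proof -
    have "(d j)\<^sup>2 * (real (N + m j) / (lam * kap)) \<le> 1 / 2"
    proof -
      have 1: "(d j)\<^sup>2 * real (N + m j) \<le> mu / 16"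
      proof -
        have "(d j)\<^sup>2 * real (N + m j) = mu / (16 * B\<^sup>2) * (q j * real (N + m j))" using d2[OF j] by simp
        also have "\<dots> \<le> mu / (16 * B\<^sup>2) * B\<^sup>2" using mu by (intro mult_left_mono q(3)[OF j]) auto
        also have "\<dots> = mu / 16" using B by simp
        finally show ?thesis .
      qed
      have 2: "mu \<le> 8 * (lam * kap)"
      proof -
        have "mu \<le> lp\<^sup>2" by (rule mu)
        also have "\<dots> \<le> (2 * lam)\<^sup>2" using lam lp by (intro power_mono) auto
        also have "\<dots> = 8 * (lam * (lam / 2))" by (simp add: power2_eq_square)
        also have "\<dots> \<le> 8 * (lam * kap)" using kap lam by (intro mult_left_mono) auto
        finally show ?thesis .
      qed
      have "(d j)\<^sup>2 * real (N + m j) \<le> 1 / 2 * (lam * kap)" using 1 2 by linarith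
      then show ?thesis using lam kap0 by (simp add: field_simps)
    qed
    moreover have "(d j)\<^sup>2 * (real (m j) * b0\<^sup>2 / (lam * R\<^sup>2)) \<le> 1 / 2"
    proof -
      have "(d j)\<^sup>2 * (real (m j) * b0\<^sup>2 / (lam * R\<^sup>2)) = mu / (32 * (lam * R\<^sup>2)) * (q j * real (m j))"
        unfolding d2[OF j] b0(2) using B by (simp add: field_simps)
      also have "\<dots> \<le> mu / (32 * (lam * R\<^sup>2)) * R\<^sup>2"
        using mu lam R by (intro mult_left_mono q(4)[OF j]) auto
      also have "\<dots> = mu / (32 * lam)" using R by simp
      also have "\<dots> \<le> 1 / 2" using mu lam by (simp add: field_simps)
      finally show ?thesis .
    qed
    ultimately show ?thesis unfolding distrib_left by linarith
  qed
  have main: "ennreal (1 / 16 * (\<Sum>j\<in>?J. (d j * b0 / lam)\<^sup>2)) \<le> (SUP P\<in>P_OSS_Gauss p R B lm lp chi C ke CX. risk p K Obs n N bhat P)"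
    unfolding lam_def
  proof (rule cross_lower_bound_core[where B = B and bhat = bhat and d = d, OF i p2 _ R lm(1) less_imp_le[OF lm(2)] cst _ b0(1)])
    note fold_defs = m_def[symmetric] lam_def[symmetric] D_def[symmetric] kap_def[symmetric]
    show "Obs k \<subseteq> {..<p}" if "k < K" for k by (rule Obs[OF that])
    show "0 < d j" if "j \<in> ?J" for j by (rule dpos[OF that])
    show "0 < (lm + lp) / 2 - (\<Sum>j\<in>?J. (d j)\<^sup>2) / ((lm + lp) / 2)" unfolding fold_defs by (rule kap0)
    show "sqrt (\<Sum>j\<in>?J. (d j)\<^sup>2) \<le> (lp - lm) / 2" unfolding fold_defs by (rule D3)
    show "b0\<^sup>2 * (1 + (\<Sum>j\<in>?J. (d j)\<^sup>2) / ((lm + lp) / 2)\<^sup>2) \<le> B\<^sup>2" unfolding fold_defs by (rule bB)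
    show "0 < B" by (rule B)
    show "(d j)\<^sup>2 * (real (N + (\<Sum>k<K. if i \<in> Obs k \<and> j \<in> Obs k then n k else 0)) / ((lm + lp) / 2 * ((lm + lp) / 2 - (\<Sum>j\<in>?J. (d j)\<^sup>2) / ((lm + lp) / 2)))
        + real (\<Sum>k<K. if i \<in> Obs k \<and> j \<in> Obs k then n k else 0) * b0\<^sup>2 / ((lm + lp) / 2 * R\<^sup>2)) \<le> 1" if "j \<in> ?J" for j
      unfolding fold_defs by (rule info[OF that])
    show "bhat \<in> estimators p K Obs n N (P_OSS p R B lm lp chi C ke CX)" by (rule bhat)
  qed
  have "(1 / 512) * (min (1 / lp\<^sup>2) 1 * s) \<le> 1 / 16 * (\<Sum>j\<in>?J. (d j * b0 / lam)\<^sup>2)"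
  proof -
    have e: "min (1 / lp\<^sup>2) 1 = mu / lp\<^sup>2" using lp by (auto simp: mu_def min_def field_simps)
    have "(\<Sum>j\<in>?J. (d j * b0 / lam)\<^sup>2) = D * b0\<^sup>2 / lam\<^sup>2"
      unfolding D_def by (simp add: power_mult_distrib power_divide sum_distrib_right sum_divide_distrib)
    also have "\<dots> = mu * s / (32 * lam\<^sup>2)" unfolding D b0(2) using B by simp
    finally have "1 / 16 * (\<Sum>j\<in>?J. (d j * b0 / lam)\<^sup>2) = mu * s / (512 * lam\<^sup>2)" by simp
    moreover have "mu * s / (512 * lp\<^sup>2) \<le> mu * s / (512 * lam\<^sup>2)"
      using lam lp mu s0 by (intro divide_left_mono mult_left_mono power_mono mult_pos_pos mult_nonneg_nonneg) auto
    ultimately show ?thesis unfolding e by simp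
  qed
  then have "ennreal (1 / 512 * (min (1 / lp\<^sup>2) 1 * s)) \<le> ennreal (1 / 16 * (\<Sum>j\<in>?J. (d j * b0 / lam)\<^sup>2))"
    by (rule ennreal_leI)
  moreover have "ennreal (1 / 512) * (ennreal (min (1 / lp\<^sup>2) 1) * cross_sum p K Obs n N L Lm R B i) = ennreal (1 / 512 * (min (1 / lp\<^sup>2) 1 * s))"
    unfolding cs2 using s0 lp by (simp only: ennreal_mult'[symmetric] ennreal_mult''[symmetric])
  ultimately show ?thesis using main by simp
qed

section \<open>The price of noise and missing covariates\<close>

definition scalar :: "real \<Rightarrow> nat \<Rightarrow> nat \<Rightarrow> real" where
  "scalar g a c = (if a = c then g else 0)"

lemma lin_map_scalar: "lin_map p (scalar g) z = (\<lambda>a\<in>{..<p}. g * z a)"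
  by (auto simp: lin_map_def scalar_def fun_eq_iff if_distrib[of "\<lambda>x. x * _"] cong: if_cong)

lemma fac_quad_scalar: "fac_quad p (scalar g) \<theta> = g\<^sup>2 * (\<Sum>a<p. (\<theta> a)\<^sup>2)"
proof -
  have "(\<Sum>a<p. \<theta> a * scalar g a c) = g * \<theta> c" if "c < p" for c
    using that by (simp add: scalar_def if_distrib[of "\<lambda>x. _ * x"] cong: if_cong)
  then show ?thesis by (simp add: fac_quad_def power_mult_distrib sum_distrib_left)
qed

lemma sample_scalar:
  "sample p R (scalar g) b Ok z = (restrict (\<lambda>a\<in>{..<p}. g * z a) Ok, (\<Sum>a<p. g * z a * b a) + R * z p)"
  by (simp add: sample_def lin_map_scalar dotp_def)

text \<open>
With \<open>X = g z\<close>, a change of \<open>\<beta>\<^sub>j\<close> by \<open>t\<close> changes the response by \<open>g t z\<^sub>j\<close>. This change can be produced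
by shifting the unobserved coordinates \<open>z\<^sub>a\<close> (\<open>a \<in> M\<close>) and the noise instead; \<open>t w\<close> is the
cheapest such shift per unit of \<open>z\<^sub>j\<close>, spread in proportion to the coefficients \<open>g b\<^sub>a\<close> and \<open>R\<close>.
\<close>

lemma sample_scalar_shear:
  fixes g :: real and b :: "nat \<Rightarrow> real"
  assumes Ok: "Ok \<subseteq> {..<p}" and j: "j \<in> Ok" and R: "0 < R"
  defines "M \<equiv> {..<p} - Ok"
  defines "s2 \<equiv> R\<^sup>2 + g\<^sup>2 * (\<Sum>a\<in>M. (b a)\<^sup>2)"
  defines "w \<equiv> \<lambda>a. if a \<in> M then g\<^sup>2 * b a / s2 else if a = p then g * R / s2 else 0"
  shows "sample p R (scalar g) (b(j := t)) Ok z = sample p R (scalar g) (b(j := 0)) Ok (shear {..p} j (\<lambda>a. t * w a) z)"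
    and "(\<Sum>a\<le>p. (w a)\<^sup>2) = g\<^sup>2 / s2" and "w j = 0"
proof -
  have s2: "0 < s2" unfolding s2_def using R by (intro add_pos_nonneg mult_nonneg_nonneg sum_nonneg) auto
  have jp: "j < p" and jM: "j \<notin> M" using Ok j by (auto simp: M_def)
  show "w j = 0" using jM jp by (simp add: w_def)
  have M: "M \<subseteq> {..<p}" "finite M" by (auto simp: M_def)
  have wM: "w a = g\<^sup>2 * b a / s2" if "a \<in> M" for a using that by (simp add: w_def)
  have w0: "w a = 0" if "a < p" "a \<notin> M" for a using that by (simp add: w_def)
  have wp: "w p = g * R / s2" using M by (auto simp: w_def)
  define T where "T = (\<Sum>a\<in>M. (b a)\<^sup>2)"
  show "(\<Sum>a\<le>p. (w a)\<^sup>2) = g\<^sup>2 / s2"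
  proof -
    have "(\<Sum>a\<le>p. (w a)\<^sup>2) = (\<Sum>a<p. (w a)\<^sup>2) + (w p)\<^sup>2" by (simp add: lessThan_Suc_atMost[symmetric])
    also have "(\<Sum>a<p. (w a)\<^sup>2) = (\<Sum>a\<in>M. (w a)\<^sup>2)"
      using M w0 by (intro sum.mono_neutral_right) auto
    also have "\<dots> = (g\<^sup>2 / s2)\<^sup>2 * T"
      unfolding T_def sum_distrib_left by (intro sum.cong) (auto simp: wM power_mult_distrib power_divide)
    also have "(g\<^sup>2 / s2)\<^sup>2 * T + (w p)\<^sup>2 = g\<^sup>2 * (R\<^sup>2 + g\<^sup>2 * T) / s2\<^sup>2"
      unfolding wp by (simp add: power2_eq_square add_divide_distrib distrib_left mult_ac)
    also have "\<dots> = g\<^sup>2 / s2" using s2 unfolding s2_def[folded T_def, symmetric] by (simp add: power2_eq_square)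
    finally show ?thesis .
  qed
  have cost: "(\<Sum>a<p. g * w a * (b(j := 0)) a) + R * w p = g"
  proof -
    have "(\<Sum>a<p. g * w a * (b(j := 0)) a) = (\<Sum>a\<in>M. g * w a * (b(j := 0)) a)"
      using M w0 by (intro sum.mono_neutral_right) auto
    also have "\<dots> = (\<Sum>a\<in>M. (g * g\<^sup>2 / s2) * (b a)\<^sup>2)"
      using jM by (intro sum.cong) (auto simp: wM power2_eq_square)
    also have "\<dots> = (g * g\<^sup>2 / s2) * T" unfolding T_def by (rule sum_distrib_left[symmetric])
    finally have "(\<Sum>a<p. g * w a * (b(j := 0)) a) + R * w p = g * (R\<^sup>2 + g\<^sup>2 * T) / s2"
      unfolding wp by (simp add: power2_eq_square add_divide_distrib distrib_left mult_ac)
    also have "\<dots> = g" using s2 unfolding s2_def[folded T_def, symmetric] by simp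
    finally show ?thesis .
  qed
  have X: "g * z a = g * (z a + z j * (t * w a))" if "a \<in> Ok" for a
  proof -
    have "a < p" "a \<notin> M" using that Ok by (auto simp: M_def)
    then show ?thesis by (simp add: w0)
  qed
  have jin: "j \<in> {..<p}" using jp by simp
  have "(\<Sum>a<p. g * z a * (b(j := t)) a) = g * z j * t + (\<Sum>a<p. g * z a * (b(j := 0)) a)"
    unfolding sum.remove[OF finite_lessThan jin] by (auto intro!: sum.cong)
  moreover have "(\<Sum>a<p. g * (z a + z j * (t * w a)) * (b(j := 0)) a) + R * (z p + z j * (t * w p))
     = (\<Sum>a<p. g * z a * (b(j := 0)) a) + R * z p + z j * t * ((\<Sum>a<p. g * w a * (b(j := 0)) a) + R * w p)"
    by (simp add: distrib_left distrib_right sum.distrib sum_distrib_left mult_ac del: fun_upd_apply)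
  ultimately have Y: "(\<Sum>a<p. g * z a * (b(j := t)) a) + R * z p
     = (\<Sum>a<p. g * (z a + z j * (t * w a)) * (b(j := 0)) a) + R * (z p + z j * (t * w p))"
    unfolding cost by simp
  show "sample p R (scalar g) (b(j := t)) Ok z = sample p R (scalar g) (b(j := 0)) Ok (shear {..p} j (\<lambda>a. t * w a) z)"
    unfolding sample_scalar
  proof (rule arg_cong2[where f = Pair])
    show "restrict (\<lambda>a\<in>{..<p}. g * z a) Ok = restrict (\<lambda>a\<in>{..<p}. g * shear {..p} j (\<lambda>a. t * w a) z a) Ok"
      using Ok X by (auto simp: fun_eq_iff restrict_def shear_def)
    have "(\<Sum>a<p. g * shear {..p} j (\<lambda>a. t * w a) z a * (b(j := 0)) a) = (\<Sum>a<p. g * (z a + z j * (t * w a)) * (b(j := 0)) a)"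
      by (intro sum.cong refl) (simp add: shear_def)
    then show "(\<Sum>a<p. g * z a * (b(j := t)) a) + R * z p
      = (\<Sum>a<p. g * shear {..p} j (\<lambda>a. t * w a) z a * (b(j := 0)) a) + R * shear {..p} j (\<lambda>a. t * w a) z p"
      unfolding Y by (simp add: shear_def)
  qed
qed

lemma D_fac_nonneg: "0 < R \<Longrightarrow> 0 \<le> D_fac p Obs R k z"
  unfolding D_fac_def by (intro divide_nonneg_nonneg add_nonneg_nonneg) auto

lemma alpha_nonneg: "0 < R \<Longrightarrow> 0 \<le> alpha p K Obs n R i z"
  unfolding alpha_def by (intro sum_nonneg mult_nonneg_nonneg D_fac_nonneg) auto

text \<open>
The constants: \<open>d\<^sub>j\<^sup>2 = R\<^sup>2 / (3 mx \<alpha>\<^sub>j)\<close> keeps the total cost of the shears at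
\<open>1/2\<close>, and with the weight \<open>1/3\<close> on \<open>\<parallel>z\<parallel>\<^sup>2\<close> the two parts of \<open>\<parallel>\<beta>\<parallel>\<^sup>2\<close> are at most
\<open>B\<^sup>2/3\<close> and \<open>2 B\<^sup>2/3\<close>. The value \<open>1/96\<close> is \<open>1/16 * 1/3 * 1/2\<close>.
\<close>

lemma labelled_lower_bound:
  fixes n :: "nat \<Rightarrow> nat"
  assumes p: "1 \<le> p" and Obs: "\<And>k. k < K \<Longrightarrow> Obs k \<subseteq> {..<p}"
    and Q: "refines_patterns p K Obs Q" and two: "\<And>S. S \<in> Q \<Longrightarrow> 2 \<le> card S"
    and R: "0 < R" and B: "0 < B" and lm: "0 < lm" "lm \<le> lp"
    and cst: "0 < chi" "chi \<le> 1" "1 \<le> C" "0 < CX" "sqrt (8 * lp / 3) \<le> CX" "105 powr (1 / 4) \<le> ke"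
    and z: "z \<in> rcball p B"
    and al: "\<And>i. i < p \<Longrightarrow> (1 / 2) * max (1 / lm) lm * max (R\<^sup>2 / B\<^sup>2) (B\<^sup>2 / R\<^sup>2) * real p \<le> alpha p K Obs n R i z"
    and bhat: "bhat \<in> estimators p K Obs n N (P_OSS p R B lm lp chi C ke CX)"
  shows "ennreal (1 / 96) * (ennreal (R\<^sup>2 / max 1 lm) * (\<Sum>i<p. 1 / ennreal (alpha p K Obs n R i z)))
    \<le> (SUP P\<in>P_OSS_Gauss p R B lm lp chi C ke CX. risk p K Obs n N bhat P)"
proof -
  define f where "f i = 1 / alpha p K Obs n R i z" for i
  define mx where "mx = max 1 lm"
  have mx: "1 \<le> mx" "lm \<le> mx" by (auto simp: mx_def)
  have part: "partition_on {..<p} Q" and un: "\<And>k. k < K \<Longrightarrow> \<exists>T\<subseteq>Q. Obs k = \<Union>T"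
    using Q by (auto simp: refines_patterns_def)
  have UQ: "\<Union>Q = {..<p}" using part by (simp add: partition_on_def)
  have disj: "S = S'" if "S \<in> Q" "S' \<in> Q" "x \<in> S" "x \<in> S'" for S S' x
    using partition_onD2[OF part] that unfolding disjoint_def by blast
  have S: "finite S" "S \<noteq> {}" "S \<subseteq> {..<p}" if "S \<in> Q" for S
    using that UQ two[OF that] finite_subset[of S "{..<p}"] by auto
  have finQ: "finite Q" using UQ finite_UnionD by (metis finite_lessThan)
  have sumQ: "(\<Sum>a\<in>\<Union>Q'. F a) = (\<Sum>S\<in>Q'. \<Sum>a\<in>S. F a)" if "Q' \<subseteq> Q" for Q' and F :: "nat \<Rightarrow> real"
  proof -
    have "S \<inter> S' = {}" if "S \<in> Q'" "S' \<in> Q'" "S \<noteq> S'" for S S'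
      using that \<open>Q' \<subseteq> Q\<close> disj by blast
    moreover have "finite S" if "S \<in> Q'" for S using that \<open>Q' \<subseteq> Q\<close> S(1) by blast
    ultimately show ?thesis by (subst sum.Union_disjoint) auto
  qed
  have MinS: "Min S \<in> S" and MaxS: "Max S \<in> S" and Mm: "Max S \<noteq> Min S" if "S \<in> Q" for S
  proof -
    show "Min S \<in> S" "Max S \<in> S" using S[OF that] by auto
    show "Max S \<noteq> Min S"
    proof
      assume "Max S = Min S"
      then have "S \<subseteq> {Min S}" using S[OF that] by (metis Max_ge Min_le antisym singletonI subsetI)
      then have "card S \<le> 1" using card_mono[of "{Min S}" S] by simp
      then show False using two[OF that] by simp
    qed
  qed
  \<comment> \<open>the minimum of each part is its representative, the maximum is a second element\<close>
  define J where "J = {..<p} - Min ` Q"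
  have J: "J \<subseteq> {..<p}" "finite J" by (auto simp: J_def)
  have inJ: "a \<in> J" if "S \<in> Q" "a \<in> S" "a \<noteq> Min S" for S a
  proof -
    have "a \<notin> Min ` Q" using that MinS disj by blast
    then show ?thesis using that(2) S(3)[OF that(1)] by (auto simp: J_def)
  qed
  have part_ob: "\<exists>S\<in>Q. a \<in> S" if "a < p" for a using UQ that by auto
  define pt where "pt a = (THE S. S \<in> Q \<and> a \<in> S)" for a
  have pt: "pt a = S" if "S \<in> Q" "a \<in> S" for a S
    unfolding pt_def using that disj by (intro the_equality) auto
  have same: "a \<in> Obs k \<longleftrightarrow> a' \<in> Obs k" if "k < K" "S \<in> Q" "a \<in> S" "a' \<in> S" for k S a a'
    using part_subset_iff[OF part that(2) that(3) un[OF that(1)]] part_subset_iff[OF part that(2) that(4) un[OF that(1)]] by simp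
  have alpha_same: "alpha p K Obs n R a z = alpha p K Obs n R a' z" if "S \<in> Q" "a \<in> S" "a' \<in> S" for S a a'
    unfolding alpha_def using same[OF _ that] by (intro sum.cong) auto
  have ap: "R\<^sup>2 / B\<^sup>2 * real p / 2 \<le> alpha p K Obs n R i z" "0 < alpha p K Obs n R i z" if i: "i < p" for i
  proof -
    have m1: "1 \<le> max (1 / lm) lm"
    proof (cases "lm \<le> 1")
      case True then have "1 \<le> 1 / lm" using lm by simp
      then show ?thesis by linarith
    next
      case False then show ?thesis by simp
    qed
    have rp: "0 < R\<^sup>2 / B\<^sup>2" using R B by simp
    have "(1 / 2) * 1 * (R\<^sup>2 / B\<^sup>2) * real p \<le> (1 / 2) * max (1 / lm) lm * max (R\<^sup>2 / B\<^sup>2) (B\<^sup>2 / R\<^sup>2) * real p"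
      using m1 rp by (intro mult_right_mono mult_mono) auto
    also have "\<dots> \<le> alpha p K Obs n R i z" by (rule al[OF i])
    finally have le: "R\<^sup>2 / B\<^sup>2 * real p / 2 \<le> alpha p K Obs n R i z" by simp
    then show "R\<^sup>2 / B\<^sup>2 * real p / 2 \<le> alpha p K Obs n R i z" .
    have "0 < R\<^sup>2 / B\<^sup>2 * real p / 2" using R B p by simp
    then show "0 < alpha p K Obs n R i z" using le by linarith
  qed
  have f0: "0 < f i" if "i < p" for i using ap(2)[OF that] by (simp add: f_def)
  define d where "d j = sqrt (R\<^sup>2 / (3 * mx) * f j)" for j
  have d2: "(d j)\<^sup>2 = R\<^sup>2 / (3 * mx) * f j" if "j < p" for j
    using f0[OF that] mx by (simp add: d_def)
  have dpos: "0 < d j" if "j < p" for j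
    using f0[OF that] mx R by (simp add: d_def)
  have dle: "(d j)\<^sup>2 \<le> 2 * B\<^sup>2 / (3 * real p)" if j: "j < p" for j
  proof -
    have pp: "0 < R\<^sup>2 / B\<^sup>2 * real p / 2" using R B p by simp
    note ap(1)[OF j]
    then have "f j \<le> 1 / (R\<^sup>2 / B\<^sup>2 * real p / 2)" unfolding f_def using pp ap(2)[OF j] by (intro divide_left_mono mult_pos_pos zero_le_one)
    then have "(d j)\<^sup>2 \<le> R\<^sup>2 / (3 * mx) * (1 / (R\<^sup>2 / B\<^sup>2 * real p / 2))"
      unfolding d2[OF j] using mx by (intro mult_left_mono) auto
    also have "\<dots> \<le> R\<^sup>2 / 3 * (1 / (R\<^sup>2 / B\<^sup>2 * real p / 2))"
      using mx pp by (intro mult_right_mono divide_left_mono) auto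
    also have "\<dots> = 2 * B\<^sup>2 / (3 * real p)" using R B p by (simp add: field_simps)
    finally show ?thesis .
  qed
  \<comment> \<open>the representative carries the norm of z on its part; the factor leaves room for the other coordinates\<close>
  define rw where "rw a = sqrt (1 / 3) * L2_set z (pt a)" for a
  define b where "b v = (\<lambda>a\<in>{..<p}. if a \<in> J then sign_in v a * d a else rw a)" for v
  define g where "g = sqrt lm"
  have g: "0 < g" "g\<^sup>2 = lm" using lm by (auto simp: g_def)
  define P where "P v = gauss_mech p R (scalar g) (b v)" for v
  have bpart: "(\<Sum>a\<in>S. (b v a)\<^sup>2) = 1 / 3 * (\<Sum>a\<in>S. (z a)\<^sup>2) + (\<Sum>a\<in>S - {Min S}. (d a)\<^sup>2)" if SQ: "S \<in> Q" for v S
  proof -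
    have mnJ: "Min S \<notin> J" using SQ by (simp add: J_def)
    have mnp: "Min S < p" using subsetD[OF S(3)[OF SQ] MinS[OF SQ]] by simp
    have "(\<Sum>a\<in>S. (b v a)\<^sup>2) = (b v (Min S))\<^sup>2 + (\<Sum>a\<in>S - {Min S}. (b v a)\<^sup>2)"
      using S[OF SQ] MinS[OF SQ] by (intro sum.remove) auto
    also have "(b v (Min S))\<^sup>2 = 1 / 3 * (\<Sum>a\<in>S. (z a)\<^sup>2)"
      using mnJ mnp pt[OF SQ MinS[OF SQ]] by (simp add: b_def rw_def power_mult_distrib L2_set_square real_sqrt_divide power_divide)
    also have "(\<Sum>a\<in>S - {Min S}. (b v a)\<^sup>2) = (\<Sum>a\<in>S - {Min S}. (d a)\<^sup>2)"
      using inJ[OF SQ] S(3)[OF SQ] by (intro sum.cong) (auto simp: b_def power_mult_distrib)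
    finally show ?thesis .
  qed
  have bnorm: "L2_set (b v) {..<p} \<le> B" for v
  proof -
    have "(\<Sum>a<p. (b v a)\<^sup>2) = (\<Sum>S\<in>Q. \<Sum>a\<in>S. (b v a)\<^sup>2)" using sumQ[OF subset_refl] UQ by simp
    also have "\<dots> = (\<Sum>S\<in>Q. 1 / 3 * (\<Sum>a\<in>S. (z a)\<^sup>2) + (\<Sum>a\<in>S - {Min S}. (d a)\<^sup>2))"
      by (intro sum.cong refl bpart)
    also have "\<dots> \<le> (\<Sum>S\<in>Q. 1 / 3 * (\<Sum>a\<in>S. (z a)\<^sup>2) + (\<Sum>a\<in>S. (d a)\<^sup>2))"
      using S by (intro sum_mono add_left_mono sum_mono2) auto
    also have "\<dots> = 1 / 3 * (\<Sum>a<p. (z a)\<^sup>2) + (\<Sum>a<p. (d a)\<^sup>2)"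
      unfolding sumQ[OF subset_refl, of "\<lambda>a. (z a)\<^sup>2", unfolded UQ] sumQ[OF subset_refl, of "\<lambda>a. (d a)\<^sup>2", unfolded UQ]
        sum.distrib sum_distrib_left ..
    also have "\<dots> \<le> 1 / 3 * B\<^sup>2 + (\<Sum>a<p. 2 * B\<^sup>2 / (3 * real p))"
    proof (intro add_mono mult_left_mono sum_mono dle)
      have "L2_set z {..<p} \<le> B" using z by (simp add: rcball_def)
      then have "(L2_set z {..<p})\<^sup>2 \<le> B\<^sup>2" by (intro power_mono) auto
      then show "(\<Sum>a<p. (z a)\<^sup>2) \<le> B\<^sup>2" by (simp add: L2_set_square)
    qed auto
    also have "\<dots> = B\<^sup>2" using p by (simp add: field_simps)
    finally have "(L2_set (b v) {..<p})\<^sup>2 \<le> B\<^sup>2" by (simp add: L2_set_square)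
    from power2_le_imp_le[OF this] B show ?thesis by simp
  qed
  have bmiss: "1 / 3 * (\<Sum>a\<in>{..<p} - Obs k. (z a)\<^sup>2) \<le> (\<Sum>a\<in>{..<p} - Obs k. (b v a)\<^sup>2)" if k: "k < K" for k v
  proof -
    define Q' where "Q' = {S\<in>Q. S \<inter> Obs k = {}}"
    have Q': "Q' \<subseteq> Q" by (auto simp: Q'_def)
    have U: "{..<p} - Obs k = \<Union>Q'"
    proof (intro equalityI subsetI)
      fix a assume a: "a \<in> {..<p} - Obs k"
      then have "a < p" by simp
      from part_ob[OF this] obtain S where SQ: "S \<in> Q" "a \<in> S" by blast
      have "x \<notin> Obs k" if "x \<in> S" for x using same[OF k SQ that] a by simp
      then have "S \<in> Q'" using SQ(1) unfolding Q'_def by blast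
      then show "a \<in> \<Union>Q'" using SQ(2) by blast
    next
      fix a assume "a \<in> \<Union>Q'"
      then obtain S where SQ: "S \<in> Q" "S \<inter> Obs k = {}" "a \<in> S" unfolding Q'_def by blast
      then show "a \<in> {..<p} - Obs k" using subsetD[OF S(3)[OF SQ(1)] SQ(3)] by blast
    qed
    have "1 / 3 * (\<Sum>a\<in>\<Union>Q'. (z a)\<^sup>2) = (\<Sum>S\<in>Q'. 1 / 3 * (\<Sum>a\<in>S. (z a)\<^sup>2))"
      unfolding sumQ[OF Q'] by (rule sum_distrib_left)
    also have "\<dots> \<le> (\<Sum>S\<in>Q'. \<Sum>a\<in>S. (b v a)\<^sup>2)"
    proof (rule sum_mono)
      fix S assume "S \<in> Q'"
      then have "S \<in> Q" using Q' by blast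
      then have "(\<Sum>a\<in>S. (b v a)\<^sup>2) = 1 / 3 * (\<Sum>a\<in>S. (z a)\<^sup>2) + (\<Sum>a\<in>S - {Min S}. (d a)\<^sup>2)" by (rule bpart)
      moreover have "0 \<le> (\<Sum>a\<in>S - {Min S}. (d a)\<^sup>2)" by (intro sum_nonneg) simp
      ultimately show "1 / 3 * (\<Sum>a\<in>S. (z a)\<^sup>2) \<le> (\<Sum>a\<in>S. (b v a)\<^sup>2)" by linarith
    qed
    also have "\<dots> = (\<Sum>a\<in>\<Union>Q'. (b v a)\<^sup>2)" by (rule sumQ[OF Q', symmetric])
    finally show ?thesis unfolding U .
  qed
  have main: "ennreal (1 / 16 * (\<Sum>j\<in>J. (d j)\<^sup>2)) \<le> (SUP P\<in>P_OSS_Gauss p R B lm lp chi C ke CX. risk p K Obs n N bhat P)"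
  proof (rule minimax_risk_ge[where P = P, OF J(1) _ _ _ _ _ _ bhat])
    show "0 < d j" if "j \<in> J" for j using that J dpos by auto
    show "coef (P v) j = sign_in v j * d j" if "j \<in> J" for v j using that J by (auto simp: P_def b_def)
    show "coef (P v) a = coef (P {}) a" if "a < p" "a \<notin> J" for v a using that by (simp add: P_def b_def)
    show "prob_space (data_law p K Obs n N (P v))" for v
      unfolding P_def by (rule prob_space_data_law_gauss_mech[OF Obs])
    show "P v \<in> P_OSS_Gauss p R B lm lp chi C ke CX" for v
      unfolding P_def
    proof (rule gauss_mech_in_class[OF R lm(1) _ _ _ _ _ bnorm cst])
      show "lm * (\<Sum>a<p. (\<theta> a)\<^sup>2) \<le> fac_quad p (scalar g) \<theta>" for \<theta> by (simp add: fac_quad_scalar g)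
      show "fac_quad p (scalar g) \<theta> \<le> lp * (\<Sum>a<p. (\<theta> a)\<^sup>2)" for \<theta>
        unfolding fac_quad_scalar g by (intro mult_right_mono lm sum_nonneg) auto
      show "\<exists>i<p. (\<lambda>_. 1 :: real) i \<noteq> 0" using p by (intro exI[of _ 0]) auto
      show "b v \<in> space (rvec {..<p})" by (simp add: b_def space_PiM)
      show "(\<Sum>j<p. (\<Sum>c<p. scalar g i c * scalar g j c) * 1) = lm * 1" if "i < p" for i
      proof -
        have "(\<Sum>c<p. scalar g i c * scalar g j c) = (if j = i then g * g else 0)" for j
        proof -
          have "(\<Sum>c<p. scalar g i c * scalar g j c) = (\<Sum>c<p. if i = c then (if j = i then g * g else 0) else 0)"
            by (intro sum.cong) (auto simp: scalar_def)
          then show ?thesis using that by simp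
        qed
        then show ?thesis using that g by (simp add: power2_eq_square)
      qed
    qed
    show "hellinger_close (1 / 2) (data_law p K Obs n N (P v)) (data_law p K Obs n N (P (insert j v)))"
      if j: "j \<in> J" and v: "v \<subseteq> J - {j}" for v j
    proof -
      have jp: "j < p" using j J by auto
      define u where "u = b v"
      have bv: "b v = u(j := - d j)" using v j jp by (auto simp: u_def b_def sign_in_def fun_eq_iff)
      have bi: "b (insert j v) = u(j := d j)" using j jp by (auto simp: u_def b_def sign_in_def fun_eq_iff)
      define s2 where "s2 k = R\<^sup>2 + g\<^sup>2 * (\<Sum>a\<in>{..<p} - Obs k. (u a)\<^sup>2)" for k
      define \<eta> where "\<eta> k = (if j \<in> Obs k then (d j)\<^sup>2 * (g\<^sup>2 / s2 k) / 2 else 0)" for k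
      have s2: "0 < s2 k" for k
        unfolding s2_def using R by (intro add_pos_nonneg mult_nonneg_nonneg sum_nonneg) auto
      have lab: "hellinger_close (\<eta> k) (labelled_law p (Obs k) (P v)) (labelled_law p (Obs k) (P (insert j v)))" if k: "k < K" for k
      proof -
        have Ok: "Obs k \<subseteq> {..<p}" by (rule Obs[OF k])
        show ?thesis
        proof (cases "j \<in> Obs k")
          case True
          define w where "w a = (if a \<in> {..<p} - Obs k then g\<^sup>2 * u a / s2 k else if a = p then g * R / s2 k else 0)" for a
          note sh = sample_scalar_shear[OF Ok True R, where g = g and b = u, folded s2_def, folded w_def]
          have "hellinger_close ((\<Sum>a\<le>p. (d j * w a)\<^sup>2) / 2) (labelled_law p (Obs k) (P v)) (labelled_law p (Obs k) (P (insert j v)))"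
            unfolding P_def bv bi
          proof (rule hellinger_close_labelled_law_shear[OF Ok jp])
            show "d j * w j = 0" using sh(3) by simp
            show "sample p R (scalar g) (u(j := - d j)) (Obs k) z
              = sample p R (scalar g) (u(j := 0)) (Obs k) (shear {..p} j (\<lambda>a. - (d j * w a)) z)" for z
              using sh(1)[of "- d j" z] by simp
            show "sample p R (scalar g) (u(j := d j)) (Obs k) z
              = sample p R (scalar g) (u(j := 0)) (Obs k) (shear {..p} j (\<lambda>a. d j * w a) z)" for z
              by (rule sh(1))
          qed
          moreover have "(\<Sum>a\<le>p. (d j * w a)\<^sup>2) = (d j)\<^sup>2 * (g\<^sup>2 / s2 k)"
            unfolding sh(2)[symmetric] power_mult_distrib by (rule sum_distrib_left[symmetric])
          ultimately show ?thesis unfolding \<eta>_def using True by simp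
        next
          case False
          have "sample p R (scalar g) (u(j := d j)) (Obs k) z = sample p R (scalar g) (u(j := - d j)) (Obs k) (z(j := - z j))" for z
          proof -
            have "(\<Sum>a<p. g * z a * (u(j := d j)) a) = (\<Sum>a<p. g * (z(j := - z j)) a * (u(j := - d j)) a)"
              by (intro sum.cong) auto
            then show ?thesis unfolding sample_scalar using jp False by (auto simp: fun_eq_iff restrict_def)
          qed
          then have "hellinger_close 0 (labelled_law p (Obs k) (P v)) (labelled_law p (Obs k) (P (insert j v)))"
            unfolding P_def bv bi by (intro hellinger_close_labelled_law_eq[OF Ok jp]) blast
          then show ?thesis unfolding \<eta>_def using False by simp
        qed
      qed
      have unlab: "hellinger_close 0 (distr (law (P v)) (rvec {..<p}) fst) (distr (law (P (insert j v))) (rvec {..<p}) fst)"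
      proof -
        have "prob_space (distr (gauss {..p}) (rvec {..<p}) (lin_map p (scalar g)))"
          by (intro prob_space.prob_space_distr prob_space_gauss measurable_lin_map) auto
        then show ?thesis unfolding P_def unlabelled_law_gauss_mech by (rule hellinger_close_refl)
      qed
      have nn: "0 \<le> \<eta> k" for k
        unfolding \<eta>_def using s2[of k] by (auto intro!: divide_nonneg_pos mult_nonneg_nonneg)
      have eta_le: "\<eta> k \<le> 3 * mx * (d j)\<^sup>2 / (2 * R\<^sup>2) * (D_fac p Obs R k z * (if j \<in> Obs k then 1 else 0))" if k: "k < K" for k
      proof (cases "j \<in> Obs k")
        case True
        define Z where "Z = (\<Sum>a\<in>{..<p} - Obs k. (z a)\<^sup>2)"
        have Z0: "0 \<le> Z" unfolding Z_def by (intro sum_nonneg) auto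
        have R2: "0 < R\<^sup>2" using R by simp
        have "R\<^sup>2 + lm * (1 / 3 * Z) \<le> s2 k"
          unfolding s2_def g Z_def u_def using bmiss[OF k, of v] lm by (intro add_left_mono mult_left_mono) auto
        moreover have "lm * (R\<^sup>2 + Z) \<le> 3 * mx * (R\<^sup>2 + lm * (1 / 3 * Z))"
        proof -
          have "lm * R\<^sup>2 \<le> 3 * mx * R\<^sup>2" using mx lm R2 by (intro mult_right_mono) auto
          moreover have "1 * (lm * Z) \<le> mx * (lm * Z)" using mx lm Z0 by (intro mult_right_mono) auto
          ultimately show ?thesis by (simp add: algebra_simps)
        qed
        moreover have "3 * mx * (R\<^sup>2 + lm * (1 / 3 * Z)) \<le> 3 * mx * s2 k"
          using calculation(1) mx by (intro mult_left_mono) auto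
        ultimately have "lm * (R\<^sup>2 + Z) \<le> 3 * mx * s2 k" by linarith
        then have "g\<^sup>2 / s2 k \<le> 3 * mx / (R\<^sup>2 + Z)"
        proof -
          have rz: "0 < R\<^sup>2 + Z" by (rule add_pos_nonneg[OF R2 Z0])
          show ?thesis
            unfolding g pos_divide_le_eq[OF s2] times_divide_eq_left pos_le_divide_eq[OF rz] by fact
        qed
        then have "(d j)\<^sup>2 * (g\<^sup>2 / s2 k) / 2 \<le> (d j)\<^sup>2 * (3 * mx / (R\<^sup>2 + Z)) / 2"
          by (intro divide_right_mono mult_left_mono) auto
        also have "\<dots> = 3 * mx * (d j)\<^sup>2 / (2 * R\<^sup>2) * D_fac p Obs R k z"
        proof -
          have "x * (y / q) / 2 = y * x / (2 * r) * (r / q)" if "0 < r" for x y q r :: real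
            using that by (cases "q = 0") (auto simp: field_simps)
          from this[OF R2] show ?thesis unfolding D_fac_def L2_set_square Z_def[symmetric] .
        qed
        finally show ?thesis using True by (simp add: \<eta>_def)
      qed (simp add: \<eta>_def)
      have "(\<Sum>k<K. real (n k) * \<eta> k) + real N * 0 \<le> 1 / 2"
      proof -
        have "(\<Sum>k<K. real (n k) * \<eta> k) \<le> (\<Sum>k<K. real (n k) * (3 * mx * (d j)\<^sup>2 / (2 * R\<^sup>2) * (D_fac p Obs R k z * (if j \<in> Obs k then 1 else 0))))"
          using eta_le by (intro sum_mono mult_left_mono) auto
        also have "\<dots> = 3 * mx * (d j)\<^sup>2 / (2 * R\<^sup>2) * alpha p K Obs n R j z"
          unfolding alpha_def sum_distrib_left by (intro sum.cong) (auto simp: mult_ac)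
        also have "\<dots> = 1 / 2"
          unfolding d2[OF jp] f_def using ap(2)[OF jp] R mx by (simp add: field_simps)
        finally show ?thesis by simp
      qed
      then show ?thesis
        using hellinger_close_mono[OF hellinger_close_data_law[where \<eta> = \<eta> and \<eta>' = 0, OF lab unlab nn order_refl]] by blast
    qed
  qed
  \<comment> \<open>each representative is paid for by another member of its part\<close>
  have half: "(\<Sum>i<p. f i) \<le> 2 * (\<Sum>j\<in>J. f j)"
  proof -
    have injm: "inj_on Min Q" "inj_on Max Q"
      unfolding inj_on_def using MinS MaxS disj by metis+
    have "(\<Sum>i\<in>Min ` Q. f i) = (\<Sum>S\<in>Q. f (Min S))" by (simp add: sum.reindex[OF injm(1)])
    also have "\<dots> = (\<Sum>S\<in>Q. f (Max S))"
      unfolding f_def using alpha_same MinS MaxS by (intro sum.cong refl) metis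
    also have "\<dots> = (\<Sum>i\<in>Max ` Q. f i)" by (simp add: sum.reindex[OF injm(2)])
    also have "\<dots> \<le> (\<Sum>j\<in>J. f j)"
    proof (rule sum_mono2[OF J(2)])
      show "Max ` Q \<subseteq> J" using inJ MaxS Mm by blast
      show "0 \<le> f x" if "x \<in> J - Max ` Q" for x using that J f0 by (auto simp: less_imp_le)
    qed
    finally have "(\<Sum>i\<in>Min ` Q. f i) \<le> (\<Sum>j\<in>J. f j)" .
    moreover have "(\<Sum>i<p. f i) = (\<Sum>j\<in>J. f j) + (\<Sum>i\<in>Min ` Q. f i)"
    proof -
      have "Min ` Q \<subseteq> {..<p}" using MinS S(3) by blast
      then show ?thesis unfolding J_def by (intro sum.subset_diff) auto
    qed
    ultimately show ?thesis by simp
  qed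
  have "(1 / 96) * (R\<^sup>2 / mx * (\<Sum>i<p. f i)) \<le> (1 / 96) * (R\<^sup>2 / mx * (2 * (\<Sum>j\<in>J. f j)))"
    using half mx by (intro mult_left_mono) auto
  also have "\<dots> = 1 / 16 * (\<Sum>j\<in>J. R\<^sup>2 / (3 * mx) * f j)" unfolding sum_distrib_left[symmetric] by simp
  also have "(\<Sum>j\<in>J. R\<^sup>2 / (3 * mx) * f j) = (\<Sum>j\<in>J. (d j)\<^sup>2)"
    using J by (intro sum.cong refl) (auto simp: d2)
  finally have "ennreal ((1 / 96) * (R\<^sup>2 / mx * (\<Sum>i<p. f i))) \<le> ennreal (1 / 16 * (\<Sum>j\<in>J. (d j)\<^sup>2))" by (rule ennreal_leI)
  moreover have "ennreal (1 / 96) * (ennreal (R\<^sup>2 / max 1 lm) * (\<Sum>i<p. 1 / ennreal (alpha p K Obs n R i z))) = ennreal ((1 / 96) * (R\<^sup>2 / mx * (\<Sum>i<p. f i)))"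
  proof -
    have "(\<Sum>i<p. 1 / ennreal (alpha p K Obs n R i z)) = (\<Sum>i<p. ennreal (f i))"
    proof (rule sum.cong[OF refl])
      fix i assume "i \<in> {..<p}"
      then show "1 / ennreal (alpha p K Obs n R i z) = ennreal (f i)"
        using divide_ennreal[of 1 "alpha p K Obs n R i z"] ap(2)[of i] by (simp add: f_def)
    qed
    also have "\<dots> = ennreal (\<Sum>i<p. f i)" by (rule sum_ennreal) (use f0 less_imp_le in blast)
    finally have e: "(\<Sum>i<p. 1 / ennreal (alpha p K Obs n R i z)) = ennreal (\<Sum>i<p. f i)" .
    have "0 \<le> R\<^sup>2 / mx" using mx by simp
    then show ?thesis unfolding e mx_def[symmetric] by (simp only: ennreal_mult'[symmetric] ennreal_mult''[symmetric])
  qed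
  ultimately show ?thesis using main by simp
qed

theorem theorem3:
  shows "\<exists>c::real. 0 < c \<and>
    (\<forall>(p::nat) (K::nat) (Obs :: nat \<Rightarrow> nat set) (n :: nat \<Rightarrow> nat) (N::nat)
      (L::nat) (Lm :: nat \<Rightarrow> nat set)
      (R::real) (B::real) (lm::real) (lp::real) (chi::real) (C::real) (\<kappa>::real) (CX::real).
        1 \<le> p \<and> (\<forall>k<K. Obs k \<subseteq> {..<p}) \<and> (\<Union>k<K. Obs k) = {..<p} \<and>
        modalities p K Obs L Lm \<and>
        0 < R \<and> 0 < B \<and> 0 < lm \<and> lm \<le> lp \<and> 0 < chi \<and> chi \<le> 1 \<and> 1 \<le> C \<and> 1 \<le> \<kappa> \<and> 0 < CX \<and>
        sqrt (8 * lp / 3) \<le> CX \<and> 105 powr (1 / 4) \<le> \<kappa> \<and> lm < lp \<and>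
        (\<forall>i<p. (1 / 2) * max (1 / lm) lm * max (R\<^sup>2 / B\<^sup>2) (B\<^sup>2 / R\<^sup>2) * real p
                 \<le> (INF z\<in>rcball p B. alpha p K Obs n R i z)) \<and>
        (\<forall>i<p. ennreal (min 1 (lp\<^sup>2)) * cross_sum p K Obs n N L Lm R B i
                 \<le> ennreal (2 * B\<^sup>2 * (lp - lm)\<^sup>2)) \<and>
        (\<forall>i<L. 2 \<le> card (Lm i))
      \<longrightarrow>
        ennreal c *
          ((SUP z\<in>rcball p B.
              ennreal (R\<^sup>2 / max 1 lm) * (\<Sum>i<p. 1 / ennreal (alpha p K Obs n R i z)))
           + ennreal (min (1 / lp\<^sup>2) 1) * (MAX i\<in>{..<p}. cross_sum p K Obs n N L Lm R B i))
        \<le> (INF bhat\<in>estimators p K Obs n N (P_OSS p R B lm lp chi C \<kappa> CX).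
             SUP P\<in>P_OSS_Gauss p R B lm lp chi C \<kappa> CX. risk p K Obs n N bhat P))"
proof (rule exI[of _ "1 / 1024"], intro conjI allI impI INF_greatest; (elim conjE)?)
  show "0 < (1 / 1024 :: real)" by simp
next
  fix p K :: nat and Obs :: "nat \<Rightarrow> nat set" and n :: "nat \<Rightarrow> nat" and N L :: nat and Lm :: "nat \<Rightarrow> nat set"
    and R B lm lp chi C \<kappa> CX :: real and bhat :: "full_data \<Rightarrow> nat \<Rightarrow> real"
  assume p: "1 \<le> p" and Obs: "\<forall>k<K. Obs k \<subseteq> {..<p}" and mods: "modalities p K Obs L Lm"
    and R: "0 < R" and B: "0 < B" and lm: "0 < lm" "lm \<le> lp" "lm < lp"
    and cst: "0 < chi" "chi \<le> 1" "1 \<le> C" "0 < CX" "sqrt (8 * lp / 3) \<le> CX" "105 powr (1 / 4) \<le> \<kappa>"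
    and al: "\<forall>i<p. (1 / 2) * max (1 / lm) lm * max (R\<^sup>2 / B\<^sup>2) (B\<^sup>2 / R\<^sup>2) * real p \<le> (INF z\<in>rcball p B. alpha p K Obs n R i z)"
    and cross: "\<forall>i<p. ennreal (min 1 (lp\<^sup>2)) * cross_sum p K Obs n N L Lm R B i \<le> ennreal (2 * B\<^sup>2 * (lp - lm)\<^sup>2)"
    and two: "\<forall>i<L. 2 \<le> card (Lm i)"
    and bhat: "bhat \<in> estimators p K Obs n N (P_OSS p R B lm lp chi C \<kappa> CX)"
  let ?T = "SUP P\<in>P_OSS_Gauss p R B lm lp chi C \<kappa> CX. risk p K Obs n N bhat P"
  let ?A = "SUP z\<in>rcball p B. ennreal (R\<^sup>2 / max 1 lm) * (\<Sum>i<p. 1 / ennreal (alpha p K Obs n R i z))"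
  let ?M = "MAX i\<in>{..<p}. cross_sum p K Obs n N L Lm R B i"
  have Lm: "refines_patterns p K Obs (Lm ` {..<L})" "inj_on Lm {..<L}"
    using mods by (auto simp: modalities_def)
  have A: "ennreal (1 / 96) * ?A \<le> ?T"
    unfolding SUP_mult_left_ennreal
  proof (rule SUP_least)
    fix z assume z: "z \<in> rcball p B"
    have "(INF z\<in>rcball p B. alpha p K Obs n R i z) \<le> alpha p K Obs n R i z" for i
      by (rule cINF_lower[OF _ z]) (auto intro!: bdd_belowI2[where m = 0] alpha_nonneg R)
    then have al': "(1 / 2) * max (1 / lm) lm * max (R\<^sup>2 / B\<^sup>2) (B\<^sup>2 / R\<^sup>2) * real p \<le> alpha p K Obs n R i z" if "i < p" for i
      using al that order_trans by blast
    show "ennreal (1 / 96) * (ennreal (R\<^sup>2 / max 1 lm) * (\<Sum>i<p. 1 / ennreal (alpha p K Obs n R i z))) \<le> ?T"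
      by (rule labelled_lower_bound[OF p _ Lm(1) _ R B lm(1,2) cst z al' bhat]) (use Obs two in auto)
  qed
  have p2: "2 \<le> p"
  proof -
    have "partition_on {..<p} (Lm ` {..<L})" using Lm(1) by (simp add: refines_patterns_def)
    from xi_props[OF this Lm(2), of 0] p have "xi L Lm 0 < L" by simp
    moreover have "Lm (xi L Lm 0) \<subseteq> {..<p}"
      using \<open>partition_on {..<p} (Lm ` {..<L})\<close> calculation by (auto simp: partition_on_def)
    ultimately show ?thesis using two card_mono[of "{..<p}" "Lm (xi L Lm 0)"] by fastforce
  qed
  have "?M \<in> (\<lambda>i. cross_sum p K Obs n N L Lm R B i) ` {..<p}" using p by (intro Max_in) (auto simp: lessThan_empty_iff)
  then obtain i where i: "i < p" "?M = cross_sum p K Obs n N L Lm R B i" by auto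
  have M: "ennreal (1 / 512) * (ennreal (min (1 / lp\<^sup>2) 1) * ?M) \<le> ?T"
    unfolding i(2)
    by (rule cross_lower_bound[OF i(1) p2 _ Lm R B lm(1,3) cst _ bhat]) (use Obs cross i in auto)
  have half: "ennreal (1 / 1024) = ennreal (1 / 2) * ennreal (1 / 512)" by (subst ennreal_mult[symmetric]) auto
  have "ennreal (1 / 1024) * (?A + ennreal (min (1 / lp\<^sup>2) 1) * ?M)
     = ennreal (1 / 1024) * ?A + ennreal (1 / 1024) * (ennreal (min (1 / lp\<^sup>2) 1) * ?M)"
    by (rule distrib_left)
  also have "\<dots> = ennreal (1 / 2) * (ennreal (1 / 512) * ?A) + ennreal (1 / 2) * (ennreal (1 / 512) * (ennreal (min (1 / lp\<^sup>2) 1) * ?M))"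
    by (simp only: half mult.assoc)
  also have "\<dots> \<le> ennreal (1 / 2) * ?T + ennreal (1 / 2) * ?T"
  proof (intro add_mono mult_left_mono M)
    have "ennreal (1 / 512) * ?A \<le> ennreal (1 / 96) * ?A" by (intro mult_right_mono ennreal_leI) auto
    then show "ennreal (1 / 512) * ?A \<le> ?T" using A by (rule order_trans)
  qed auto
  also have "\<dots> = ennreal (1 / 2 + 1 / 2) * ?T"
    unfolding distrib_right[symmetric] by (subst ennreal_plus[symmetric]) auto
  also have "\<dots> = ?T" by simp
  finally show "ennreal (1 / 1024) * (?A + ennreal (min (1 / lp\<^sup>2) 1) * ?M) \<le> ?T" .
qed

end
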